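(* Let $\mu\le\omega_1$ and $\kappa$ be cardinals, and suppose that the colouring $c:[\omega_2]^2\to\mu$ establishes $\omega_2\not\rightarrow[(\omega_1;\omega)]^2_\mu$. Then $$V^{Fn(\kappa,2)}\models\text{``$c$ establishes } \omega_2\not\rightarrow[(\omega_1;\omega)]^2_\mu\text{''}.$$
   Context: $[X]^2$ is the set of two-element subsets of $X$. For sets $A,B$ of ordinals, $[A,B]=\{\{\alpha,\beta\}:\alpha\in A,\ \beta\in B,\ \alpha\ne\beta\}$, and $c''[A,B]$ is the image of this set under $c$. A function $c:[\omega_2]^2\to\mu$ establishes $\omega_2\not\rightarrow[(\omega_1;\omega)]^2_\mu$ if $c''[A,B]=\mu$ whenever $A\subseteq\omega_2$ has order type $\omega_1$, $B\subseteq\omega_2$ has order type $\omega$, and every element of $A$ is smaller than every element of $B$. $Fn(\kappa,2)$ is the Cohen poset of all finite partial functions from $\kappa$ to $2$ ordered by reverse inclusion, and $V^{Fn(\kappa,2)}$ denotes a generic extension of the ground model $V$ by it. *)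

theory Defs
  imports Main
begin

section \<open>The ground model\<close>

text \<open>
  The universe of sets, with \<open>elts x\<close> the class of members of \<open>x\<close>. Classes are HOL sets
  of elements of the universe, so the Separation and Replacement schemes become single axioms, and
  Foundation is stated for classes. The empty set comes from Infinity; the axiom of choice
  follows from Replacement and Hilbert choice in HOL.
\<close>

class zfc =
  fixes elts :: "'a \<Rightarrow> 'a set"
  assumes extensionality: "elts x = elts y \<Longrightarrow> x = y"
    and foundation: "wf {(x, y). x \<in> elts y}"
    and pairing: "\<exists>z. elts z = {x, y}"
    and union: "\<exists>y. elts y = (\<Union>z\<in>elts x. elts z)"
    and powerset: "\<exists>y. elts y = {z. elts z \<subseteq> elts x}"
    and separation: "\<exists>y. elts y = {z \<in> elts x. Q z}"
    and replacement: "\<exists>y. elts y = F ` elts x"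
    and infinity: "\<exists>x. (\<exists>e\<in>elts x. elts e = {}) \<and>
                       (\<forall>y\<in>elts x. \<exists>z\<in>elts x. elts z = insert y (elts y))"

text \<open>The set with the given members; meaningful only if the class \<open>X\<close> is a set.\<close>

definition vset :: "'v::zfc set \<Rightarrow> 'v" where
  "vset X = (THE x. elts x = X)"

definition vpair :: "'v::zfc \<Rightarrow> 'v \<Rightarrow> 'v" where
  "vpair x y = vset {vset {x}, vset {x, y}}"

lemma vset_eqI: "elts x = X \<Longrightarrow> vset X = x"
  unfolding vset_def by (rule the_equality) (auto intro: extensionality)

lemma elts_vset: "elts x = X \<Longrightarrow> elts (vset X) = X"
  by (simp add: vset_eqI)

lemma elts_vset_pair: "elts (vset {x, y}) = {x, y}"
  using pairing[of x y] elts_vset by blast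

lemma elts_vset_sing: "elts (vset {x}) = {x}"
  using elts_vset_pair[of x x] by simp

lemma elts_vpair: "elts (vpair x y) = {vset {x}, vset {x, y}}"
  unfolding vpair_def by (rule elts_vset_pair)

definition elem_rel :: "('v::zfc \<times> 'v) set" where
  "elem_rel = {(x, y). x \<in> elts y}"

lemma wf_elem_rel: "wf elem_rel"
  unfolding elem_rel_def by (rule foundation)

lemma vpair_elem_trancl:
  assumes "vpair x r \<in> elts y"
  shows "(x, y) \<in> elem_rel\<^sup>+"
proof -
  have "(x, vset {x}) \<in> elem_rel" "(vset {x}, vpair x r) \<in> elem_rel" "(vpair x r, y) \<in> elem_rel"
    using assms by (simp_all add: elem_rel_def elts_vset_sing elts_vpair)
  then show ?thesis by (meson trancl.simps)
qed


section \<open>The first-order language of set theory\<close>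

text \<open>
  Formulas with parameters from \<open>'a\<close>, using higher-order abstract syntax. The concrete formulas
  below are polymorphic in \<open>'a\<close>, without any class constraint, and so are formulas of the
  pure language: only the connectives, \<open>\<in>\<close> and \<open>=\<close> occur.
\<close>

datatype 'a fm =
    Mem 'a 'a (infix "\<^bold>\<in>" 50)
  | Eq 'a 'a (infix "\<^bold>=" 50)
  | Neg "'a fm" ("\<^bold>\<not> _" [40] 40)
  | Conj "'a fm" "'a fm" (infixr "\<^bold>\<and>" 35)
  | Forall "'a \<Rightarrow> 'a fm" (binder "\<^bold>\<forall>" 10)

definition Disj :: "'a fm \<Rightarrow> 'a fm \<Rightarrow> 'a fm" (infixr "\<^bold>\<or>" 30) where
  "(\<phi> \<^bold>\<or> \<psi>) = (\<^bold>\<not> (\<^bold>\<not> \<phi> \<^bold>\<and> \<^bold>\<not> \<psi>))"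

definition Imp :: "'a fm \<Rightarrow> 'a fm \<Rightarrow> 'a fm" (infixr "\<^bold>\<longrightarrow>" 25) where
  "(\<phi> \<^bold>\<longrightarrow> \<psi>) = (\<^bold>\<not> (\<phi> \<^bold>\<and> \<^bold>\<not> \<psi>))"

definition Iff :: "'a fm \<Rightarrow> 'a fm \<Rightarrow> 'a fm" (infixr "\<^bold>\<longleftrightarrow>" 25) where
  "(\<phi> \<^bold>\<longleftrightarrow> \<psi>) = ((\<phi> \<^bold>\<longrightarrow> \<psi>) \<^bold>\<and> (\<psi> \<^bold>\<longrightarrow> \<phi>))"

definition Exists :: "('a \<Rightarrow> 'a fm) \<Rightarrow> 'a fm" (binder "\<^bold>\<exists>" 10) where
  "Exists \<phi> = (\<^bold>\<not> (\<^bold>\<forall>x. \<^bold>\<not> \<phi> x))"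

text \<open>Truth in the ground model.\<close>

primrec V_models :: "'v::zfc fm \<Rightarrow> bool" where
  "V_models (x \<^bold>\<in> y) \<longleftrightarrow> x \<in> elts y"
| "V_models (x \<^bold>= y) \<longleftrightarrow> x = y"
| "V_models (\<^bold>\<not> \<phi>) \<longleftrightarrow> \<not> V_models \<phi>"
| "V_models (\<phi> \<^bold>\<and> \<psi>) \<longleftrightarrow> V_models \<phi> \<and> V_models \<psi>"
| "V_models (Forall \<phi>) \<longleftrightarrow> (\<forall>x. V_models (\<phi> x))"


section \<open>The partition relation as a formula\<close>

definition subset_fm :: "'a \<Rightarrow> 'a \<Rightarrow> 'a fm" where
  "subset_fm x y = (\<^bold>\<forall>z. z \<^bold>\<in> x \<^bold>\<longrightarrow> z \<^bold>\<in> y)"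

text \<open>\<open>s = {x, y}\<close>\<close>

definition upair_fm :: "'a \<Rightarrow> 'a \<Rightarrow> 'a \<Rightarrow> 'a fm" where
  "upair_fm s x y = (\<^bold>\<forall>z. z \<^bold>\<in> s \<^bold>\<longleftrightarrow> z \<^bold>= x \<^bold>\<or> z \<^bold>= y)"

text \<open>\<open>p = (x, y)\<close>, Kuratowski pair\<close>

definition opair_fm :: "'a \<Rightarrow> 'a \<Rightarrow> 'a \<Rightarrow> 'a fm" where
  "opair_fm p x y = (\<^bold>\<exists>s. \<^bold>\<exists>d. upair_fm s x x \<^bold>\<and> upair_fm d x y \<^bold>\<and> upair_fm p s d)"

text \<open>\<open>(x, y) \<in> f\<close>\<close>

definition app_fm :: "'a \<Rightarrow> 'a \<Rightarrow> 'a \<Rightarrow> 'a fm" where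
  "app_fm f x y = (\<^bold>\<exists>p. opair_fm p x y \<^bold>\<and> p \<^bold>\<in> f)"

text \<open>\<open>f\<close> is a function from \<open>X\<close> to \<open>Y\<close>\<close>

definition fun_fm :: "'a \<Rightarrow> 'a \<Rightarrow> 'a \<Rightarrow> 'a fm" where
  "fun_fm f X Y =
     ((\<^bold>\<forall>p. p \<^bold>\<in> f \<^bold>\<longrightarrow> (\<^bold>\<exists>x. \<^bold>\<exists>y. x \<^bold>\<in> X \<^bold>\<and> y \<^bold>\<in> Y \<^bold>\<and> opair_fm p x y)) \<^bold>\<and>
      (\<^bold>\<forall>x. x \<^bold>\<in> X \<^bold>\<longrightarrow> (\<^bold>\<exists>y. app_fm f x y \<^bold>\<and> (\<^bold>\<forall>z. app_fm f x z \<^bold>\<longrightarrow> z \<^bold>= y))))"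

definition bij_fm :: "'a \<Rightarrow> 'a \<Rightarrow> 'a \<Rightarrow> 'a fm" where
  "bij_fm f X Y =
     (fun_fm f X Y \<^bold>\<and>
      (\<^bold>\<forall>x. \<^bold>\<forall>x'. \<^bold>\<forall>y. app_fm f x y \<^bold>\<and> app_fm f x' y \<^bold>\<longrightarrow> x \<^bold>= x') \<^bold>\<and>
      (\<^bold>\<forall>y. y \<^bold>\<in> Y \<^bold>\<longrightarrow> (\<^bold>\<exists>x. app_fm f x y)))"

text \<open>\<open>a\<close> is transitive and strictly well-ordered by \<open>\<in>\<close>\<close>

definition Ord_fm :: "'a \<Rightarrow> 'a fm" where
  "Ord_fm a =
     ((\<^bold>\<forall>x. x \<^bold>\<in> a \<^bold>\<longrightarrow> subset_fm x a) \<^bold>\<and>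
      (\<^bold>\<forall>x. x \<^bold>\<in> a \<^bold>\<longrightarrow> \<^bold>\<not> x \<^bold>\<in> x) \<^bold>\<and>
      (\<^bold>\<forall>x. \<^bold>\<forall>y. \<^bold>\<forall>z. x \<^bold>\<in> a \<^bold>\<and> y \<^bold>\<in> a \<^bold>\<and> z \<^bold>\<in> a \<^bold>\<and> x \<^bold>\<in> y \<^bold>\<and> y \<^bold>\<in> z \<^bold>\<longrightarrow> x \<^bold>\<in> z) \<^bold>\<and>
      (\<^bold>\<forall>s. subset_fm s a \<^bold>\<and> (\<^bold>\<exists>x. x \<^bold>\<in> s) \<^bold>\<longrightarrow>
         (\<^bold>\<exists>m. m \<^bold>\<in> s \<^bold>\<and> (\<^bold>\<forall>x. x \<^bold>\<in> s \<^bold>\<longrightarrow> m \<^bold>= x \<^bold>\<or> m \<^bold>\<in> x))))"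

text \<open>Nonzero limit ordinals; \<open>\<omega>\<close> is the least of them.\<close>

definition Limit_fm :: "'a \<Rightarrow> 'a fm" where
  "Limit_fm a =
     (Ord_fm a \<^bold>\<and> (\<^bold>\<exists>x. x \<^bold>\<in> a) \<^bold>\<and> (\<^bold>\<forall>x. x \<^bold>\<in> a \<^bold>\<longrightarrow> (\<^bold>\<exists>y. y \<^bold>\<in> a \<^bold>\<and> x \<^bold>\<in> y)))"

definition omega_fm :: "'a \<Rightarrow> 'a fm" where
  "omega_fm w = (Limit_fm w \<^bold>\<and> (\<^bold>\<forall>x. x \<^bold>\<in> w \<^bold>\<longrightarrow> \<^bold>\<not> Limit_fm x))"

definition Card_fm :: "'a \<Rightarrow> 'a fm" where
  "Card_fm k = (Ord_fm k \<^bold>\<and> (\<^bold>\<forall>x. x \<^bold>\<in> k \<^bold>\<longrightarrow> \<^bold>\<not> (\<^bold>\<exists>f. bij_fm f x k)))"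

text \<open>\<open>l\<close> is the least cardinal above \<open>k\<close>\<close>

definition csucc_fm :: "'a \<Rightarrow> 'a \<Rightarrow> 'a fm" where
  "csucc_fm k l =
     (Card_fm l \<^bold>\<and> k \<^bold>\<in> l \<^bold>\<and> (\<^bold>\<forall>m. m \<^bold>\<in> l \<^bold>\<and> Card_fm m \<^bold>\<longrightarrow> \<^bold>\<not> k \<^bold>\<in> m))"

definition omega1_fm :: "'a \<Rightarrow> 'a fm" where
  "omega1_fm w1 = (\<^bold>\<exists>w. omega_fm w \<^bold>\<and> csucc_fm w w1)"

definition omega2_fm :: "'a \<Rightarrow> 'a fm" where
  "omega2_fm w2 = (\<^bold>\<exists>w1. omega1_fm w1 \<^bold>\<and> csucc_fm w1 w2)"

text \<open>The set \<open>A\<close> of ordinals has order type \<open>a\<close>.\<close>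

definition otp_fm :: "'a \<Rightarrow> 'a \<Rightarrow> 'a fm" where
  "otp_fm A a =
     (Ord_fm a \<^bold>\<and>
      (\<^bold>\<exists>f. bij_fm f a A \<^bold>\<and>
         (\<^bold>\<forall>x. \<^bold>\<forall>y. \<^bold>\<forall>u. \<^bold>\<forall>v. app_fm f x u \<^bold>\<and> app_fm f y v \<^bold>\<longrightarrow> (x \<^bold>\<in> y \<^bold>\<longleftrightarrow> u \<^bold>\<in> v))))"

text \<open>\<open>D = {{x, y}: x \<in> A, y \<in> B, x \<noteq> y}\<close>; in particular \<open>[X]\<^sup>2\<close> is \<open>[X, X]\<close>.\<close>

definition rect_fm :: "'a \<Rightarrow> 'a \<Rightarrow> 'a \<Rightarrow> 'a fm" where
  "rect_fm D A B =
     (\<^bold>\<forall>s. s \<^bold>\<in> D \<^bold>\<longleftrightarrow> (\<^bold>\<exists>x. \<^bold>\<exists>y. x \<^bold>\<in> A \<^bold>\<and> y \<^bold>\<in> B \<^bold>\<and> \<^bold>\<not> x \<^bold>= y \<^bold>\<and> upair_fm s x y))"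

text \<open>\<open>c``D = m\<close>\<close>

definition image_fm :: "'a \<Rightarrow> 'a \<Rightarrow> 'a \<Rightarrow> 'a fm" where
  "image_fm c D m = (\<^bold>\<forall>y. y \<^bold>\<in> m \<^bold>\<longleftrightarrow> (\<^bold>\<exists>s. s \<^bold>\<in> D \<^bold>\<and> app_fm c s y))"

text \<open>
  \<open>c: [\<omega>\<^sub>2]\<^sup>2 \<rightarrow> m\<close> establishes the negative relation with the pattern \<open>(\<omega>\<^sub>1; \<omega>)\<close> and \<open>m\<close> colours.
  The cardinals \<open>\<omega>\<close>, \<open>\<omega>\<^sub>1\<close>, \<open>\<omega>\<^sub>2\<close> are not parameters: they are those of the model in which
  the formula is evaluated.
\<close>

definition establishes_fm :: "'a \<Rightarrow> 'a \<Rightarrow> 'a fm" where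
  "establishes_fm c m =
     (\<^bold>\<exists>w. \<^bold>\<exists>w1. \<^bold>\<exists>w2. omega_fm w \<^bold>\<and> omega1_fm w1 \<^bold>\<and> omega2_fm w2 \<^bold>\<and>
        (\<^bold>\<exists>D. rect_fm D w2 w2 \<^bold>\<and> fun_fm c D m) \<^bold>\<and>
        (\<^bold>\<forall>A. \<^bold>\<forall>B. subset_fm A w2 \<^bold>\<and> otp_fm A w1 \<^bold>\<and>
                subset_fm B w2 \<^bold>\<and> otp_fm B w \<^bold>\<and>
                (\<^bold>\<forall>x. \<^bold>\<forall>y. x \<^bold>\<in> A \<^bold>\<and> y \<^bold>\<in> B \<^bold>\<longrightarrow> x \<^bold>\<in> y) \<^bold>\<longrightarrow>
                (\<^bold>\<exists>D. rect_fm D A B \<^bold>\<and> image_fm c D m)))"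


section \<open>Forcing\<close>

text \<open>\<open>le P p q\<close> means that \<open>p\<close> is the stronger condition.\<close>

record 'v forcing_notion =
  conds :: "'v set"
  le :: "'v \<Rightarrow> 'v \<Rightarrow> bool"
  weakest :: 'v

inductive is_name :: "('v::zfc) forcing_notion \<Rightarrow> 'v \<Rightarrow> bool" for P where
  "(\<forall>z\<in>elts \<tau>. \<exists>\<sigma> p. z = vpair \<sigma> p \<and> p \<in> conds P \<and> is_name P \<sigma>) \<Longrightarrow> is_name P \<tau>"

function check :: "('v::zfc) forcing_notion \<Rightarrow> 'v \<Rightarrow> 'v" where
  "check P x = vset ((\<lambda>y. vpair (check P y) (weakest P)) ` elts x)"
  by auto
termination
  by (relation "inv_image elem_rel snd") (auto simp: wf_elem_rel, simp add: elem_rel_def)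

declare check.simps [simp del]

definition dense_below :: "'v forcing_notion \<Rightarrow> 'v \<Rightarrow> 'v set \<Rightarrow> bool" where
  "dense_below P p X \<longleftrightarrow>
     (\<forall>q\<in>conds P. le P q p \<longrightarrow> (\<exists>s\<in>conds P. le P s q \<and> s \<in> X))"

lemma dense_below_cong [fundef_cong]:
  assumes "P = P'" "p = p'" "\<And>s. s \<in> X \<longleftrightarrow> s \<in> X'"
  shows "dense_below P p X = dense_below P' p' X'"
  using assms by (simp add: dense_below_def)

declare conj_cong [fundef_cong]

text \<open>
  The forcing relation for atomic formulas, by recursion on names: \<open>p\<close> forces \<open>\<sigma> = \<tau>\<close> iff
  every \<open>q \<le> p, r\<close> with \<open>(\<rho>, r) \<in> \<sigma>\<close> forces \<open>\<rho> \<in> \<tau>\<close>, and symmetrically, where forcing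
  of \<open>\<rho> \<in> \<tau>\<close> is unfolded to its clause \<open>forces_mem\<close> below.
\<close>

function forces_eq :: "('v::zfc) forcing_notion \<Rightarrow> 'v \<Rightarrow> 'v \<Rightarrow> 'v \<Rightarrow> bool" where
  "forces_eq P p \<sigma> \<tau> \<longleftrightarrow>
     (\<forall>\<rho> r q. vpair \<rho> r \<in> elts \<sigma> \<longrightarrow> q \<in> conds P \<and> le P q p \<and> le P q r \<longrightarrow>
        dense_below P q
          {s. \<exists>\<pi> t. vpair \<pi> t \<in> elts \<tau> \<and> le P s t \<and> forces_eq P s \<rho> \<pi>}) \<and>
     (\<forall>\<pi> t q. vpair \<pi> t \<in> elts \<tau> \<longrightarrow> q \<in> conds P \<and> le P q p \<and> le P q t \<longrightarrow>
        dense_below P q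
          {s. \<exists>\<rho> r. vpair \<rho> r \<in> elts \<sigma> \<and> le P s r \<and> forces_eq P s \<rho> \<pi>})"
  by pat_completeness auto
termination
  by (relation "inv_image (elem_rel\<^sup>+) (\<lambda>(P, p, \<sigma>, \<tau>). \<sigma>)")
     (auto simp: wf_trancl wf_elem_rel intro: vpair_elem_trancl)

declare forces_eq.simps [simp del]

definition forces_mem :: "('v::zfc) forcing_notion \<Rightarrow> 'v \<Rightarrow> 'v \<Rightarrow> 'v \<Rightarrow> bool" where
  "forces_mem P p \<sigma> \<tau> \<longleftrightarrow>
     dense_below P p {s. \<exists>\<pi> t. vpair \<pi> t \<in> elts \<tau> \<and> le P s t \<and> forces_eq P s \<sigma> \<pi>}"

primrec forces :: "('v::zfc) forcing_notion \<Rightarrow> 'v \<Rightarrow> 'v fm \<Rightarrow> bool" where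
  "forces P p (\<sigma> \<^bold>\<in> \<tau>) \<longleftrightarrow> forces_mem P p \<sigma> \<tau>"
| "forces P p (\<sigma> \<^bold>= \<tau>) \<longleftrightarrow> forces_eq P p \<sigma> \<tau>"
| "forces P p (\<^bold>\<not> \<phi>) \<longleftrightarrow> (\<forall>q\<in>conds P. le P q p \<longrightarrow> \<not> forces P q \<phi>)"
| "forces P p (\<phi> \<^bold>\<and> \<psi>) \<longleftrightarrow> forces P p \<phi> \<and> forces P p \<psi>"
| "forces P p (Forall \<phi>) \<longleftrightarrow> (\<forall>\<tau>. is_name P \<tau> \<longrightarrow> forces P p (\<phi> \<tau>))"

text \<open>
  Truth in the generic extension by \<open>P\<close>, whichever generic filter is taken: all conditions,
  equivalently the weakest one, force the formula.
\<close>

definition ext_models :: "('v::zfc) forcing_notion \<Rightarrow> 'v fm \<Rightarrow> bool" where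
  "ext_models P \<phi> \<longleftrightarrow> (\<forall>p\<in>conds P. forces P p \<phi>)"

text \<open>Finite partial functions from \<open>\<kappa>\<close> to \<open>2 = {\<emptyset>, {\<emptyset>}}\<close>, ordered by reverse inclusion.\<close>

definition Fn :: "'v::zfc \<Rightarrow> 'v forcing_notion" where
  "Fn \<kappa> =
     \<lparr>conds = {p. finite (elts p) \<and>
         (\<forall>z\<in>elts p. \<exists>\<xi>\<in>elts \<kappa>. \<exists>i\<in>{vset {}, vset {vset {}}}. z = vpair \<xi> i) \<and>
         (\<forall>\<xi> i j. vpair \<xi> i \<in> elts p \<and> vpair \<xi> j \<in> elts p \<longrightarrow> i = j)},
      le = (\<lambda>p q. elts q \<subseteq> elts p),
      weakest = vset {}\<rparr>"

end

theory Submission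
  imports Defs "HOL-Library.Countable_Set"
begin

text \<open>
  Let \<open>p\<close> force that \<open>A\<close> and \<open>B\<close> are as in the relation, and fix a colour. For \<open>\<alpha> < \<omega>\<^sub>1\<close> let
  \<open>p\<^sub>\<alpha> \<le> p\<close> decide the \<open>\<alpha>\<close>-th element of \<open>A\<close> to be \<open>a\<^sub>\<alpha>\<close>. A weak form of the Delta-system lemma gives a
  condition \<open>r\<close> and an uncountable \<open>S\<close> such that \<open>p\<^sub>\<alpha> \<le> r\<close> for \<open>\<alpha> \<in> S\<close> and every \<open>s \<le> r\<close> is compatible with
  all but countably many of these \<open>p\<^sub>\<alpha>\<close>; in particular the poset is ccc and preserves \<open>\<omega>\<^sub>1\<close> and \<open>\<omega>\<^sub>2\<close>.
  The set of \<open>b\<close> that some \<open>s\<^sub>b \<le> r\<close> forces into \<open>B\<close> has no largest element, so it contains a ground model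
  set of type \<open>\<omega>\<close>. After removing countably many \<open>\<alpha>\<close> from \<open>S\<close>, every \<open>p\<^sub>\<alpha>\<close> is compatible with every
  \<open>s\<^sub>b\<close>, and the \<open>a\<^sub>\<alpha>\<close> contain a set of type \<open>\<omega>\<^sub>1\<close> below all these \<open>b\<close>. In the ground model the colour is
  attained at some pair \<open>a\<^sub>\<alpha>, b\<close>, and a common extension of \<open>p\<^sub>\<alpha>\<close> and \<open>s\<^sub>b\<close> puts this pair into \<open>[A, B]\<close>.
\<close>

section \<open>The forcing relation\<close>

text \<open>No generic filter occurs: an argument in the extension becomes one about conditions and
  names, and an existential statement yields a witness only below a stronger condition. In general
  neither \<open>A\<close> nor \<open>B\<close> contains a ground model set of its order type, so
  sets of merely possible values take their place. These values are decided by different conditions,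
  and the ground model colouring may pick any pair of them; hence each condition used for
  \<open>A\<close> must be compatible with each one used for \<open>B\<close>. The asymmetry of the
  two types makes this possible: a condition used for \<open>B\<close> rules out countably many
  \<alpha>, and only countably many such conditions are used. The values
  \<open>a\<^sub>\<alpha>\<close> need neither be distinct nor increase with \<alpha>; but equal
  values at different indices have incompatible conditions, so each value occurs countably often and
  uncountably many values remain. A pair of chosen values is in increasing order because a common
  extension puts it into \<open>A\<close> and \<open>B\<close>. Cardinals must be preserved because
  the formula speaks of the extension's own \<open>\<omega>\<^sub>1\<close> and
  \<open>\<omega>\<^sub>2\<close>.\<close>

locale forcing_poset =
  fixes P :: "'v::zfc forcing_notion"
  assumes le_refl: "le P p p"
    and le_trans: "le P p q \<Longrightarrow> le P q r \<Longrightarrow> le P p r"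
    and weakest_cond: "weakest P \<in> conds P"
    and le_weakest: "le P p (weakest P)"
    and small_conds: "\<exists>x. elts x = conds P"
begin

text \<open>\<open>le\<close> is a relation on the whole universe, so the left argument has to be
  required to be a condition. Nothing is required of the right one, which may be any set that occurs
  as a label in a name.\<close>

definition stronger :: "'v \<Rightarrow> 'v \<Rightarrow> bool" (infix "\<preceq>" 50) where
  "q \<preceq> p \<longleftrightarrow> q \<in> conds P \<and> le P q p"

abbreviation forces_in :: "'v \<Rightarrow> 'v fm \<Rightarrow> bool" (infix "\<tturnstile>" 50) where
  "p \<tturnstile> \<phi> \<equiv> forces P p \<phi>"

abbreviation chk :: "'v \<Rightarrow> 'v" where
  "chk \<equiv> check P"

lemma stronger_refl: "p \<in> conds P \<Longrightarrow> p \<preceq> p"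
  by (simp add: stronger_def le_refl)

lemma stronger_cond: "q \<preceq> p \<Longrightarrow> q \<in> conds P"
  by (simp add: stronger_def)

lemma stronger_trans [trans]: "r \<preceq> q \<Longrightarrow> q \<preceq> p \<Longrightarrow> r \<preceq> p"
  using le_trans by (auto simp: stronger_def)

lemma stronger_self: "q \<preceq> p \<Longrightarrow> q \<preceq> q"
  by (simp add: stronger_def le_refl)

lemma stronger_weakest: "p \<in> conds P \<Longrightarrow> p \<preceq> weakest P"
  by (simp add: stronger_def le_weakest)

section \<open>Atomic formulas: forced equality and membership of names\<close>

lemma dense_below_iff: "dense_below P p X \<longleftrightarrow> (\<forall>q. q \<preceq> p \<longrightarrow> (\<exists>s. s \<preceq> q \<and> s \<in> X))"
  by (auto simp: dense_below_def stronger_def)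

text \<open>The range of \<open>q\<close> is closed under passing to stronger conditions, so one
  witness below each \<open>q\<close> already amounts to density below each \<open>q\<close>. This
  removes \<open>dense_below\<close> from the recursion.\<close>

lemma forces_eq_iff:
  "forces_eq P p \<sigma> \<tau> \<longleftrightarrow>
     (\<forall>\<rho> r q. vpair \<rho> r \<in> elts \<sigma> \<longrightarrow> q \<preceq> p \<longrightarrow> q \<preceq> r \<longrightarrow>
        (\<exists>s \<pi> t. s \<preceq> q \<and> vpair \<pi> t \<in> elts \<tau> \<and> s \<preceq> t \<and> forces_eq P s \<rho> \<pi>)) \<and>
     (\<forall>\<pi> t q. vpair \<pi> t \<in> elts \<tau> \<longrightarrow> q \<preceq> p \<longrightarrow> q \<preceq> t \<longrightarrow>
        (\<exists>s \<rho> r. s \<preceq> q \<and> vpair \<rho> r \<in> elts \<sigma> \<and> s \<preceq> r \<and> forces_eq P s \<rho> \<pi>))"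
proof -
  have *: "(\<forall>\<rho> r q. vpair \<rho> r \<in> elts \<sigma> \<longrightarrow> q \<in> conds P \<and> le P q p \<and> le P q r \<longrightarrow>
        dense_below P q {s. \<exists>\<pi> t. vpair \<pi> t \<in> elts \<tau> \<and> le P s t \<and> Q s \<rho> \<pi>}) \<longleftrightarrow>
     (\<forall>\<rho> r q. vpair \<rho> r \<in> elts \<sigma> \<longrightarrow> q \<preceq> p \<longrightarrow> q \<preceq> r \<longrightarrow>
        (\<exists>s \<pi> t. s \<preceq> q \<and> vpair \<pi> t \<in> elts \<tau> \<and> s \<preceq> t \<and> Q s \<rho> \<pi>))" for \<sigma> \<tau> :: 'v and Q
  proof (intro iffI allI impI)
    fix \<rho> r q
    assume "\<forall>\<rho> r q. vpair \<rho> r \<in> elts \<sigma> \<longrightarrow> q \<in> conds P \<and> le P q p \<and> le P q r \<longrightarrow>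
        dense_below P q {s. \<exists>\<pi> t. vpair \<pi> t \<in> elts \<tau> \<and> le P s t \<and> Q s \<rho> \<pi>}"
      and "vpair \<rho> r \<in> elts \<sigma>" "q \<preceq> p" "q \<preceq> r"
    then have "dense_below P q {s. \<exists>\<pi> t. vpair \<pi> t \<in> elts \<tau> \<and> le P s t \<and> Q s \<rho> \<pi>}"
      unfolding stronger_def by blast
    with \<open>q \<preceq> p\<close> show "\<exists>s \<pi> t. s \<preceq> q \<and> vpair \<pi> t \<in> elts \<tau> \<and> s \<preceq> t \<and> Q s \<rho> \<pi>"
      unfolding dense_below_def stronger_def using le_refl by blast
  next
    fix \<rho> r q
    assume *: "\<forall>\<rho> r q. vpair \<rho> r \<in> elts \<sigma> \<longrightarrow> q \<preceq> p \<longrightarrow> q \<preceq> r \<longrightarrow>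
        (\<exists>s \<pi> t. s \<preceq> q \<and> vpair \<pi> t \<in> elts \<tau> \<and> s \<preceq> t \<and> Q s \<rho> \<pi>)"
      and "vpair \<rho> r \<in> elts \<sigma>" and q: "q \<in> conds P \<and> le P q p \<and> le P q r"
    show "dense_below P q {s. \<exists>\<pi> t. vpair \<pi> t \<in> elts \<tau> \<and> le P s t \<and> Q s \<rho> \<pi>}"
      unfolding dense_below_iff
    proof (intro allI impI)
      fix q' assume "q' \<preceq> q"
      moreover have "q' \<preceq> p" "q' \<preceq> r"
        using \<open>q' \<preceq> q\<close> q le_trans unfolding stronger_def by blast+
      ultimately obtain s \<pi> t where "s \<preceq> q'" "vpair \<pi> t \<in> elts \<tau>" "s \<preceq> t" "Q s \<rho> \<pi>"
        using * \<open>vpair \<rho> r \<in> elts \<sigma>\<close> by blast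
      then show "\<exists>s. s \<preceq> q' \<and> s \<in> {s. \<exists>\<pi> t. vpair \<pi> t \<in> elts \<tau> \<and> le P s t \<and> Q s \<rho> \<pi>}"
        unfolding stronger_def by blast
    qed
  qed
  show ?thesis
    by (subst forces_eq.simps)
      (simp only: *[of \<sigma> \<tau> "\<lambda>s \<rho> \<pi>. forces_eq P s \<rho> \<pi>"] *[of \<tau> \<sigma> "\<lambda>s \<pi> \<rho>. forces_eq P s \<rho> \<pi>"])
qed

lemma forces_mem_iff:
  "forces_mem P p \<sigma> \<tau> \<longleftrightarrow>
     (\<forall>q. q \<preceq> p \<longrightarrow> (\<exists>s \<pi> t. s \<preceq> q \<and> vpair \<pi> t \<in> elts \<tau> \<and> s \<preceq> t \<and> forces_eq P s \<sigma> \<pi>))"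
  unfolding forces_mem_def dense_below_iff by (auto simp: stronger_def) blast+

text \<open>Induction along the transitive closure of membership, in which the first component of a
  member of \<sigma> precedes \<sigma>. It covers every set, so the facts on atomic forcing hold for
  arbitrary sets.\<close>

lemma name_induct:
  assumes "\<And>\<sigma>. (\<And>\<rho> r. vpair \<rho> r \<in> elts \<sigma> \<Longrightarrow> Q \<rho>) \<Longrightarrow> Q \<sigma>"
  shows "Q \<sigma>"
  using wf_trancl[OF wf_elem_rel]
proof (induction \<sigma> rule: wf_induct_rule)
  case (less \<sigma>)
  show ?case by (rule assms) (blast intro: less vpair_elem_trancl)
qed

lemma forces_eq_refl: "forces_eq P p \<sigma> \<sigma>"
proof (induction \<sigma> arbitrary: p rule: name_induct)
  case (1 \<sigma>)
  then show ?case
    by (subst forces_eq_iff) (blast intro: stronger_self)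
qed

lemma forces_eq_sym: "forces_eq P p \<sigma> \<tau> \<Longrightarrow> forces_eq P p \<tau> \<sigma>"
proof -
  have "forces_eq P p \<sigma> \<tau> \<longleftrightarrow> forces_eq P p \<tau> \<sigma>"
  proof (induction \<sigma> arbitrary: p \<tau> rule: name_induct)
    case (1 \<sigma>)
    show ?case
      unfolding forces_eq_iff[of p \<sigma> \<tau>] forces_eq_iff[of p \<tau> \<sigma>]
      using 1 by (smt (verit))
  qed
  then show "forces_eq P p \<sigma> \<tau> \<Longrightarrow> forces_eq P p \<tau> \<sigma>" by simp
qed

lemma forces_eq_mono: "q \<preceq> p \<Longrightarrow> forces_eq P p \<sigma> \<tau> \<Longrightarrow> forces_eq P q \<sigma> \<tau>"
  unfolding forces_eq_iff[of p] forces_eq_iff[of q] by (meson stronger_trans)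

lemma forces_eq_trans:
  "forces_eq P p \<sigma> \<tau> \<Longrightarrow> forces_eq P p \<tau> \<upsilon> \<Longrightarrow> forces_eq P p \<sigma> \<upsilon>"
proof (induction \<sigma> arbitrary: p \<tau> \<upsilon> rule: name_induct)
  case (1 \<sigma>)
  show ?case
    unfolding forces_eq_iff[of p \<sigma> \<upsilon>]
  proof (intro conjI allI impI)
    fix \<rho> r q assume \<rho>: "vpair \<rho> r \<in> elts \<sigma>" "q \<preceq> p" "q \<preceq> r"
    then obtain s \<pi> t where s: "s \<preceq> q" "vpair \<pi> t \<in> elts \<tau>" "s \<preceq> t" "forces_eq P s \<rho> \<pi>"
      using 1(2) unfolding forces_eq_iff[of p \<sigma> \<tau>] by blast
    then obtain s' \<chi> u where s': "s' \<preceq> s" "vpair \<chi> u \<in> elts \<upsilon>" "s' \<preceq> u" "forces_eq P s' \<pi> \<chi>"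
      using 1(3) \<rho> unfolding forces_eq_iff[of p \<tau> \<upsilon>] by (meson stronger_trans)
    have "forces_eq P s' \<rho> \<chi>"
      using 1(1)[OF \<rho>(1)] forces_eq_mono[OF s'(1) s(4)] s'(4) by blast
    then show "\<exists>s \<pi> t. s \<preceq> q \<and> vpair \<pi> t \<in> elts \<upsilon> \<and> s \<preceq> t \<and> forces_eq P s \<rho> \<pi>"
      using s s' stronger_trans by blast
  next
    fix \<chi> u q assume \<chi>: "vpair \<chi> u \<in> elts \<upsilon>" "q \<preceq> p" "q \<preceq> u"
    then obtain s \<pi> t where s: "s \<preceq> q" "vpair \<pi> t \<in> elts \<tau>" "s \<preceq> t" "forces_eq P s \<pi> \<chi>"
      using 1(3) unfolding forces_eq_iff[of p \<tau> \<upsilon>] by blast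
    then obtain s' \<rho> r where s': "s' \<preceq> s" "vpair \<rho> r \<in> elts \<sigma>" "s' \<preceq> r" "forces_eq P s' \<rho> \<pi>"
      using 1(2) \<chi> unfolding forces_eq_iff[of p \<sigma> \<tau>] by (meson stronger_trans)
    have "forces_eq P s' \<rho> \<chi>"
      using 1(1)[OF s'(2)] forces_eq_mono[OF s'(1) s(4)] s'(4) by blast
    then show "\<exists>s \<rho> r. s \<preceq> q \<and> vpair \<rho> r \<in> elts \<sigma> \<and> s \<preceq> r \<and> forces_eq P s \<rho> \<chi>"
      using s s' stronger_trans by blast
  qed
qed

text \<open>No induction on names: both clauses quantify over all \<open>q\<close> below
  \<open>p\<close>, and below each \<open>q\<close> the assumed witness can be used instead.\<close>

lemma forces_eq_dense:
  assumes "\<And>q. q \<preceq> p \<Longrightarrow> \<exists>s. s \<preceq> q \<and> forces_eq P s \<sigma> \<tau>"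
  shows "forces_eq P p \<sigma> \<tau>"
  unfolding forces_eq_iff[of p]
proof (intro conjI allI impI)
  fix \<rho> r q assume \<rho>: "vpair \<rho> r \<in> elts \<sigma>" "q \<preceq> p" "q \<preceq> r"
  then obtain s where "s \<preceq> q" "forces_eq P s \<sigma> \<tau>" using assms by blast
  with \<rho> show "\<exists>s \<pi> t. s \<preceq> q \<and> vpair \<pi> t \<in> elts \<tau> \<and> s \<preceq> t \<and> forces_eq P s \<rho> \<pi>"
    unfolding forces_eq_iff[of s \<sigma>] by (meson stronger_trans stronger_self)
next
  fix \<pi> t q assume \<pi>: "vpair \<pi> t \<in> elts \<tau>" "q \<preceq> p" "q \<preceq> t"
  then obtain s where "s \<preceq> q" "forces_eq P s \<sigma> \<tau>" using assms by blast
  with \<pi> show "\<exists>s \<rho> r. s \<preceq> q \<and> vpair \<rho> r \<in> elts \<sigma> \<and> s \<preceq> r \<and> forces_eq P s \<rho> \<pi>"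
    unfolding forces_eq_iff[of s \<sigma>] by (meson stronger_trans stronger_self)
qed

lemma forces_mem_mono: "q \<preceq> p \<Longrightarrow> forces_mem P p \<sigma> \<tau> \<Longrightarrow> forces_mem P q \<sigma> \<tau>"
  unfolding forces_mem_iff by (meson stronger_trans)

lemma forces_mem_dense:
  assumes "\<And>q. q \<preceq> p \<Longrightarrow> \<exists>s. s \<preceq> q \<and> forces_mem P s \<sigma> \<tau>"
  shows "forces_mem P p \<sigma> \<tau>"
  using assms unfolding forces_mem_iff by (meson stronger_trans stronger_self)

lemma forces_mem_cong_left:
  assumes "forces_eq P p \<sigma> \<sigma>'" and "forces_mem P p \<sigma> \<tau>"
  shows "forces_mem P p \<sigma>' \<tau>"
  unfolding forces_mem_iff
proof (intro allI impI)
  fix q assume q: "q \<preceq> p"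
  then obtain s \<pi> t where s: "s \<preceq> q" "vpair \<pi> t \<in> elts \<tau>" "s \<preceq> t" "forces_eq P s \<sigma> \<pi>"
    using assms(2) unfolding forces_mem_iff by blast
  have "forces_eq P s \<sigma>' \<sigma>"
    using assms(1) s(1) q forces_eq_mono forces_eq_sym stronger_trans by blast
  then show "\<exists>s \<pi> t. s \<preceq> q \<and> vpair \<pi> t \<in> elts \<tau> \<and> s \<preceq> t \<and> forces_eq P s \<sigma>' \<pi>"
    using s forces_eq_trans by blast
qed

lemma forces_mem_cong_right:
  assumes "forces_eq P p \<tau> \<tau>'" and "forces_mem P p \<sigma> \<tau>"
  shows "forces_mem P p \<sigma> \<tau>'"
  unfolding forces_mem_iff
proof (intro allI impI)
  fix q assume q: "q \<preceq> p"
  then obtain s \<pi> t where s: "s \<preceq> q" "vpair \<pi> t \<in> elts \<tau>" "s \<preceq> t" "forces_eq P s \<sigma> \<pi>"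
    using assms(2) unfolding forces_mem_iff by blast
  have "s \<preceq> p" using s(1) q stronger_trans by blast
  then obtain s' \<pi>' t' where s': "s' \<preceq> s" "vpair \<pi>' t' \<in> elts \<tau>'" "s' \<preceq> t'" "forces_eq P s' \<pi> \<pi>'"
    using assms(1) s(2,3) unfolding forces_eq_iff[of p] by blast
  then show "\<exists>s \<pi> t. s \<preceq> q \<and> vpair \<pi> t \<in> elts \<tau>' \<and> s \<preceq> t \<and> forces_eq P s \<sigma> \<pi>"
    using s forces_eq_trans forces_eq_mono stronger_trans by meson
qed

section \<open>Monotonicity, density and the logical connectives\<close>

lemma forces_Neg: "p \<tturnstile> (\<^bold>\<not> \<phi>) \<longleftrightarrow> (\<forall>q. q \<preceq> p \<longrightarrow> \<not> q \<tturnstile> \<phi>)"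
  by (auto simp: stronger_def)

lemma forces_mono: "p \<tturnstile> \<phi> \<Longrightarrow> q \<preceq> p \<Longrightarrow> q \<tturnstile> \<phi>"
proof (induction \<phi>)
  case (Neg \<phi>)
  then show ?case unfolding forces_Neg by (meson stronger_trans)
qed (auto intro: forces_eq_mono forces_mem_mono)

text \<open>A statement may be verified after passing to conditions that decide more. For a
  negation: if some \<open>q\<close> below \<open>p\<close> forced the negated formula, a condition
  below \<open>q\<close> would force both it and its negation.\<close>

lemma forces_dense: "(\<And>q. q \<preceq> p \<Longrightarrow> \<exists>s. s \<preceq> q \<and> s \<tturnstile> \<phi>) \<Longrightarrow> p \<tturnstile> \<phi>"
proof (induction \<phi>)
  case (Neg \<phi>)
  show ?case
    unfolding forces_Neg
  proof (intro allI impI notI)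
    fix q assume q: "q \<preceq> p" "q \<tturnstile> \<phi>"
    then obtain s where s: "s \<preceq> q" "s \<tturnstile> (\<^bold>\<not> \<phi>)" using Neg.prems by blast
    then have "s \<tturnstile> \<phi>" using q forces_mono by blast
    with s show False unfolding forces_Neg using stronger_self by blast
  qed
next
  case (Conj \<phi> \<psi>)
  then show ?case by simp blast
next
  case (Forall \<phi>)
  then show ?case by simp (meson rangeI)
qed (auto intro: forces_eq_dense forces_mem_dense)

lemma forces_Conj: "p \<tturnstile> (\<phi> \<^bold>\<and> \<psi>) \<longleftrightarrow> p \<tturnstile> \<phi> \<and> p \<tturnstile> \<psi>"
  by simp

lemma forces_Forall: "p \<tturnstile> (\<^bold>\<forall>x. \<phi> x) \<longleftrightarrow> (\<forall>\<tau>. is_name P \<tau> \<longrightarrow> p \<tturnstile> \<phi> \<tau>)"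
  by simp

text \<open>\<open>Disj\<close>, \<open>Imp\<close> and \<open>Exists\<close> are abbreviations
  through negation; density makes the logic of forced formulas classical, which gives implication
  its expected clause.\<close>

lemma forces_NegNeg: "p \<tturnstile> (\<^bold>\<not> \<^bold>\<not> \<phi>) \<longleftrightarrow> p \<tturnstile> \<phi>"
proof
  assume "p \<tturnstile> (\<^bold>\<not> \<^bold>\<not> \<phi>)"
  then show "p \<tturnstile> \<phi>"
    unfolding forces_Neg by (intro forces_dense) blast
next
  assume "p \<tturnstile> \<phi>"
  then show "p \<tturnstile> (\<^bold>\<not> \<^bold>\<not> \<phi>)"
    unfolding forces_Neg using forces_mono stronger_self by blast
qed

lemma forces_Disj:
  "p \<tturnstile> (\<phi> \<^bold>\<or> \<psi>) \<longleftrightarrow> (\<forall>q. q \<preceq> p \<longrightarrow> (\<exists>s. s \<preceq> q \<and> (s \<tturnstile> \<phi> \<or> s \<tturnstile> \<psi>)))"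
  unfolding Disj_def forces_Neg forces_Conj by blast

lemma forces_Imp: "p \<tturnstile> (\<phi> \<^bold>\<longrightarrow> \<psi>) \<longleftrightarrow> (\<forall>q. q \<preceq> p \<longrightarrow> q \<tturnstile> \<phi> \<longrightarrow> q \<tturnstile> \<psi>)"
proof
  assume L: "p \<tturnstile> (\<phi> \<^bold>\<longrightarrow> \<psi>)"
  show "\<forall>q. q \<preceq> p \<longrightarrow> q \<tturnstile> \<phi> \<longrightarrow> q \<tturnstile> \<psi>"
  proof (intro allI impI)
    fix q assume q: "q \<preceq> p" "q \<tturnstile> \<phi>"
    have "q \<tturnstile> (\<^bold>\<not> \<^bold>\<not> \<psi>)"
      unfolding forces_Neg[of q]
    proof (intro allI impI notI)
      fix r assume "r \<preceq> q" "r \<tturnstile> (\<^bold>\<not> \<psi>)"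
      with L q show False
        unfolding Imp_def forces_Neg[of p] forces_Conj using forces_mono stronger_trans by blast
    qed
    then show "q \<tturnstile> \<psi>" by (simp only: forces_NegNeg)
  qed
next
  assume "\<forall>q. q \<preceq> p \<longrightarrow> q \<tturnstile> \<phi> \<longrightarrow> q \<tturnstile> \<psi>"
  then show "p \<tturnstile> (\<phi> \<^bold>\<longrightarrow> \<psi>)"
    unfolding Imp_def forces_Neg forces_Conj using stronger_self by blast
qed

lemma forces_Iff: "p \<tturnstile> (\<phi> \<^bold>\<longleftrightarrow> \<psi>) \<longleftrightarrow> (\<forall>q. q \<preceq> p \<longrightarrow> (q \<tturnstile> \<phi> \<longleftrightarrow> q \<tturnstile> \<psi>))"
  unfolding Iff_def forces_Conj forces_Imp by blast

text \<open>The witness may change from one condition to another; no names are glued together along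
  an antichain.\<close>

lemma forces_Exists:
  "p \<tturnstile> (\<^bold>\<exists>x. \<phi> x) \<longleftrightarrow> (\<forall>q. q \<preceq> p \<longrightarrow> (\<exists>s \<tau>. s \<preceq> q \<and> is_name P \<tau> \<and> s \<tturnstile> \<phi> \<tau>))"
  unfolding Exists_def forces_Neg forces_Forall by blast

lemma forces_ExistsI: "is_name P \<tau> \<Longrightarrow> p \<tturnstile> \<phi> \<tau> \<Longrightarrow> p \<tturnstile> (\<^bold>\<exists>x. \<phi> x)"
  unfolding forces_Exists using forces_mono stronger_self by blast

text \<open>Since the goal is itself a forced formula, it may be proved densely, and there a single
  witness can be fixed as in ordinary logic.\<close>

lemma forces_ExistsE:
  assumes "p \<tturnstile> (\<^bold>\<exists>x. \<phi> x)" and "\<And>q \<tau>. q \<preceq> p \<Longrightarrow> is_name P \<tau> \<Longrightarrow> q \<tturnstile> \<phi> \<tau> \<Longrightarrow> q \<tturnstile> \<chi>"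
  shows "p \<tturnstile> \<chi>"
  using assms unfolding forces_Exists by (intro forces_dense) (meson stronger_trans)

lemma forces_DisjE:
  assumes "p \<tturnstile> (\<phi> \<^bold>\<or> \<psi>)"
    and "\<And>q. q \<preceq> p \<Longrightarrow> q \<tturnstile> \<phi> \<Longrightarrow> q \<tturnstile> \<chi>" and "\<And>q. q \<preceq> p \<Longrightarrow> q \<tturnstile> \<psi> \<Longrightarrow> q \<tturnstile> \<chi>"
  shows "p \<tturnstile> \<chi>"
  using assms unfolding forces_Disj by (intro forces_dense) (meson stronger_trans)

lemma forces_DisjI1: "p \<tturnstile> \<phi> \<Longrightarrow> p \<tturnstile> (\<phi> \<^bold>\<or> \<psi>)"
  and forces_DisjI2: "p \<tturnstile> \<psi> \<Longrightarrow> p \<tturnstile> (\<phi> \<^bold>\<or> \<psi>)"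
  unfolding forces_Disj using forces_mono stronger_self by blast+

lemma forces_ForallD: "p \<tturnstile> (\<^bold>\<forall>x. \<phi> x) \<Longrightarrow> is_name P \<tau> \<Longrightarrow> p \<tturnstile> \<phi> \<tau>"
  by simp

lemma forces_ImpD: "p \<tturnstile> (\<phi> \<^bold>\<longrightarrow> \<psi>) \<Longrightarrow> p \<in> conds P \<Longrightarrow> p \<tturnstile> \<phi> \<Longrightarrow> p \<tturnstile> \<psi>"
  unfolding forces_Imp using stronger_refl by blast

lemma forces_refl: "p \<tturnstile> (\<sigma> \<^bold>= \<sigma>)"
  by (simp add: forces_eq_refl)

lemma forces_sym: "p \<tturnstile> (\<sigma> \<^bold>= \<tau>) \<Longrightarrow> p \<tturnstile> (\<tau> \<^bold>= \<sigma>)"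
  by (simp add: forces_eq_sym)

lemma forces_trans: "p \<tturnstile> (\<sigma> \<^bold>= \<tau>) \<Longrightarrow> p \<tturnstile> (\<tau> \<^bold>= \<upsilon>) \<Longrightarrow> p \<tturnstile> (\<sigma> \<^bold>= \<upsilon>)"
  using forces_eq_trans by auto

lemma forces_Mem_subst:
  "p \<tturnstile> (\<sigma> \<^bold>\<in> \<tau>) \<Longrightarrow> p \<tturnstile> (\<sigma> \<^bold>= \<sigma>') \<Longrightarrow> p \<tturnstile> (\<tau> \<^bold>= \<tau>') \<Longrightarrow> p \<tturnstile> (\<sigma>' \<^bold>\<in> \<tau>')"
  using forces_mem_cong_left forces_mem_cong_right by auto

text \<open>
  Formulas in higher-order abstract syntax admit no general substitution lemma; the rules
  below prove it for each concrete formula by descending through its connectives.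
\<close>

definition fcong :: "'v \<Rightarrow> 'v fm \<Rightarrow> 'v fm \<Rightarrow> bool" where
  "fcong p \<phi> \<psi> \<longleftrightarrow> (\<forall>q. q \<preceq> p \<longrightarrow> (q \<tturnstile> \<phi> \<longleftrightarrow> q \<tturnstile> \<psi>))"

lemma fcong_Mem:
  assumes "p \<tturnstile> (x \<^bold>= x')" "p \<tturnstile> (y \<^bold>= y')"
  shows "fcong p (x \<^bold>\<in> y) (x' \<^bold>\<in> y')"
  unfolding fcong_def using assms forces_Mem_subst forces_sym forces_mono by meson

lemma fcong_Eq:
  assumes "p \<tturnstile> (x \<^bold>= x')" "p \<tturnstile> (y \<^bold>= y')"
  shows "fcong p (x \<^bold>= y) (x' \<^bold>= y')"
  unfolding fcong_def using assms forces_trans forces_sym forces_mono by meson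

lemma fcong_Neg: "fcong p \<phi> \<psi> \<Longrightarrow> fcong p (\<^bold>\<not> \<phi>) (\<^bold>\<not> \<psi>)"
  unfolding fcong_def forces_Neg by (meson stronger_trans)

lemma fcong_Conj: "fcong p \<phi> \<psi> \<Longrightarrow> fcong p \<phi>' \<psi>' \<Longrightarrow> fcong p (\<phi> \<^bold>\<and> \<phi>') (\<psi> \<^bold>\<and> \<psi>')"
  unfolding fcong_def by simp

lemma fcong_Forall: "(\<And>x. fcong p (\<phi> x) (\<psi> x)) \<Longrightarrow> fcong p (\<^bold>\<forall>x. \<phi> x) (\<^bold>\<forall>x. \<psi> x)"
  unfolding fcong_def by simp

lemma forces_subst: "fcong p \<phi> \<psi> \<Longrightarrow> p \<tturnstile> \<phi> \<Longrightarrow> p \<in> conds P \<Longrightarrow> p \<tturnstile> \<psi>"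
  unfolding fcong_def using stronger_refl by blast

lemmas fcong_rules = fcong_Mem fcong_Eq fcong_Neg fcong_Conj fcong_Forall

lemmas fm_defs = Disj_def Imp_def Iff_def Exists_def subset_fm_def upair_fm_def opair_fm_def
  app_fm_def fun_fm_def bij_fm_def Ord_fm_def Limit_fm_def Card_fm_def

lemma fcong_Card: "p \<tturnstile> (x \<^bold>= x') \<Longrightarrow> fcong p (Card_fm x) (Card_fm x')"
  unfolding fm_defs by (intro fcong_rules; (assumption | rule forces_refl))

end

section \<open>Pairs, smallness and induction on membership in the ground model\<close>

lemma vpair_eq_iff [simp]: "vpair a b = vpair c d \<longleftrightarrow> a = c \<and> b = d"
proof
  assume eq: "vpair a b = vpair c d"
  have sing: "vset {x} = vset {y, z} \<longleftrightarrow> x = y \<and> x = z" for x y z :: 'a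
    by (metis elts_vset_sing elts_vset_pair doubleton_eq_iff insert_absorb2)
  have pair: "vset {x, y} = vset {z, w} \<longleftrightarrow> {x, y} = {z, w}" for x y z w :: 'a
    by (metis elts_vset_pair)
  have "{vset {a}, vset {a, b}} = {vset {c}, vset {c, d}}"
    using eq elts_vpair by metis
  then consider "vset {a} = vset {c}" "vset {a, b} = vset {c, d}"
    | "vset {a} = vset {c, d}" "vset {c} = vset {a, b}"
    unfolding doubleton_eq_iff by metis
  then show "a = c \<and> b = d"
  proof cases
    case 1
    then have "{a} = {c}" "{a, b} = {c, d}" by (metis elts_vset_sing) (simp only: pair[symmetric] 1)
    then show ?thesis by (metis doubleton_eq_iff singleton_inject)
  next
    case 2
    then show ?thesis unfolding sing by metis
  qed
qed simp

lemma elts_vset_empty: "elts (vset {}) = {}"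
  using infinity elts_vset by metis

lemma small_image: "elts (vset (F ` elts x)) = F ` elts x"
  for F :: "'v::zfc \<Rightarrow> 'v"
  using replacement[of F x] elts_vset by blast

lemma small_subset: "X \<subseteq> elts x \<Longrightarrow> elts (vset X) = X"
  using separation[of x "\<lambda>z. z \<in> X"] by (metis Collect_conj_eq Collect_mem_eq elts_vset inf.absorb_iff2)

lemma mem_irrefl [simp]: "x \<notin> elts x"
  using wf_elem_rel unfolding elem_rel_def by (auto dest: wf_not_refl)

lemma mem_asym: "x \<in> elts y \<Longrightarrow> y \<notin> elts x"
  using wf_elem_rel unfolding elem_rel_def by (auto dest: wf_not_sym)

lemma mem_induct: "(\<And>x. (\<And>y. y \<in> elts x \<Longrightarrow> Q y) \<Longrightarrow> Q x) \<Longrightarrow> Q x"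
  using wf_elem_rel unfolding elem_rel_def by (rule wf_induct_rule) auto

context forcing_poset
begin

section \<open>Check names\<close>

lemma elts_check: "elts (chk x) = (\<lambda>y. vpair (chk y) (weakest P)) ` elts x"
  by (subst check.simps) (rule small_image)

lemma is_name_member: "is_name P \<tau> \<Longrightarrow> vpair \<sigma> r \<in> elts \<tau> \<Longrightarrow> is_name P \<sigma> \<and> r \<in> conds P"
  by (erule is_name.cases) fastforce

text \<open>Every \<open>q\<close> below \<open>r\<close> forces \<rho> into \<sigma> when the pair
  of \<rho> and \<open>r\<close> belongs to \<sigma>. Agreement on forced members therefore returns
  the two clauses of \<open>forces_eq\<close>.\<close>

lemma forces_extensionality:
  assumes n: "is_name P \<sigma>" "is_name P \<tau>"
    and eq: "\<And>q z. q \<preceq> p \<Longrightarrow> is_name P z \<Longrightarrow> q \<tturnstile> (z \<^bold>\<in> \<sigma>) \<longleftrightarrow> q \<tturnstile> (z \<^bold>\<in> \<tau>)"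
  shows "p \<tturnstile> (\<sigma> \<^bold>= \<tau>)"
proof -
  have mem: "q \<tturnstile> (\<rho> \<^bold>\<in> \<sigma>)" if "vpair \<rho> r \<in> elts \<sigma>" "q \<preceq> r" for \<rho> r q \<sigma>
    unfolding forces.simps forces_mem_iff
    using that forces_eq_refl stronger_trans stronger_self by blast
  have "\<exists>s \<pi> t. s \<preceq> q \<and> vpair \<pi> t \<in> elts \<tau> \<and> s \<preceq> t \<and> forces_eq P s \<rho> \<pi>"
    if "vpair \<rho> r \<in> elts \<sigma>" "q \<preceq> p" "q \<preceq> r" for \<rho> r q
  proof -
    have "forces_mem P q \<rho> \<tau>"
      using eq[OF that(2)] mem[OF that(1,3)] is_name_member[OF n(1) that(1)] by auto
    then show ?thesis unfolding forces_mem_iff using that(2) stronger_self by blast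
  qed
  moreover have "\<exists>s \<pi> t. s \<preceq> q \<and> vpair \<pi> t \<in> elts \<sigma> \<and> s \<preceq> t \<and> forces_eq P s \<pi> \<rho>"
    if "vpair \<rho> r \<in> elts \<tau>" "q \<preceq> p" "q \<preceq> r" for \<rho> r q
  proof -
    have "forces_mem P q \<rho> \<sigma>"
      using eq[OF that(2)] mem[OF that(1,3)] is_name_member[OF n(2) that(1)] by auto
    then show ?thesis unfolding forces_mem_iff using that(2) stronger_self forces_eq_sym by blast
  qed
  ultimately show ?thesis by (simp only: forces.simps forces_eq_iff[of p]) blast
qed

lemma is_name_check [simp]: "is_name P (chk x)"
proof (induction x rule: mem_induct)
  case (1 x)
  then show ?case
    by (intro is_name.intros) (auto simp: elts_check weakest_cond)
qed

text \<open>All members of a check name carry the label \<open>weakest P\<close>, so the requirement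
  \<open>s \<preceq> t\<close> always holds. This is how a name for an element of a ground model set
  gets decided.\<close>

lemma forces_mem_check_iff:
  "p \<tturnstile> (\<sigma> \<^bold>\<in> chk x) \<longleftrightarrow> (\<forall>q. q \<preceq> p \<longrightarrow> (\<exists>s y. s \<preceq> q \<and> y \<in> elts x \<and> s \<tturnstile> (\<sigma> \<^bold>= chk y)))"
proof -
  have "(\<exists>s \<pi> t. s \<preceq> q \<and> vpair \<pi> t \<in> elts (chk x) \<and> s \<preceq> t \<and> forces_eq P s \<sigma> \<pi>) \<longleftrightarrow>
      (\<exists>s y. s \<preceq> q \<and> y \<in> elts x \<and> forces_eq P s \<sigma> (chk y))" (is "?L \<longleftrightarrow> ?R") for q
  proof
    assume ?L
    then obtain s \<pi> t where s: "s \<preceq> q" "vpair \<pi> t \<in> elts (chk x)" "forces_eq P s \<sigma> \<pi>" by blast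
    from s(2) obtain y where "y \<in> elts x" "\<pi> = chk y" unfolding elts_check by auto
    with s show ?R by blast
  next
    assume ?R
    then obtain s y where s: "s \<preceq> q" "y \<in> elts x" "forces_eq P s \<sigma> (chk y)" by blast
    have "vpair (chk y) (weakest P) \<in> elts (chk x)" unfolding elts_check using s(2) by (rule imageI)
    moreover have "s \<preceq> weakest P" using s(1) stronger_weakest stronger_cond by blast
    ultimately show ?L using s by blast
  qed
  then show ?thesis by (simp only: forces.simps forces_mem_iff)
qed

lemma forces_mem_checkE:
  assumes "p \<tturnstile> (\<sigma> \<^bold>\<in> chk x)"
    and "\<And>q y. q \<preceq> p \<Longrightarrow> y \<in> elts x \<Longrightarrow> q \<tturnstile> (\<sigma> \<^bold>= chk y) \<Longrightarrow> q \<tturnstile> \<chi>"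
  shows "p \<tturnstile> \<chi>"
  using assms unfolding forces_mem_check_iff by (intro forces_dense) (meson stronger_trans)

lemma forces_mem_checkI: "y \<in> elts x \<Longrightarrow> p \<tturnstile> (chk y \<^bold>\<in> chk x)"
  unfolding forces_mem_check_iff using forces_refl stronger_self by blast

text \<open>A member of one side is forced into the other side, a stronger condition identifies it
  with a member there, and the induction hypothesis turns forced equality of members into
  equality.\<close>

lemma forces_check_eqD: "p \<tturnstile> (chk x \<^bold>= chk y) \<Longrightarrow> p \<in> conds P \<Longrightarrow> x = y"
proof (induction x arbitrary: p y rule: mem_induct)
  case (1 x)
  have "z \<in> elts y" if z: "z \<in> elts x" for z
  proof -
    have "p \<tturnstile> (chk z \<^bold>\<in> chk y)"
      using forces_mem_checkI[OF z] forces_Mem_subst[OF _ forces_refl 1(2)] by blast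
    then show ?thesis
      unfolding forces_mem_check_iff using 1(1)[OF z] 1(3) stronger_refl stronger_cond by metis
  qed
  moreover have "z \<in> elts x" if z: "z \<in> elts y" for z
  proof -
    have "p \<tturnstile> (chk z \<^bold>\<in> chk x)"
      using forces_mem_checkI[OF z] forces_Mem_subst[OF _ forces_refl forces_sym[OF 1(2)]] by blast
    then obtain s w where "s \<preceq> p" "w \<in> elts x" "s \<tturnstile> (chk z \<^bold>= chk w)"
      unfolding forces_mem_check_iff using 1(3) stronger_refl by blast
    then show ?thesis using 1(1)[of w s z] forces_sym stronger_cond by blast
  qed
  ultimately show ?case by (intro extensionality) blast
qed

lemma forces_check_memD: "p \<tturnstile> (chk x \<^bold>\<in> chk y) \<Longrightarrow> p \<in> conds P \<Longrightarrow> x \<in> elts y"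
  unfolding forces_mem_check_iff using forces_check_eqD stronger_refl stronger_cond by metis

lemma forces_check_Neg_eq: "x \<noteq> y \<Longrightarrow> p \<tturnstile> (\<^bold>\<not> chk x \<^bold>= chk y)"
  unfolding forces_Neg using forces_check_eqD stronger_cond by blast

text \<open>A name forced into \<open>chk x\<close> densely equals some \<open>chk y\<close>, so
  only check names have to be tested. The second premise supplies, for this particular formula, the
  substitution that carries the result back to the name.\<close>

lemma forces_Forall_check:
  assumes "\<And>y q. y \<in> elts x \<Longrightarrow> q \<preceq> p \<Longrightarrow> q \<tturnstile> \<phi> (chk y)"
    and "\<And>\<sigma> \<tau> q. q \<preceq> p \<Longrightarrow> q \<tturnstile> (\<sigma> \<^bold>= \<tau>) \<Longrightarrow> fcong q (\<phi> \<sigma>) (\<phi> \<tau>)"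
  shows "p \<tturnstile> (\<^bold>\<forall>z. z \<^bold>\<in> chk x \<^bold>\<longrightarrow> \<phi> z)"
  unfolding forces_Forall forces_Imp
proof (intro allI impI)
  fix \<tau> q assume q: "q \<preceq> p" "q \<tturnstile> (\<tau> \<^bold>\<in> chk x)"
  from q(2) show "q \<tturnstile> \<phi> \<tau>"
  proof (rule forces_mem_checkE)
    fix r y assume r: "r \<preceq> q" "y \<in> elts x" "r \<tturnstile> (\<tau> \<^bold>= chk y)"
    have "r \<preceq> p" using r q stronger_trans by blast
    then show "r \<tturnstile> \<phi> \<tau>"
      using assms(1)[OF r(2)] assms(2)[OF _ forces_sym[OF r(3)]] forces_subst stronger_cond by blast
  qed
qed

section \<open>Forced pairs and forced functions\<close>

lemma forces_subset_iff:
  "p \<tturnstile> subset_fm A B \<longleftrightarrow> (\<forall>z q. is_name P z \<longrightarrow> q \<preceq> p \<longrightarrow> q \<tturnstile> (z \<^bold>\<in> A) \<longrightarrow> q \<tturnstile> (z \<^bold>\<in> B))"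
  unfolding subset_fm_def forces_Forall forces_Imp by blast

lemma forces_upair_iff:
  "p \<tturnstile> upair_fm s x y \<longleftrightarrow>
     (\<forall>z q. is_name P z \<longrightarrow> q \<preceq> p \<longrightarrow> (q \<tturnstile> (z \<^bold>\<in> s) \<longleftrightarrow> q \<tturnstile> (z \<^bold>= x \<^bold>\<or> z \<^bold>= y)))"
  unfolding upair_fm_def forces_Forall forces_Iff by blast

lemma forces_upair_mem:
  assumes "p \<tturnstile> upair_fm s x y" "p \<in> conds P"
  shows "is_name P x \<Longrightarrow> p \<tturnstile> (x \<^bold>\<in> s)" and "is_name P y \<Longrightarrow> p \<tturnstile> (y \<^bold>\<in> s)"
  using assms forces_refl forces_DisjI1 forces_DisjI2 stronger_refl unfolding forces_upair_iff by blast+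

lemma forces_upairE:
  assumes "p \<tturnstile> upair_fm s x y" "p \<in> conds P" "p \<tturnstile> (z \<^bold>\<in> s)" "is_name P z"
    and "\<And>q. q \<preceq> p \<Longrightarrow> q \<tturnstile> (z \<^bold>= x) \<Longrightarrow> q \<tturnstile> \<chi>"
    and "\<And>q. q \<preceq> p \<Longrightarrow> q \<tturnstile> (z \<^bold>= y) \<Longrightarrow> q \<tturnstile> \<chi>"
  shows "p \<tturnstile> \<chi>"
proof -
  have "p \<tturnstile> (z \<^bold>= x \<^bold>\<or> z \<^bold>= y)"
    using assms(1-4) stronger_refl unfolding forces_upair_iff by blast
  then show ?thesis by (rule forces_DisjE) (fact assms)+
qed

lemma forces_upair_eq:
  assumes p: "p \<in> conds P"
    and n: "is_name P s" "is_name P s'"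
    and "p \<tturnstile> upair_fm s x y" "p \<tturnstile> upair_fm s' x y"
  shows "p \<tturnstile> (s \<^bold>= s')"
  using assms by (intro forces_extensionality) (auto simp: forces_upair_iff)

lemma forces_upair_singD:
  assumes "p \<tturnstile> upair_fm s x x" "p \<in> conds P" "p \<tturnstile> (z \<^bold>\<in> s)" "is_name P z"
  shows "p \<tturnstile> (z \<^bold>= x)"
  using assms(1-4) by (rule forces_upairE)

lemma forces_mem_eq: "p \<tturnstile> (z \<^bold>\<in> s) \<Longrightarrow> p \<tturnstile> (s \<^bold>= t) \<Longrightarrow> p \<tturnstile> (z \<^bold>\<in> t)"
  using forces_Mem_subst forces_refl by blast

lemma forces_opairE:
  assumes "p \<tturnstile> opair_fm z x y"
    and "\<And>q s d. q \<preceq> p \<Longrightarrow> is_name P s \<Longrightarrow> is_name P d \<Longrightarrow> q \<tturnstile> upair_fm s x x \<Longrightarrow>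
      q \<tturnstile> upair_fm d x y \<Longrightarrow> q \<tturnstile> upair_fm z s d \<Longrightarrow> q \<tturnstile> \<chi>"
  shows "p \<tturnstile> \<chi>"
  using assms(1) unfolding opair_fm_def
proof (rule forces_ExistsE)
  fix q s assume q: "q \<preceq> p" "is_name P s"
    and "q \<tturnstile> (\<^bold>\<exists>d. upair_fm s x x \<^bold>\<and> upair_fm d x y \<^bold>\<and> upair_fm z s d)"
  from this(3) show "q \<tturnstile> \<chi>"
  proof (rule forces_ExistsE)
    fix r d assume "r \<preceq> q" "is_name P d" "r \<tturnstile> (upair_fm s x x \<^bold>\<and> upair_fm d x y \<^bold>\<and> upair_fm z s d)"
    then show "r \<tturnstile> \<chi>"
      using assms(2)[of r s d] q stronger_trans unfolding forces_Conj by blast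
  qed
qed

text \<open>Injectivity of the Kuratowski pair, carried out on forced statements with names
  \<open>s\<close>, \<open>d\<close> for the singleton and the doubleton. For the first coordinate,
  \<open>s\<close> equals \<open>s'\<close> or \<open>d'\<close>; both contain \<open>x'\<close>,
  while every member of \<open>s\<close> equals \<open>x\<close>.\<close>

lemma forces_pair_members_inj:
  assumes p: "p \<in> conds P"
    and n: "is_name P x" "is_name P y" "is_name P x'" "is_name P y'"
      "is_name P s" "is_name P d" "is_name P s'" "is_name P d'"
    and u: "p \<tturnstile> upair_fm s x x" "p \<tturnstile> upair_fm d x y" "p \<tturnstile> upair_fm z s d"
      "p \<tturnstile> upair_fm s' x' x'" "p \<tturnstile> upair_fm d' x' y'" "p \<tturnstile> upair_fm z s' d'"
  shows "p \<tturnstile> (x \<^bold>= x' \<^bold>\<and> y \<^bold>= y')"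
proof -
  note mem = forces_upair_mem[OF _ p]
  have in_s: "r \<tturnstile> (v \<^bold>= x)" if "r \<preceq> p" "is_name P v" "r \<tturnstile> (v \<^bold>\<in> s)" for r v
    using forces_upair_singD[OF forces_mono[OF u(1) that(1)]] that stronger_cond by blast
  have in_s': "r \<tturnstile> (v \<^bold>= x')" if "r \<preceq> p" "is_name P v" "r \<tturnstile> (v \<^bold>\<in> s')" for r v
    using forces_upair_singD[OF forces_mono[OF u(4) that(1)]] that stronger_cond by blast
  have x: "p \<tturnstile> (x \<^bold>= x')"
    using u(6) p mem(1)[OF u(3) n(5)] n(5)
  proof (rule forces_upairE)
    fix r assume r: "r \<preceq> p" "r \<tturnstile> (s \<^bold>= s')"
    have "r \<tturnstile> (x' \<^bold>\<in> s)"
      using forces_mem_eq forces_mono[OF mem(1)[OF u(4) n(3)] r(1)] forces_sym[OF r(2)] by blast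
    then show "r \<tturnstile> (x \<^bold>= x')" using in_s[OF r(1) n(3)] forces_sym by blast
  next
    fix r assume r: "r \<preceq> p" "r \<tturnstile> (s \<^bold>= d')"
    have "r \<tturnstile> (x' \<^bold>\<in> s)"
      using forces_mem_eq forces_mono[OF mem(1)[OF u(5) n(3)] r(1)] forces_sym[OF r(2)] by blast
    then show "r \<tturnstile> (x \<^bold>= x')" using in_s[OF r(1) n(3)] forces_sym by blast
  qed
  have y: "p \<tturnstile> (y \<^bold>= y')"
    using u(6) p mem(2)[OF u(3) n(6)] n(6)
  proof (rule forces_upairE)
    \<comment> \<open>Here \<open>d\<close> is a singleton, so \<open>y\<close> equals
      \<open>x'\<close>, hence \<open>x\<close>. As \<open>d'\<close> equals \<open>s\<close> or
      \<open>d\<close>, its element \<open>y'\<close> equals \<open>x\<close> or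
      \<open>x'\<close>.\<close>
    fix r assume r: "r \<preceq> p" "r \<tturnstile> (d \<^bold>= s')"
    have y: "r \<tturnstile> (y \<^bold>= x')"
      using in_s'[OF r(1) n(2)] forces_mem_eq[OF forces_mono[OF mem(2)[OF u(2) n(2)] r(1)] r(2)] .
    show "r \<tturnstile> (y \<^bold>= y')"
    proof (rule forces_upairE[OF forces_mono[OF u(3) r(1)] _ forces_mono[OF mem(2)[OF u(6) n(8)] r(1)] n(8)])
      fix t assume t: "t \<preceq> r" "t \<tturnstile> (d' \<^bold>= s)"
      have tp: "t \<preceq> p" using t(1) r(1) stronger_trans by blast
      have "t \<tturnstile> (y' \<^bold>= x)"
        using in_s[OF tp n(4)] forces_mem_eq[OF forces_mono[OF mem(2)[OF u(5) n(4)] tp] t(2)] .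
      then show "t \<tturnstile> (y \<^bold>= y')"
        using forces_trans[OF forces_mono[OF y t(1)]] forces_sym forces_trans forces_mono[OF x tp] by blast
    next
      fix t assume t: "t \<preceq> r" "t \<tturnstile> (d' \<^bold>= d)"
      have tp: "t \<preceq> p" using t(1) r(1) stronger_trans by blast
      have "t \<tturnstile> (y' \<^bold>= x')"
        using in_s'[OF tp n(4)]
          forces_mem_eq[OF forces_mem_eq[OF forces_mono[OF mem(2)[OF u(5) n(4)] tp] t(2)] forces_mono[OF r(2) t(1)]] .
      then show "t \<tturnstile> (y \<^bold>= y')"
        using forces_trans[OF forces_mono[OF y t(1)]] forces_sym by blast
    qed (use r stronger_cond in blast)
  next
    \<comment> \<open>Now \<open>y\<close> equals \<open>y'\<close>, as desired, or
      \<open>x'\<close>; in the second case \<open>y'\<close> lies in \<open>d\<close> and equals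
      \<open>x\<close> or \<open>y\<close>, where \<open>x\<close> is the same as
      \<open>x'\<close>.\<close>
    fix r assume r: "r \<preceq> p" "r \<tturnstile> (d \<^bold>= d')"
    show "r \<tturnstile> (y \<^bold>= y')"
    proof (rule forces_upairE[OF forces_mono[OF u(5) r(1)] _ _ n(2)])
      show "r \<tturnstile> (y \<^bold>\<in> d')" using forces_mem_eq[OF forces_mono[OF mem(2)[OF u(2) n(2)] r(1)] r(2)] .
    next
      fix t assume t: "t \<preceq> r" "t \<tturnstile> (y \<^bold>= x')"
      have tp: "t \<preceq> p" using t(1) r(1) stronger_trans by blast
      show "t \<tturnstile> (y \<^bold>= y')"
      proof (rule forces_upairE[OF forces_mono[OF u(2) tp] _ _ n(4)])
        show "t \<tturnstile> (y' \<^bold>\<in> d)"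
          using forces_mem_eq[OF forces_mono[OF mem(2)[OF u(5) n(4)] tp] forces_sym[OF forces_mono[OF r(2) t(1)]]] .
      next
        fix v assume v: "v \<preceq> t" "v \<tturnstile> (y' \<^bold>= x)"
        have "v \<preceq> p" using v(1) tp stronger_trans by blast
        then show "v \<tturnstile> (y \<^bold>= y')"
          using forces_trans[OF forces_mono[OF t(2) v(1)] forces_trans[OF forces_sym[OF forces_mono[OF x]] forces_sym[OF v(2)]]]
          by blast
      qed (use t stronger_cond in \<open>auto intro: forces_eq_sym\<close>)
    qed (use r stronger_cond in auto)
  qed
  show ?thesis using x y by simp
qed

lemma forces_opair_inj:
  assumes p: "p \<in> conds P"
    and n: "is_name P x" "is_name P y" "is_name P x'" "is_name P y'"
    and o: "p \<tturnstile> opair_fm z x y" "p \<tturnstile> opair_fm z x' y'"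
  shows "p \<tturnstile> (x \<^bold>= x' \<^bold>\<and> y \<^bold>= y')"
  using o(1)
proof (rule forces_opairE)
  fix q s d
  assume q: "q \<preceq> p" and sd: "is_name P s" "is_name P d" "q \<tturnstile> upair_fm s x x" "q \<tturnstile> upair_fm d x y" "q \<tturnstile> upair_fm z s d"
  show "q \<tturnstile> (x \<^bold>= x' \<^bold>\<and> y \<^bold>= y')"
    using forces_mono[OF o(2) q]
  proof (rule forces_opairE)
    fix r s' d'
    assume r: "r \<preceq> q" and sd': "is_name P s'" "is_name P d'" "r \<tturnstile> upair_fm s' x' x'" "r \<tturnstile> upair_fm d' x' y'" "r \<tturnstile> upair_fm z s' d'"
    show "r \<tturnstile> (x \<^bold>= x' \<^bold>\<and> y \<^bold>= y')"
      by (rule forces_pair_members_inj[OF stronger_cond[OF r] n sd(1,2) sd'(1,2)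
          forces_mono[OF sd(3) r] forces_mono[OF sd(4) r] forces_mono[OF sd(5) r] sd'(3-5)])
  qed
qed

lemma forces_check_upair:
  assumes "elts s = {x, y}"
  shows "p \<tturnstile> upair_fm (chk s) (chk x) (chk y)"
  by (simp only: forces_upair_iff forces_mem_check_iff forces_Disj assms) blast

lemma forces_check_opair: "p \<tturnstile> opair_fm (chk (vpair x y)) (chk x) (chk y)"
  unfolding opair_fm_def
  by (rule forces_ExistsI[OF is_name_check[of "vset {x}"]], rule forces_ExistsI[OF is_name_check[of "vset {x, y}"]])
    (simp add: forces_check_upair elts_vset_sing elts_vset_pair elts_vpair del: forces.simps add: forces_Conj)

lemma forces_check_appI: "vpair x y \<in> elts f \<Longrightarrow> p \<tturnstile> app_fm (chk f) (chk x) (chk y)"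
  unfolding app_fm_def
  by (rule forces_ExistsI[OF is_name_check[of "vpair x y"]])
    (simp only: forces_Conj forces_check_opair forces_mem_checkI)

lemma forces_appE:
  assumes "p \<tturnstile> app_fm f x y"
    and "\<And>q z. q \<preceq> p \<Longrightarrow> is_name P z \<Longrightarrow> q \<tturnstile> opair_fm z x y \<Longrightarrow> q \<tturnstile> (z \<^bold>\<in> f) \<Longrightarrow> q \<tturnstile> \<chi>"
  shows "p \<tturnstile> \<chi>"
  using assms(1) unfolding app_fm_def by (rule forces_ExistsE) (simp only: forces_Conj assms(2))

lemma fcong_opair: "p \<tturnstile> (z \<^bold>= z') \<Longrightarrow> p \<tturnstile> (x \<^bold>= x') \<Longrightarrow> p \<tturnstile> (y \<^bold>= y') \<Longrightarrow> fcong p (opair_fm z x y) (opair_fm z' x' y')"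
  unfolding fm_defs by (intro fcong_rules; (assumption | rule forces_refl))

lemma fcong_app: "p \<tturnstile> (x \<^bold>= x') \<Longrightarrow> p \<tturnstile> (y \<^bold>= y') \<Longrightarrow> fcong p (app_fm f x y) (app_fm f x' y')"
  unfolding fm_defs by (intro fcong_rules; (assumption | rule forces_refl))

text \<open>A forced member of \<open>chk f\<close> is densely a pair of the ground model, and
  injectivity of pairs then decides both coordinates.\<close>

lemma forces_check_appE:
  assumes app: "p \<tturnstile> app_fm (chk f) x y" and n: "is_name P x" "is_name P y"
    and pairs: "\<And>z. z \<in> elts f \<Longrightarrow> \<exists>u v. z = vpair u v"
    and step: "\<And>q u v. q \<preceq> p \<Longrightarrow> vpair u v \<in> elts f \<Longrightarrow> q \<tturnstile> (x \<^bold>= chk u) \<Longrightarrow> q \<tturnstile> (y \<^bold>= chk v) \<Longrightarrow> q \<tturnstile> \<chi>"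
  shows "p \<tturnstile> \<chi>"
  using app
proof (rule forces_appE)
  fix q z assume q: "q \<preceq> p" "is_name P z" "q \<tturnstile> opair_fm z x y" "q \<tturnstile> (z \<^bold>\<in> chk f)"
  from q(4) show "q \<tturnstile> \<chi>"
  proof (rule forces_mem_checkE)
    fix r w assume r: "r \<preceq> q" "w \<in> elts f" "r \<tturnstile> (z \<^bold>= chk w)"
    obtain u v where w: "w = vpair u v" using pairs r(2) by blast
    have "r \<tturnstile> opair_fm (chk w) x y"
      using forces_subst[OF fcong_opair[OF r(3) forces_refl forces_refl]] forces_mono[OF q(3) r(1)] stronger_cond[OF r(1)]
      by blast
    then have "r \<tturnstile> (x \<^bold>= chk u \<^bold>\<and> y \<^bold>= chk v)"
      using forces_opair_inj[OF stronger_cond[OF r(1)] n] forces_check_opair w is_name_check by blast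
    then show "r \<tturnstile> \<chi>"
      using step[of r u v] stronger_trans[OF r(1) q(1)] r(2) w unfolding forces_Conj by blast
  qed
qed

lemma forces_fun_iff:
  "p \<tturnstile> fun_fm f X Y \<longleftrightarrow>
    (\<forall>z q. is_name P z \<longrightarrow> q \<preceq> p \<longrightarrow> q \<tturnstile> (z \<^bold>\<in> f) \<longrightarrow> q \<tturnstile> (\<^bold>\<exists>x. \<^bold>\<exists>y. x \<^bold>\<in> X \<^bold>\<and> y \<^bold>\<in> Y \<^bold>\<and> opair_fm z x y)) \<and>
    (\<forall>x q. is_name P x \<longrightarrow> q \<preceq> p \<longrightarrow> q \<tturnstile> (x \<^bold>\<in> X) \<longrightarrow>
       q \<tturnstile> (\<^bold>\<exists>y. app_fm f x y \<^bold>\<and> (\<^bold>\<forall>z. app_fm f x z \<^bold>\<longrightarrow> z \<^bold>= y)))"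
  unfolding fun_fm_def forces_Conj forces_Forall forces_Imp by blast

lemma forces_fun_app_mem:
  assumes f: "p \<tturnstile> fun_fm f X Y" and app: "p \<tturnstile> app_fm f x y" and n: "is_name P x" "is_name P y"
  shows "p \<tturnstile> (x \<^bold>\<in> X \<^bold>\<and> y \<^bold>\<in> Y)"
  using app
proof (rule forces_appE)
  fix q z assume q: "q \<preceq> p" "is_name P z" "q \<tturnstile> opair_fm z x y" "q \<tturnstile> (z \<^bold>\<in> f)"
  then have "q \<tturnstile> (\<^bold>\<exists>x. \<^bold>\<exists>y. x \<^bold>\<in> X \<^bold>\<and> y \<^bold>\<in> Y \<^bold>\<and> opair_fm z x y)"
    using f unfolding forces_fun_iff by blast
  then show "q \<tturnstile> (x \<^bold>\<in> X \<^bold>\<and> y \<^bold>\<in> Y)"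
  proof (rule forces_ExistsE)
    fix r u assume r: "r \<preceq> q" "is_name P u" "r \<tturnstile> (\<^bold>\<exists>y. u \<^bold>\<in> X \<^bold>\<and> y \<^bold>\<in> Y \<^bold>\<and> opair_fm z u y)"
    from r(3) show "r \<tturnstile> (x \<^bold>\<in> X \<^bold>\<and> y \<^bold>\<in> Y)"
    proof (rule forces_ExistsE)
      fix s v assume s: "s \<preceq> r" "is_name P v" "s \<tturnstile> (u \<^bold>\<in> X \<^bold>\<and> v \<^bold>\<in> Y \<^bold>\<and> opair_fm z u v)"
      have "s \<tturnstile> (u \<^bold>= x \<^bold>\<and> v \<^bold>= y)"
        by (rule forces_opair_inj[OF stronger_cond[OF s(1)] r(2) s(2) n])
          (use s(3) forces_mono[OF forces_mono[OF q(3) r(1)] s(1)] in \<open>simp_all only: forces_Conj\<close>)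
      then show "s \<tturnstile> (x \<^bold>\<in> X \<^bold>\<and> y \<^bold>\<in> Y)"
        using s(3) forces_Mem_subst forces_refl unfolding forces_Conj by blast
    qed
  qed
qed

lemma forces_fun_app_unique:
  assumes f: "p \<tturnstile> fun_fm f X Y" and app: "p \<tturnstile> app_fm f x y" "p \<tturnstile> app_fm f x z"
    and p: "p \<in> conds P" and n: "is_name P x" "is_name P y" "is_name P z"
  shows "p \<tturnstile> (y \<^bold>= z)"
proof -
  have "p \<tturnstile> (x \<^bold>\<in> X)" using forces_fun_app_mem[OF f app(1) n(1,2)] unfolding forces_Conj ..
  then have "p \<tturnstile> (\<^bold>\<exists>y. app_fm f x y \<^bold>\<and> (\<^bold>\<forall>z. app_fm f x z \<^bold>\<longrightarrow> z \<^bold>= y))"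
    using f n(1) stronger_refl[OF p] unfolding forces_fun_iff by blast
  then show ?thesis
  proof (rule forces_ExistsE)
    fix q w assume q: "q \<preceq> p" "q \<tturnstile> (app_fm f x w \<^bold>\<and> (\<^bold>\<forall>z. app_fm f x z \<^bold>\<longrightarrow> z \<^bold>= w))"
    have "q \<tturnstile> (y \<^bold>= w)" "q \<tturnstile> (z \<^bold>= w)"
      using q n app[THEN forces_mono, OF q(1)] stronger_self[OF q(1)]
      unfolding forces_Conj forces_Forall forces_Imp by blast+
    then show "q \<tturnstile> (y \<^bold>= z)" using forces_trans forces_sym by blast
  qed
qed

lemma forces_fun_app_ex:
  assumes f: "p \<tturnstile> fun_fm f X Y" and x: "p \<tturnstile> (x \<^bold>\<in> X)"  and p: "p \<in> conds P" and n: "is_name P x"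
  shows "p \<tturnstile> (\<^bold>\<exists>y. app_fm f x y)"
proof -
  have "p \<tturnstile> (\<^bold>\<exists>y. app_fm f x y \<^bold>\<and> (\<^bold>\<forall>z. app_fm f x z \<^bold>\<longrightarrow> z \<^bold>= y))"
    using f n x stronger_refl[OF p] unfolding forces_fun_iff by blast
  then show ?thesis
    by (rule forces_ExistsE) (rule forces_ExistsI, assumption, simp only: forces_Conj)
qed

end


section \<open>Ordinals of the ground model\<close>

lemma V_models_connectives [simp]:
  "V_models (\<phi> \<^bold>\<or> \<psi>) \<longleftrightarrow> V_models \<phi> \<or> V_models \<psi>"
  "V_models (\<phi> \<^bold>\<longrightarrow> \<psi>) \<longleftrightarrow> (V_models \<phi> \<longrightarrow> V_models \<psi>)"
  "V_models (\<phi> \<^bold>\<longleftrightarrow> \<psi>) \<longleftrightarrow> (V_models \<phi> \<longleftrightarrow> V_models \<psi>)"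
  "V_models (\<^bold>\<exists>x. \<chi> x) \<longleftrightarrow> (\<exists>x. V_models (\<chi> x))"
  by (auto simp: Disj_def Imp_def Iff_def Exists_def)

lemma V_models_subset [simp]: "V_models (subset_fm x y) \<longleftrightarrow> elts x \<subseteq> elts y"
  by (auto simp: subset_fm_def)

lemma V_models_upair [simp]: "V_models (upair_fm s x y) \<longleftrightarrow> elts s = {x, y}"
  by (auto simp: upair_fm_def)

lemma V_models_opair [simp]: "V_models (opair_fm p x y) \<longleftrightarrow> p = vpair x y"
proof
  assume "V_models (opair_fm p x y)"
  then obtain s d where "elts s = {x}" "elts d = {x, y}" "elts p = {s, d}"
    by (auto simp: opair_fm_def)
  then show "p = vpair x y"
    unfolding vpair_def by (metis vset_eqI)
next
  assume "p = vpair x y"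
  then have "elts (vset {x}) = {x} \<and> elts (vset {x, y}) = {x, y} \<and> elts p = {vset {x}, vset {x, y}}"
    by (simp only: elts_vset_sing elts_vset_pair elts_vpair)
  then show "V_models (opair_fm p x y)"
    unfolding opair_fm_def V_models_connectives V_models.simps V_models_upair insert_absorb2 by blast
qed

lemma V_models_app [simp]: "V_models (app_fm f x y) \<longleftrightarrow> vpair x y \<in> elts f"
  by (simp add: app_fm_def)

lemma V_models_fun:
  "V_models (fun_fm f X Y) \<longleftrightarrow>
     (\<forall>z\<in>elts f. \<exists>x\<in>elts X. \<exists>y\<in>elts Y. z = vpair x y) \<and>
     (\<forall>x\<in>elts X. \<exists>y. vpair x y \<in> elts f \<and> (\<forall>z. vpair x z \<in> elts f \<longrightarrow> z = y))"
  by (auto simp: fun_fm_def)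

lemma V_models_bij:
  "V_models (bij_fm f X Y) \<longleftrightarrow> V_models (fun_fm f X Y) \<and>
     (\<forall>x x' y. vpair x y \<in> elts f \<longrightarrow> vpair x' y \<in> elts f \<longrightarrow> x = x') \<and>
     (\<forall>y\<in>elts Y. \<exists>x. vpair x y \<in> elts f)"
  by (auto simp: bij_fm_def)

definition vgraph :: "('v::zfc \<Rightarrow> 'v) \<Rightarrow> 'v \<Rightarrow> 'v" where
  "vgraph F X = vset ((\<lambda>x. vpair x (F x)) ` elts X)"

lemma vpair_in_vgraph: "vpair x y \<in> elts (vgraph F X) \<longleftrightarrow> x \<in> elts X \<and> y = F x"
  unfolding vgraph_def small_image by auto

lemma V_models_bij_vgraph:
  assumes "bij_betw F (elts X) (elts Y)"
  shows "V_models (bij_fm (vgraph F X) X Y)"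
  unfolding V_models_bij V_models_fun vpair_in_vgraph
  using assms by (auto simp: vgraph_def small_image bij_betw_def inj_on_def)

text \<open>Replacement holds for arbitrary HOL functions, so the graph of any HOL bijection between
  two sets is a set. Equinumerosity in the model is thus equinumerosity in HOL, which opens the way
  to the HOL theory of countability and cardinals.\<close>

lemma V_models_bij_ex:
  "(\<exists>f. V_models (bij_fm f X Y)) \<longleftrightarrow> (\<exists>F. bij_betw F (elts X) (elts Y))"
proof
  assume "\<exists>f. V_models (bij_fm f X Y)"
  then obtain f where f: "V_models (bij_fm f X Y)" by blast
  note f' = f[unfolded V_models_bij V_models_fun]
  note pairs = f'[THEN conjunct1, THEN conjunct1] and total = f'[THEN conjunct1, THEN conjunct2]
    and inj = f'[THEN conjunct2, THEN conjunct1] and surj = f'[THEN conjunct2, THEN conjunct2]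
  define F where "F x = (THE y. vpair x y \<in> elts f)" for x
  have F: "vpair x y \<in> elts f \<longleftrightarrow> F x = y" if x: "x \<in> elts X" for x y
  proof -
    obtain z where z: "vpair x z \<in> elts f" "\<forall>y. vpair x y \<in> elts f \<longrightarrow> y = z"
      using total x by blast
    have "F x = z"
      unfolding F_def by (rule the_equality) (simp_all add: z)
    then show ?thesis using z by metis
  qed
  have mem: "x \<in> elts X \<and> y \<in> elts Y" if "vpair x y \<in> elts f" for x y
    using pairs that by fastforce
  have "bij_betw F (elts X) (elts Y)"
    unfolding bij_betw_def
  proof
    show "inj_on F (elts X)"
    proof (rule inj_onI)
      fix x x' assume "x \<in> elts X" "x' \<in> elts X" "F x = F x'"
      then have "vpair x (F x) \<in> elts f" "vpair x' (F x) \<in> elts f" using F by auto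
      then show "x = x'" using inj by blast
    qed
    show "F ` elts X = elts Y"
    proof
      show "F ` elts X \<subseteq> elts Y" using F mem by blast
      show "elts Y \<subseteq> F ` elts X"
      proof
        fix y assume "y \<in> elts Y"
        then obtain x where "vpair x y \<in> elts f" using surj by blast
        then show "y \<in> F ` elts X" using F[of x y] mem[of x y] by blast
      qed
    qed
  qed
  then show "\<exists>F. bij_betw F (elts X) (elts Y)" by blast
qed (blast intro: V_models_bij_vgraph)

text \<open>Foundation supplies least elements and excludes cycles, which is why transitivity and
  comparability of members are equivalent to \<open>Ord_fm\<close> in the ground model.\<close>

definition Ord :: "'v::zfc \<Rightarrow> bool" where
  "Ord a \<longleftrightarrow> (\<forall>x\<in>elts a. elts x \<subseteq> elts a) \<and> (\<forall>x\<in>elts a. \<forall>y\<in>elts a. x \<in> elts y \<or> x = y \<or> y \<in> elts x)"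

lemma mem_minimal: "x \<in> X \<Longrightarrow> \<exists>m\<in>X. \<forall>y\<in>elts m. y \<notin> X"
  using wf_elem_rel[unfolded wf_eq_minimal, rule_format, of x X] unfolding elem_rel_def by auto

lemma V_models_Ord [simp]: "V_models (Ord_fm a) \<longleftrightarrow> Ord a"
proof -
  have "V_models (Ord_fm a) \<longleftrightarrow>
     (\<forall>x. x \<in> elts a \<longrightarrow> elts x \<subseteq> elts a) \<and>
     (\<forall>x y z. x \<in> elts a \<and> y \<in> elts a \<and> z \<in> elts a \<and> x \<in> elts y \<and> y \<in> elts z \<longrightarrow> x \<in> elts z) \<and>
     (\<forall>s. elts s \<subseteq> elts a \<and> (\<exists>x. x \<in> elts s) \<longrightarrow>
         (\<exists>m. m \<in> elts s \<and> (\<forall>x. x \<in> elts s \<longrightarrow> m = x \<or> m \<in> elts x)))" (is "_ \<longleftrightarrow> ?trans \<and> ?trans' \<and> ?min")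
    by (simp add: Ord_fm_def)
  also have "\<dots> \<longleftrightarrow> Ord a"
  proof
    assume a: "?trans \<and> ?trans' \<and> ?min"
    have "x \<in> elts y \<or> x = y \<or> y \<in> elts x" if xy: "x \<in> elts a" "y \<in> elts a" for x y
    proof -
      have s: "elts (vset {x, y}) = {x, y}" by (rule elts_vset_pair)
      have "elts (vset {x, y}) \<subseteq> elts a \<and> (\<exists>z. z \<in> elts (vset {x, y}))" unfolding s using xy by blast
      then have "\<exists>m. m \<in> elts (vset {x, y}) \<and> (\<forall>z. z \<in> elts (vset {x, y}) \<longrightarrow> m = z \<or> m \<in> elts z)"
        by (rule a[THEN conjunct2, THEN conjunct2, THEN spec, THEN mp])
      then show ?thesis unfolding s by blast
    qed
    with a[THEN conjunct1] show "Ord a" unfolding Ord_def by simp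
  next
    assume a: "Ord a"
    have min: "\<exists>m. m \<in> elts s \<and> (\<forall>x. x \<in> elts s \<longrightarrow> m = x \<or> m \<in> elts x)"
      if s: "elts s \<subseteq> elts a" "y \<in> elts s" for s y
    proof -
      obtain m where m: "m \<in> elts s" "\<forall>y\<in>elts m. y \<notin> elts s"
        using mem_minimal[OF s(2)] by blast
      have "m = x \<or> m \<in> elts x" if x: "x \<in> elts s" for x
      proof -
        have "m \<in> elts a" "x \<in> elts a" using m(1) x s(1) by blast+
        then have "m \<in> elts x \<or> m = x \<or> x \<in> elts m" using a unfolding Ord_def by blast
        then show ?thesis using m(2) x by blast
      qed
      with m(1) show ?thesis by blast
    qed
    have trans: "x \<in> elts z" if xyz: "x \<in> elts a" "z \<in> elts a" "x \<in> elts y" "y \<in> elts z" for x y z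
    proof -
      \<comment> \<open>A membership-minimal element of \<open>{x, y, z}\<close> rules out the cycle
        in which \<open>z\<close> is a member of \<open>x\<close>.\<close>
      obtain m where m: "m \<in> {x, y, z}" "\<forall>w\<in>elts m. w \<notin> {x, y, z}"
        using mem_minimal[of x "{x, y, z}"] by blast
      have "z \<notin> elts x" using m xyz(3,4) by blast
      moreover have "x \<noteq> z" using xyz(3,4) mem_asym by blast
      moreover have "x \<in> elts z \<or> x = z \<or> z \<in> elts x" using a xyz(1,2) unfolding Ord_def by blast
      ultimately show ?thesis by blast
    qed
    show "?trans \<and> ?trans' \<and> ?min"
    proof (intro conjI allI impI)
      show "elts x \<subseteq> elts a" if "x \<in> elts a" for x using a that unfolding Ord_def by blast
    qed (use min trans in blast)+
  qed
  finally show ?thesis .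
qed

section \<open>Comparison of ordinals\<close>

lemma Ord_transD: "Ord a \<Longrightarrow> x \<in> elts a \<Longrightarrow> y \<in> elts x \<Longrightarrow> y \<in> elts a"
  unfolding Ord_def by blast

lemma Ord_member: "Ord a \<Longrightarrow> x \<in> elts a \<Longrightarrow> Ord x"
proof -
  assume a: "Ord a" "x \<in> elts a"
  then have sub: "elts x \<subseteq> elts a" unfolding Ord_def by blast
  have "z \<in> elts x" if "y \<in> elts x" "z \<in> elts y" for y z
  proof -
    have "z \<in> elts a" using that sub a Ord_transD by blast
    then have "z \<in> elts x \<or> z = x \<or> x \<in> elts z" using a unfolding Ord_def by blast
    moreover have "z \<noteq> x" using that mem_asym by blast
    moreover have "x \<notin> elts z"
    proof
      assume "x \<in> elts z"
      obtain m where m: "m \<in> {x, y, z}" "\<forall>w\<in>elts m. w \<notin> {x, y, z}"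
        using mem_minimal[of x "{x, y, z}"] by blast
      then show False using \<open>x \<in> elts z\<close> that by blast
    qed
    ultimately show ?thesis by blast
  qed
  then show "Ord x" using a sub unfolding Ord_def by blast
qed

text \<open>The least member of \<open>b\<close> outside \<open>a\<close> is \<open>a\<close>
  itself.\<close>

lemma Ord_subset_mem:
  assumes "Ord a" "Ord b" "elts a \<subseteq> elts b" "a \<noteq> b"
  shows "a \<in> elts b"
proof -
  have "\<exists>x. x \<in> elts b - elts a" using assms extensionality by blast
  then obtain m where "m \<in> elts b - elts a" "\<forall>y\<in>elts m. y \<notin> elts b - elts a"
    using mem_minimal[of _ "elts b - elts a"] by blast
  then have m: "m \<in> elts b" "m \<notin> elts a" "\<And>y. y \<in> elts m \<Longrightarrow> y \<in> elts b \<Longrightarrow> y \<in> elts a"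
    by blast+
  have "elts m \<subseteq> elts a" using m(1,3) assms(2) Ord_transD by blast
  moreover have "elts a \<subseteq> elts m"
  proof
    fix x assume x: "x \<in> elts a"
    then have "x \<in> elts m \<or> x = m \<or> m \<in> elts x" using assms m(1) unfolding Ord_def by blast
    then show "x \<in> elts m" using x m(2) assms(1) Ord_transD by blast
  qed
  ultimately show ?thesis using m(1) extensionality by blast
qed

text \<open>The intersection of \<open>a\<close> and \<open>b\<close> is an ordinal; if it differed
  from both it would belong to both, hence to itself.\<close>

lemma Ord_linear:
  assumes "Ord a" "Ord b"
  shows "a \<in> elts b \<or> a = b \<or> b \<in> elts a"
proof -
  define c where "c = vset (elts a \<inter> elts b)"
  have c: "elts c = elts a \<inter> elts b" unfolding c_def by (rule small_subset[of _ a]) blast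
  have "Ord c"
    unfolding Ord_def
  proof (intro conjI ballI)
    fix x assume "x \<in> elts c"
    then show "elts x \<subseteq> elts c" using assms unfolding c Ord_def by simp
  next
    fix x y assume "x \<in> elts c" "y \<in> elts c"
    then have "x \<in> elts a" "y \<in> elts a" unfolding c by simp_all
    then show "x \<in> elts y \<or> x = y \<or> y \<in> elts x" using assms(1) unfolding Ord_def by blast
  qed
  then have "c = a \<or> c \<in> elts a" "c = b \<or> c \<in> elts b"
    using Ord_subset_mem[of c] assms c by blast+
  then show ?thesis using c mem_irrefl by blast
qed

lemma V_models_Limit [simp]:
  "V_models (Limit_fm a) \<longleftrightarrow> Ord a \<and> elts a \<noteq> {} \<and> (\<forall>x\<in>elts a. \<exists>y\<in>elts a. x \<in> elts y)"
  by (auto simp: Limit_fm_def)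

lemma V_models_Card [simp]:
  "V_models (Card_fm k) \<longleftrightarrow> Ord k \<and> (\<forall>x\<in>elts k. \<not> (\<exists>F. bij_betw F (elts x) (elts k)))"
  using V_models_bij_ex by (auto simp: Card_fm_def)

section \<open>\<open>\<omega>\<close> and \<open>\<omega>\<^sub>1\<close> as the sets of finite and
  of countable ordinals\<close>

lemma finite_Ord_set_has_max:
  assumes "finite X" "X \<noteq> {}" "\<And>x. x \<in> X \<Longrightarrow> Ord x"
  shows "\<exists>m\<in>X. \<forall>x\<in>X. x = m \<or> x \<in> elts m"
  using assms
proof (induction X rule: finite_ne_induct)
  case (insert x X)
  then obtain m where m: "m \<in> X" "\<forall>x\<in>X. x = m \<or> x \<in> elts m" by blast
  then consider "m \<in> elts x" | "x = m" | "x \<in> elts m" using Ord_linear insert.prems by blast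
  then show ?case
  proof cases
    case 1
    have "Ord x" using insert.prems by blast
    then have "\<forall>y\<in>X. y \<in> elts x" using 1 m(2) Ord_transD[of x m] by metis
    then show ?thesis by blast
  qed (use m in auto)
qed auto

text \<open>A member of \<open>w\<close> is not a limit, so it is empty or has a greatest member,
  and induction makes it finite. Conversely \<open>w\<close> has no greatest member, so it is
  infinite and not included in any finite ordinal.\<close>

lemma omega_members:
  assumes w: "V_models (omega_fm w)"
  shows "x \<in> elts w \<longleftrightarrow> Ord x \<and> finite (elts x)"
proof -
  have lim: "Ord w" "elts w \<noteq> {}" "\<And>x. x \<in> elts w \<Longrightarrow> \<exists>y\<in>elts w. x \<in> elts y"
    and least: "\<And>x. x \<in> elts w \<Longrightarrow> \<not> V_models (Limit_fm x)"
  proof -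
    have "V_models (Limit_fm w)" "\<forall>x. x \<in> elts w \<longrightarrow> \<not> V_models (Limit_fm x)"
      using w unfolding omega_fm_def by (simp_all del: V_models_Limit)
    then show "Ord w" "elts w \<noteq> {}" "\<And>x. x \<in> elts w \<Longrightarrow> \<exists>y\<in>elts w. x \<in> elts y"
      "\<And>x. x \<in> elts w \<Longrightarrow> \<not> V_models (Limit_fm x)"
      unfolding V_models_Limit by blast+
  qed
  have fin: "x \<in> elts w \<Longrightarrow> finite (elts x)" for x
  proof (induction x rule: mem_induct)
    case (1 x)
    then have "Ord x" using lim(1) Ord_member by blast
    then consider "elts x = {}" | y where "y \<in> elts x" "\<forall>z\<in>elts x. y \<notin> elts z"
      using least[OF 1(2)] unfolding V_models_Limit by blast
    then show ?case
    proof cases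
      case 2
      then have "elts x \<subseteq> insert y (elts y)" using \<open>Ord x\<close> unfolding Ord_def by blast
      moreover have "finite (elts y)" using 1 2 lim(1) Ord_transD by blast
      ultimately show ?thesis using finite_subset by blast
    qed simp
  qed
  have inf: "infinite (elts w)"
  proof
    assume "finite (elts w)"
    then obtain m where "m \<in> elts w" "\<forall>x\<in>elts w. x = m \<or> x \<in> elts m"
      using finite_Ord_set_has_max[of "elts w"] lim(1,2) Ord_member by blast
    with lim(3) show False by (metis mem_asym mem_irrefl)
  qed
  show ?thesis
  proof
    assume x: "Ord x \<and> finite (elts x)"
    have "\<not> elts w \<subseteq> elts x" using x inf finite_subset by blast
    then have "w \<noteq> x" "w \<notin> elts x" using x unfolding Ord_def by blast+
    then show "x \<in> elts w" using Ord_linear x lim(1) by blast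
  qed (use fin lim(1) Ord_member in blast)
qed

lemma omega_infinite: "V_models (omega_fm w) \<Longrightarrow> infinite (elts w)"
  using omega_members[of w w] by (auto simp: omega_fm_def)

lemma omega_unique: "V_models (omega_fm w) \<Longrightarrow> V_models (omega_fm w') \<Longrightarrow> w = w'"
  by (intro extensionality) (auto simp: omega_members)

lemma V_models_csucc:
  "V_models (csucc_fm k l) \<longleftrightarrow>
     V_models (Card_fm l) \<and> k \<in> elts l \<and> (\<forall>m\<in>elts l. V_models (Card_fm m) \<longrightarrow> k \<notin> elts m)"
  unfolding csucc_fm_def by auto

text \<open>Take the least ordinal equinumerous with \<open>a\<close>.\<close>

lemma Ord_bij_Card:
  assumes "Ord a"
  obtains b F where "V_models (Card_fm b)" "b = a \<or> b \<in> elts a" "bij_betw F (elts b) (elts a)"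
proof -
  let ?X = "insert a (elts a)"
  have "a \<in> {b \<in> ?X. \<exists>F. bij_betw F (elts b) (elts a)}"
    using bij_betw_id[of "elts a"] by (intro CollectI conjI insertI1 exI)
  then obtain b where "b \<in> {b \<in> ?X. \<exists>F. bij_betw F (elts b) (elts a)}"
    and "\<forall>y\<in>elts b. y \<notin> {b \<in> ?X. \<exists>F. bij_betw F (elts b) (elts a)}"
    using mem_minimal[of a "{b \<in> ?X. \<exists>F. bij_betw F (elts b) (elts a)}"] by blast
  then have b: "b \<in> ?X" "\<exists>F. bij_betw F (elts b) (elts a)"
    "\<And>y. y \<in> elts b \<Longrightarrow> y \<in> ?X \<Longrightarrow> \<not> (\<exists>F. bij_betw F (elts y) (elts a))"
    by blast+
  obtain F where F: "bij_betw F (elts b) (elts a)" using b(2) by blast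
  have "\<not> bij_betw G (elts y) (elts b)" if y: "y \<in> elts b" for y G
  proof
    assume "bij_betw G (elts y) (elts b)"
    from bij_betw_trans[OF this F] have "\<exists>F. bij_betw F (elts y) (elts a)" by blast
    moreover have "y \<in> ?X" using y b(1) assms Ord_transD by blast
    ultimately show False using b(3) y by blast
  qed
  moreover have "Ord b" using b(1) assms Ord_member by blast
  ultimately have "V_models (Card_fm b)" unfolding V_models_Card by blast
  with b(1) F that show thesis by blast
qed

text \<open>A member of \<open>w1\<close> is equinumerous with a cardinal of \<open>w1\<close>; by
  minimality of \<open>w1\<close> that cardinal is not above \<open>w\<close>, so it is countable.
  If \<open>w1\<close> itself were countable, it would be equinumerous with its member
  \<open>w\<close>.\<close>

lemma omega1_members:
  assumes w: "V_models (omega_fm w)" and w1: "V_models (csucc_fm w w1)"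
  shows "x \<in> elts w1 \<longleftrightarrow> Ord x \<and> countable (elts x)"
proof -
  have Ord: "Ord w" "Ord w1" using w w1 by (auto simp: omega_fm_def V_models_csucc)
  have cw: "countable (elts w)"
  proof (rule countableI)
    \<comment> \<open>Of two distinct finite ordinals one is a proper subset of the other, so sizes
      separate them.\<close>
    show "inj_on (\<lambda>n. card (elts n)) (elts w)"
    proof (rule inj_onI, rule ccontr)
      fix x y assume xy: "x \<in> elts w" "y \<in> elts w" "card (elts x) = card (elts y)" "x \<noteq> y"
      have less: "card (elts u) < card (elts v)" if "u \<in> elts v" "v \<in> elts w" for u v
      proof (rule psubset_card_mono)
        have v: "Ord v" "finite (elts v)" using omega_members[OF w, of v] that(2) by simp_all
        then show "finite (elts v)" by simp
        have "elts u \<noteq> elts v" using that(1) mem_irrefl[of u] by metis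
        then show "elts u \<subset> elts v" using v(1) that(1) unfolding Ord_def by blast
      qed
      have "x \<in> elts y \<or> y \<in> elts x" using xy Ord(1) unfolding Ord_def by blast
      then show False using less xy by fastforce
    qed
  qed
  have c: "countable (elts x)" if x: "x \<in> elts w1" for x
  proof -
    have "Ord x" using x Ord Ord_member by blast
    then obtain b F where b: "V_models (Card_fm b)" "b = x \<or> b \<in> elts x" "bij_betw F (elts b) (elts x)"
      by (rule Ord_bij_Card)
    have "b \<in> elts w1" using b(2) x Ord(2) Ord_transD by blast
    then have "w \<notin> elts b" using w1 b(1) unfolding V_models_csucc by blast
    moreover have "Ord b" using b by simp
    ultimately have "elts b \<subseteq> elts w" using Ord_linear[of b w] Ord(1) unfolding Ord_def by blast
    then have "countable (elts b)" using cw countable_subset by blast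
    then show ?thesis using b(3) countable_image unfolding bij_betw_def by metis
  qed
  have uc: "uncountable (elts w1)"
  proof
    assume "countable (elts w1)"
    moreover have "w \<in> elts w1" using w1 unfolding V_models_csucc by blast
    moreover have "infinite (elts w1)"
    proof (rule infinite_super[OF _ omega_infinite[OF w]])
      show "elts w \<subseteq> elts w1" using \<open>w \<in> elts w1\<close> Ord(2) unfolding Ord_def by blast
    qed
    ultimately obtain F where "bij_betw F (elts w) (elts w1)"
      using omega_infinite[OF w] cw by (metis bij_betw_from_nat_into bij_betw_trans to_nat_on_infinite)
    then show False using \<open>w \<in> elts w1\<close> w1 unfolding V_models_csucc by auto
  qed
  show ?thesis
  proof
    assume x: "Ord x \<and> countable (elts x)"
    have "\<not> elts w1 \<subseteq> elts x" using x uc countable_subset by blast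
    then have "w1 \<noteq> x" "w1 \<notin> elts x" using x unfolding Ord_def by blast+
    then show "x \<in> elts w1" using Ord_linear x Ord by blast
  qed (use c Ord Ord_member in blast)
qed

lemma omega1_uncountable:
  "V_models (omega_fm w) \<Longrightarrow> V_models (csucc_fm w w1) \<Longrightarrow> uncountable (elts w1)"
  using omega1_members[of w w1 w1] by (auto simp: V_models_csucc)

text \<open>For infinite \<open>x\<close> the fibres cover \<open>k\<close> by as many countable
  sets as \<open>x\<close> has members, so \<open>k\<close> injects into \<open>x\<close>, and
  Schroeder-Bernstein contradicts that \<open>k\<close> is a cardinal; for finite \<open>x\<close>
  the set \<open>k\<close> would be countable. This is what the chain condition produces from a name
  of a collapsing bijection.\<close>

lemma Card_no_countable_to_one:
  includes cardinal_syntax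
  assumes k: "V_models (Card_fm k)" "uncountable (elts k)" and x: "x \<in> elts k"
    and F: "F ` elts k \<subseteq> elts x" and fib: "\<And>y. y \<in> elts x \<Longrightarrow> countable {z \<in> elts k. F z = y}"
  shows False
proof -
  have K: "elts k = (\<Union>y\<in>elts x. {z \<in> elts k. F z = y})" using F by blast
  have inf: "infinite (elts x)"
  proof
    assume "finite (elts x)"
    then have "countable (\<Union>y\<in>elts x. {z \<in> elts k. F z = y})"
      using fib by (auto intro: countable_finite)
    then show False using K k(2) by simp
  qed
  have "|{z \<in> elts k. F z = y}| \<le>o |elts x|" if y: "y \<in> elts x" for y
  proof -
    obtain g :: "'a \<Rightarrow> nat" where "inj_on g {z \<in> elts k. F z = y}"
      using fib[OF y] by (rule countableE)
    then have "|{z \<in> elts k. F z = y}| \<le>o |UNIV :: nat set|"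
      using card_of_ordLeq[of "{z \<in> elts k. F z = y}" "UNIV :: nat set"] by blast
    moreover have "|UNIV :: nat set| \<le>o |elts x|" using inf by (simp add: infinite_iff_card_of_nat)
    ultimately show ?thesis by (rule ordLeq_transitive)
  qed
  then have "|\<Union>y\<in>elts x. {z \<in> elts k. F z = y}| \<le>o |elts x|"
    by (intro card_of_UNION_ordLeq_infinite inf) (auto intro: card_of_mono1)
  then have "|elts k| \<le>o |elts x|" using K by simp
  then obtain g where "inj_on g (elts k)" "g ` elts k \<subseteq> elts x" using card_of_ordLeq by metis
  moreover have "id ` elts x \<subseteq> elts k" using k(1) x by (auto simp: Ord_def)
  ultimately obtain h where "bij_betw h (elts x) (elts k)"
    using Schroeder_Bernstein[of id "elts x" "elts k" g] by auto
  then show False using k(1) x by auto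
qed

section \<open>Mostowski collapse and subsets of prescribed order type\<close>

function collapse :: "'v::zfc set \<Rightarrow> 'v \<Rightarrow> 'v" where
  "collapse X x = vset (collapse X ` (X \<inter> elts x))"
  by auto
termination
  by (relation "inv_image elem_rel snd") (auto simp: wf_elem_rel, simp add: elem_rel_def)

declare collapse.simps [simp del]

lemma elts_collapse: "elts (collapse X x) = collapse X ` (X \<inter> elts x)"
proof -
  have "elts (vset (X \<inter> elts x)) = X \<inter> elts x" by (rule small_subset[of _ x]) blast
  then show ?thesis
    by (subst collapse.simps) (metis small_image)
qed

lemma collapse_less_iff:
  assumes "\<And>x. x \<in> X \<Longrightarrow> Ord x" "x \<in> X" "y \<in> X"
  shows "collapse X x \<in> elts (collapse X y) \<longleftrightarrow> x \<in> elts y"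
proof -
  have mono: "collapse X u \<in> elts (collapse X v)" if "u \<in> X" "u \<in> elts v" for u v
    using that by (simp add: elts_collapse)
  consider "x \<in> elts y" | "x = y" | "y \<in> elts x"
    using Ord_linear[of x y] assms by blast
  then show ?thesis
  proof cases
    case 3
    then show ?thesis using mono[OF assms(3) 3] mem_asym by metis
  qed (use mono[OF assms(2)] in simp_all)
qed

lemma collapse_inj:
  assumes "\<And>x. x \<in> X \<Longrightarrow> Ord x"
  shows "inj_on (collapse X) X"
proof (rule inj_onI)
  fix x y assume xy: "x \<in> X" "y \<in> X" "collapse X x = collapse X y"
  then have "x \<notin> elts y" "y \<notin> elts x"
    using collapse_less_iff[OF assms] mem_irrefl by metis+
  then show "x = y" using Ord_linear[of x y] assms xy by blast
qed

text \<open>The value at \<open>x\<close> is the order type of the part of \<open>X\<close> below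
  \<open>x\<close>. Comparability comes from \<open>collapse_less_iff\<close>, transitivity from
  that of \<open>x\<close>.\<close>

lemma Ord_collapse:
  assumes X: "\<And>x. x \<in> X \<Longrightarrow> Ord x" and x: "x \<in> X"
  shows "Ord (collapse X x)"
  unfolding Ord_def
proof (intro conjI ballI)
  fix u assume "u \<in> elts (collapse X x)"
  then show "elts u \<subseteq> elts (collapse X x)"
    using Ord_transD[OF X[OF x]] unfolding elts_collapse[of X x] by (auto simp: elts_collapse)
next
  fix u v assume "u \<in> elts (collapse X x)" "v \<in> elts (collapse X x)"
  then show "u \<in> elts v \<or> u = v \<or> v \<in> elts u"
    using Ord_linear X collapse_less_iff[OF X] unfolding elts_collapse[of X x] by blast
qed

lemma V_models_otpI:
  assumes "Ord a" "bij_betw F (elts a) (elts A)"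
    and "\<And>x y. x \<in> elts a \<Longrightarrow> y \<in> elts a \<Longrightarrow> x \<in> elts y \<longleftrightarrow> F x \<in> elts (F y)"
  shows "V_models (otp_fm A a)"
  using assms V_models_bij_vgraph[OF assms(2)]
  by (auto simp: otp_fm_def vpair_in_vgraph intro!: exI[of _ "vgraph F a"])

text \<open>For \<open>a = \<omega>\<close> the property \<open>Q\<close> is finiteness, for \<open>a = \<omega>\<^sub>1\<close> it is countability.\<close>

lemma subset_of_order_type:
  assumes a: "Ord a" "\<And>x. x \<in> elts a \<longleftrightarrow> Ord x \<and> Q (elts x)"
    and Q_subset: "\<And>X Y. Q Y \<Longrightarrow> X \<subseteq> Y \<Longrightarrow> Q X"
    and Q_image: "\<And>(f :: 'v \<Rightarrow> 'v) Y. Q Y \<Longrightarrow> Q (f ` Y)"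
    and X: "X \<subseteq> elts d" "Ord d" "\<not> Q X"
  obtains A :: "'v::zfc" where "elts A \<subseteq> X" "V_models (otp_fm A a)"
proof -
  \<comment> \<open>The initial segment of those elements that have few predecessors. Cutting
    \<open>X\<close> here makes the order type exactly \<open>a\<close> and not larger.\<close>
  define Y where "Y = {x \<in> X. Q (X \<inter> elts x)}"
  have Ord: "Ord y" if "y \<in> Y" for y
    using that X(1,2) Ord_member unfolding Y_def by blast
  have QY: "Q (Y \<inter> elts y)" if "y \<in> Y" for y
    using that Q_subset[of "X \<inter> elts y" "Y \<inter> elts y"] unfolding Y_def by blast
  have nQY: "\<not> Q Y"
  proof (cases "X \<subseteq> Y")
    case True
    then show ?thesis using X(3) Q_subset by blast
  next
    case False
    then have "\<exists>x. x \<in> X - Y" by blast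
    \<comment> \<open>Below the first element \<open>m\<close> left out, \<open>X\<close> is
      included in \<open>Y\<close>, and this part is already too large for \<open>Q\<close>.\<close>
    then obtain m where "m \<in> X - Y" "\<forall>y\<in>elts m. y \<notin> X - Y"
      using mem_minimal[of _ "X - Y"] by blast
    then have "X \<inter> elts m \<subseteq> Y" "\<not> Q (X \<inter> elts m)" unfolding Y_def by blast+
    then show ?thesis using Q_subset by blast
  qed
  define A where "A = vset Y"
  have A: "elts A = Y" unfolding A_def by (rule small_subset[of _ d]) (use X(1) in \<open>auto simp: Y_def\<close>)
  have sub: "collapse Y ` Y \<subseteq> elts a"
    using a(2) Ord_collapse[OF Ord] Q_image[OF QY] by (auto simp: elts_collapse)
  \<comment> \<open>A missed \<open>m\<close> in \<open>a\<close> would bound the transitive set of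
    all values. The values would then satisfy \<open>Q\<close>, and so would \<open>Y\<close>, their
    image under the inverse of the collapse.\<close>
  have "elts a \<subseteq> collapse Y ` Y"
  proof (rule ccontr)
    assume "\<not> elts a \<subseteq> collapse Y ` Y"
    then obtain m where m: "m \<in> elts a" "m \<notin> collapse Y ` Y" by blast
    have "collapse Y ` Y \<subseteq> elts m"
    proof
      fix u assume u: "u \<in> collapse Y ` Y"
      then have "u \<in> elts m \<or> u = m \<or> m \<in> elts u" using sub m(1) a(1) unfolding Ord_def by blast
      moreover have "elts u \<subseteq> collapse Y ` Y" using u by (auto simp: elts_collapse)
      ultimately show "u \<in> elts m" using m(2) u by blast
    qed
    then have "Q (collapse Y ` Y)" using m(1) a(2) Q_subset by blast
    then have "Q (inv_into Y (collapse Y) ` collapse Y ` Y)" by (rule Q_image)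
    moreover have "inv_into Y (collapse Y) ` collapse Y ` Y = Y"
      using collapse_inj[OF Ord] by (simp add: image_image)
    ultimately show False using nQY by simp
  qed
  with sub have bij: "bij_betw (collapse Y) Y (elts a)"
    using collapse_inj[OF Ord] unfolding bij_betw_def by blast
  have "V_models (otp_fm A a)"
  proof (rule V_models_otpI[OF a(1)])
    show "bij_betw (inv_into Y (collapse Y)) (elts a) (elts A)"
      unfolding A by (rule bij_betw_inv_into[OF bij])
    fix x y assume xy: "x \<in> elts a" "y \<in> elts a"
    then have "inv_into Y (collapse Y) x \<in> Y" "inv_into Y (collapse Y) y \<in> Y"
      "collapse Y (inv_into Y (collapse Y) x) = x" "collapse Y (inv_into Y (collapse Y) y) = y"
      using bij by (auto simp: bij_betw_def inv_into_into f_inv_into_f)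
    then show "x \<in> elts y \<longleftrightarrow> inv_into Y (collapse Y) x \<in> elts (inv_into Y (collapse Y) y)"
      using collapse_less_iff[OF Ord] by metis
  qed
  then show thesis using that A unfolding Y_def by blast
qed


section \<open>Absoluteness and preservation of cardinals\<close>

context forcing_poset
begin

section \<open>Absoluteness of ordinals, \<open>\<omega>\<close> and bijections for every
  poset\<close>

lemma forces_subset_check:
  assumes "elts x \<subseteq> elts y"
  shows "p \<tturnstile> subset_fm (chk x) (chk y)"
  unfolding forces_subset_iff
proof (intro allI impI)
  fix z q assume "q \<tturnstile> (z \<^bold>\<in> chk x)"
  then show "q \<tturnstile> (z \<^bold>\<in> chk y)"
    unfolding forces_mem_check_iff using assms by blast
qed

lemma forces_check_not_mem: "x \<notin> elts y \<Longrightarrow> p \<tturnstile> (\<^bold>\<not> chk x \<^bold>\<in> chk y)"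
  unfolding forces_Neg using forces_check_memD stronger_cond by blast

text \<open>The clause with content is the last one: \<open>s\<close> there names a subset that may
  be new, so its least element can only be found densely.\<close>

lemma forces_Ord_check:
  assumes a: "Ord a"
  shows "p \<tturnstile> Ord_fm (chk a)"
  unfolding Ord_fm_def forces_Conj
proof (intro conjI)
  show "p \<tturnstile> (\<^bold>\<forall>x. x \<^bold>\<in> chk a \<^bold>\<longrightarrow> subset_fm x (chk a))"
  proof (rule forces_Forall_check)
    fix y q assume "y \<in> elts a"
    then show "q \<tturnstile> subset_fm (chk y) (chk a)"
      using a by (intro forces_subset_check) (simp add: Ord_def)
  qed (unfold fm_defs, (intro fcong_rules; (assumption | rule forces_refl)))
  show "p \<tturnstile> (\<^bold>\<forall>x. x \<^bold>\<in> chk a \<^bold>\<longrightarrow> \<^bold>\<not> x \<^bold>\<in> x)"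
    by (rule forces_Forall_check)
      (intro forces_check_not_mem mem_irrefl fcong_rules; (assumption | rule forces_refl))+
  show "p \<tturnstile> (\<^bold>\<forall>x. \<^bold>\<forall>y. \<^bold>\<forall>z. x \<^bold>\<in> chk a \<^bold>\<and> y \<^bold>\<in> chk a \<^bold>\<and> z \<^bold>\<in> chk a \<^bold>\<and> x \<^bold>\<in> y \<^bold>\<and> y \<^bold>\<in> z \<^bold>\<longrightarrow> x \<^bold>\<in> z)"
    unfolding forces_Forall forces_Imp forces_Conj
  proof (intro allI impI, elim conjE)
    fix x y z q
    assume z: "q \<tturnstile> (z \<^bold>\<in> chk a)" and xy: "q \<tturnstile> (x \<^bold>\<in> y)" and yz: "q \<tturnstile> (y \<^bold>\<in> z)"
    from z show "q \<tturnstile> (x \<^bold>\<in> z)"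
    proof (rule forces_mem_checkE)
      fix r z0 assume r: "r \<preceq> q" "z0 \<in> elts a" "r \<tturnstile> (z \<^bold>= chk z0)"
      have "r \<tturnstile> (y \<^bold>\<in> chk z0)" using forces_mem_eq[OF forces_mono[OF yz r(1)] r(3)] .
      then show "r \<tturnstile> (x \<^bold>\<in> z)"
      proof (rule forces_mem_checkE)
        fix s y0 assume s: "s \<preceq> r" "y0 \<in> elts z0" "s \<tturnstile> (y \<^bold>= chk y0)"
        have "elts y0 \<subseteq> elts z0" using Ord_member[OF a r(2)] s(2) unfolding Ord_def by blast
        have "s \<tturnstile> (x \<^bold>\<in> chk y0)"
          using forces_mem_eq[OF forces_mono[OF xy] s(3)] stronger_trans[OF s(1) r(1)] by blast
        then have "s \<tturnstile> (x \<^bold>\<in> chk z0)"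
          unfolding forces_mem_check_iff using \<open>elts y0 \<subseteq> elts z0\<close> by blast
        then show "s \<tturnstile> (x \<^bold>\<in> z)"
          using forces_mem_eq forces_sym[OF forces_mono[OF r(3) s(1)]] by blast
      qed
    qed
  qed
  show "p \<tturnstile> (\<^bold>\<forall>s. subset_fm s (chk a) \<^bold>\<and> (\<^bold>\<exists>x. x \<^bold>\<in> s) \<^bold>\<longrightarrow>
         (\<^bold>\<exists>m. m \<^bold>\<in> s \<^bold>\<and> (\<^bold>\<forall>x. x \<^bold>\<in> s \<^bold>\<longrightarrow> m \<^bold>= x \<^bold>\<or> m \<^bold>\<in> x)))" (is "p \<tturnstile> (\<^bold>\<forall>s. ?hyp s \<^bold>\<longrightarrow> ?min s)")
    unfolding forces_Forall forces_Imp
  proof (intro allI impI)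
    fix s p1 assume s: "is_name P s" "p1 \<preceq> p" "p1 \<tturnstile> ?hyp s"
    show "p1 \<tturnstile> ?min s"
    proof (rule forces_dense)
      fix q assume q: "q \<preceq> p1"
      have in_a: "r \<tturnstile> (x \<^bold>\<in> chk a)" if "r \<preceq> q" "is_name P x" "r \<tturnstile> (x \<^bold>\<in> s)" for r x
        using s(3) that stronger_trans[OF that(1) q] unfolding forces_Conj forces_subset_iff by blast
      \<comment> \<open>All possible members of \<open>s\<close> below \<open>q\<close>, a class of
        the ground model. A condition \<open>t\<close> that puts its least element \<open>m\<close>
        into \<open>s\<close> also forces minimality, since a member of \<open>s\<close> decided
        below \<open>t\<close> belongs to \<open>X\<close>.\<close>
      define X where "X = {x \<in> elts a. \<exists>r. r \<preceq> q \<and> r \<tturnstile> (chk x \<^bold>\<in> s)}"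
      obtain r u where r: "r \<preceq> q" "is_name P u" "r \<tturnstile> (u \<^bold>\<in> s)"
        using s(3) q unfolding forces_Conj forces_Exists by blast
      obtain r' x where r': "r' \<preceq> r" "x \<in> elts a" "r' \<tturnstile> (u \<^bold>= chk x)"
        using in_a[OF r] stronger_self[OF r(1)] unfolding forces_mem_check_iff by blast
      have "r' \<tturnstile> (chk x \<^bold>\<in> s)"
        using forces_Mem_subst[OF forces_mono[OF r(3) r'(1)] r'(3) forces_refl] .
      then have "x \<in> X" using r'(1,2) stronger_trans[OF r'(1) r(1)] unfolding X_def by blast
      then obtain m where m: "m \<in> X" "\<forall>y\<in>elts m. y \<notin> X" using mem_minimal by blast
      then obtain t where t: "t \<preceq> q" "t \<tturnstile> (chk m \<^bold>\<in> s)" and ma: "m \<in> elts a" unfolding X_def by blast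
      have "t \<tturnstile> (\<^bold>\<forall>x. x \<^bold>\<in> s \<^bold>\<longrightarrow> chk m \<^bold>= x \<^bold>\<or> chk m \<^bold>\<in> x)"
        unfolding forces_Forall forces_Imp
      proof (intro allI impI)
        fix x t1 assume x: "is_name P x" "t1 \<preceq> t" "t1 \<tturnstile> (x \<^bold>\<in> s)"
        have t1: "t1 \<preceq> q" using stronger_trans[OF x(2) t(1)] .
        from in_a[OF t1 x(1,3)] show "t1 \<tturnstile> (chk m \<^bold>= x \<^bold>\<or> chk m \<^bold>\<in> x)"
        proof (rule forces_mem_checkE)
          fix t2 y assume y: "t2 \<preceq> t1" "y \<in> elts a" "t2 \<tturnstile> (x \<^bold>= chk y)"
          have "t2 \<tturnstile> (chk y \<^bold>\<in> s)"
            using forces_Mem_subst[OF forces_mono[OF x(3) y(1)] y(3) forces_refl] .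
          then have "y \<in> X" using y(2) stronger_trans[OF y(1) t1] unfolding X_def by blast
          then have "m = y \<or> m \<in> elts y" using m(2) a ma y(2) unfolding Ord_def by blast
          then show "t2 \<tturnstile> (chk m \<^bold>= x \<^bold>\<or> chk m \<^bold>\<in> x)"
            using forces_DisjI1[OF forces_sym] forces_DisjI2[OF forces_mem_eq[OF forces_mem_checkI forces_sym]] y(3)
            by blast
        qed
      qed
      then have "t \<tturnstile> ?min s"
        using t(2) by (intro forces_ExistsI[OF is_name_check[of m]]) (simp only: forces_Conj)
      then show "\<exists>t. t \<preceq> q \<and> t \<tturnstile> ?min s" using t(1) by blast
    qed
  qed
qed

lemma forces_Limit_check:
  assumes "V_models (Limit_fm a)"
  shows "p \<tturnstile> Limit_fm (chk a)"
  unfolding Limit_fm_def forces_Conj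
proof (intro conjI)
  show "p \<tturnstile> Ord_fm (chk a)" using assms by (intro forces_Ord_check) simp
  obtain x where "x \<in> elts a" using assms by auto
  then show "p \<tturnstile> (\<^bold>\<exists>x. x \<^bold>\<in> chk a)"
    by (intro forces_ExistsI[OF is_name_check[of x]] forces_mem_checkI)
  show "p \<tturnstile> (\<^bold>\<forall>x. x \<^bold>\<in> chk a \<^bold>\<longrightarrow> (\<^bold>\<exists>y. y \<^bold>\<in> chk a \<^bold>\<and> x \<^bold>\<in> y))"
  proof (rule forces_Forall_check)
    fix x q assume "x \<in> elts a"
    then obtain y where "y \<in> elts a" "x \<in> elts y" using assms by auto
    then show "q \<tturnstile> (\<^bold>\<exists>y. y \<^bold>\<in> chk a \<^bold>\<and> chk x \<^bold>\<in> y)"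
      by (intro forces_ExistsI[OF is_name_check[of y]]) (simp only: forces_Conj forces_mem_checkI)
  qed (unfold fm_defs, (intro fcong_rules; (assumption | rule forces_refl)))
qed

text \<open>Failure to be a limit has a ground model reason, emptiness or a largest member, and it
  persists because a forced member of \<open>chk a\<close> is densely an old one.\<close>

lemma forces_not_Limit_check:
  assumes "Ord a" "\<not> V_models (Limit_fm a)"
  shows "p \<tturnstile> (\<^bold>\<not> Limit_fm (chk a))"
  unfolding forces_Neg
proof (intro allI impI notI)
  fix q assume q: "q \<preceq> p" and "q \<tturnstile> Limit_fm (chk a)"
  then have ne: "q \<tturnstile> (\<^bold>\<exists>x. x \<^bold>\<in> chk a)"
    and unb: "q \<tturnstile> (\<^bold>\<forall>x. x \<^bold>\<in> chk a \<^bold>\<longrightarrow> (\<^bold>\<exists>y. y \<^bold>\<in> chk a \<^bold>\<and> x \<^bold>\<in> y))"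
    unfolding Limit_fm_def forces_Conj by simp_all
  obtain r u where r: "r \<preceq> q" "r \<tturnstile> (u \<^bold>\<in> chk a)"
    using ne stronger_self[OF q] unfolding forces_Exists by blast
  then have "elts a \<noteq> {}" using stronger_self unfolding forces_mem_check_iff by blast
  then obtain m where m: "m \<in> elts a" "\<forall>y\<in>elts a. m \<notin> elts y" using assms by auto
  have "q \<tturnstile> (\<^bold>\<exists>y. y \<^bold>\<in> chk a \<^bold>\<and> chk m \<^bold>\<in> y)"
    by (rule forces_ImpD[OF forces_ForallD[OF unb is_name_check] stronger_cond[OF q] forces_mem_checkI[OF m(1)]])
  then obtain s y where s: "s \<preceq> q" "s \<tturnstile> (y \<^bold>\<in> chk a)" "s \<tturnstile> (chk m \<^bold>\<in> y)"
    using stronger_self[OF q] unfolding forces_Exists forces_Conj by blast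
  then obtain t z where t: "t \<preceq> s" "z \<in> elts a" "t \<tturnstile> (y \<^bold>= chk z)"
    using stronger_self[OF s(1)] unfolding forces_mem_check_iff[of s y] by blast
  have "t \<tturnstile> (chk m \<^bold>\<in> chk z)" using forces_mem_eq[OF forces_mono[OF s(3) t(1)] t(3)] .
  then show False using forces_check_memD stronger_cond[OF t(1)] m(2) t(2) by blast
qed

lemma fcong_Limit: "p \<tturnstile> (x \<^bold>= x') \<Longrightarrow> fcong p (Limit_fm x) (Limit_fm x')"
  unfolding fm_defs by (intro fcong_rules; (assumption | rule forces_refl))

lemma forces_omega_check:
  assumes w: "V_models (omega_fm w)"
  shows "p \<tturnstile> omega_fm (chk w)"
  unfolding omega_fm_def forces_Conj
proof
  have w': "V_models (Limit_fm w)" "\<forall>x. x \<in> elts w \<longrightarrow> \<not> V_models (Limit_fm x)"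
    using w unfolding omega_fm_def by (simp_all del: V_models_Limit)
  show "p \<tturnstile> Limit_fm (chk w)" using w'(1) by (rule forces_Limit_check)
  show "p \<tturnstile> (\<^bold>\<forall>x. x \<^bold>\<in> chk w \<^bold>\<longrightarrow> \<^bold>\<not> Limit_fm x)"
  proof (rule forces_Forall_check)
    fix x q assume "x \<in> elts w"
    then show "q \<tturnstile> (\<^bold>\<not> Limit_fm (chk x))"
      using w'(2) omega_members[OF w] by (intro forces_not_Limit_check) blast+
  qed (intro fcong_Neg fcong_Limit)
qed

lemma forces_fun_check:
  assumes f: "V_models (fun_fm f X Y)"
  shows "p \<tturnstile> fun_fm (chk f) (chk X) (chk Y)"
  unfolding fun_fm_def forces_Conj
proof
  note pairs = f[unfolded V_models_fun, THEN conjunct1] and total = f[unfolded V_models_fun, THEN conjunct2]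
  show "p \<tturnstile> (\<^bold>\<forall>z. z \<^bold>\<in> chk f \<^bold>\<longrightarrow> (\<^bold>\<exists>x. \<^bold>\<exists>y. x \<^bold>\<in> chk X \<^bold>\<and> y \<^bold>\<in> chk Y \<^bold>\<and> opair_fm z x y))"
  proof (rule forces_Forall_check)
    fix z q assume "z \<in> elts f"
    then obtain x y where xy: "x \<in> elts X" "y \<in> elts Y" "z = vpair x y" using pairs by blast
    show "q \<tturnstile> (\<^bold>\<exists>x. \<^bold>\<exists>y. x \<^bold>\<in> chk X \<^bold>\<and> y \<^bold>\<in> chk Y \<^bold>\<and> opair_fm (chk z) x y)"
      by (rule forces_ExistsI[OF is_name_check[of x]], rule forces_ExistsI[OF is_name_check[of y]])
        (simp only: forces_Conj xy forces_mem_checkI forces_check_opair)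
  qed (unfold fm_defs, (intro fcong_rules; (assumption | rule forces_refl)))
  show "p \<tturnstile> (\<^bold>\<forall>x. x \<^bold>\<in> chk X \<^bold>\<longrightarrow> (\<^bold>\<exists>y. app_fm (chk f) x y \<^bold>\<and> (\<^bold>\<forall>z. app_fm (chk f) x z \<^bold>\<longrightarrow> z \<^bold>= y)))"
  proof (rule forces_Forall_check)
    fix x q assume "x \<in> elts X"
    then obtain y where y: "vpair x y \<in> elts f" "\<forall>z. vpair x z \<in> elts f \<longrightarrow> z = y" using total by blast
    have "q \<tturnstile> (\<^bold>\<forall>z. app_fm (chk f) (chk x) z \<^bold>\<longrightarrow> z \<^bold>= chk y)"
      unfolding forces_Forall forces_Imp
    proof (intro allI impI)
      fix z r assume z: "is_name P z" "r \<tturnstile> app_fm (chk f) (chk x) z"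
      from z(2) is_name_check z(1) show "r \<tturnstile> (z \<^bold>= chk y)"
      proof (rule forces_check_appE)
        fix t u v assume t: "t \<preceq> r" "vpair u v \<in> elts f" "t \<tturnstile> (chk x \<^bold>= chk u)" "t \<tturnstile> (z \<^bold>= chk v)"
        have "x = u" using forces_check_eqD[OF t(3)] stronger_cond[OF t(1)] by blast
        then have "v = y" using y(2) t(2) by blast
        then show "t \<tturnstile> (z \<^bold>= chk y)" using t(4) by simp
      qed (use pairs in blast)
    qed
    then show "q \<tturnstile> (\<^bold>\<exists>y. app_fm (chk f) (chk x) y \<^bold>\<and> (\<^bold>\<forall>z. app_fm (chk f) (chk x) z \<^bold>\<longrightarrow> z \<^bold>= y))"
      by (intro forces_ExistsI[OF is_name_check[of y]]) (simp only: forces_Conj forces_check_appI[OF y(1)])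
  qed (unfold fm_defs, (intro fcong_rules; (assumption | rule forces_refl)))
qed

text \<open>Upward absoluteness: a bijection that refutes cardinality in the ground model still
  refutes it in the extension.\<close>

lemma forces_bij_check:
  assumes f: "V_models (bij_fm f X Y)"
  shows "p \<tturnstile> bij_fm (chk f) (chk X) (chk Y)"
  unfolding bij_fm_def forces_Conj
proof (intro conjI)
  note f' = f[unfolded V_models_bij]
  note pairs = f'[THEN conjunct1, unfolded V_models_fun, THEN conjunct1]
    and inj = f'[THEN conjunct2, THEN conjunct1] and surj = f'[THEN conjunct2, THEN conjunct2]
  have pairs': "\<exists>u v. z = vpair u v" if "z \<in> elts f" for z using pairs that by blast
  show "p \<tturnstile> fun_fm (chk f) (chk X) (chk Y)" using f' by (intro forces_fun_check) (rule conjunct1)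
  show "p \<tturnstile> (\<^bold>\<forall>x. \<^bold>\<forall>x'. \<^bold>\<forall>y. app_fm (chk f) x y \<^bold>\<and> app_fm (chk f) x' y \<^bold>\<longrightarrow> x \<^bold>= x')"
    unfolding forces_Forall forces_Imp forces_Conj
  proof (intro allI impI, elim conjE)
    fix x x' y q assume n: "is_name P x" "is_name P x'" "is_name P y"
      and app: "q \<tturnstile> app_fm (chk f) x y" "q \<tturnstile> app_fm (chk f) x' y"
    from app(1) n(1,3) pairs' show "q \<tturnstile> (x \<^bold>= x')"
    proof (rule forces_check_appE)
      fix r u v assume r: "r \<preceq> q" "vpair u v \<in> elts f" "r \<tturnstile> (x \<^bold>= chk u)" "r \<tturnstile> (y \<^bold>= chk v)"
      from forces_mono[OF app(2) r(1)] n(2,3) pairs' show "r \<tturnstile> (x \<^bold>= x')"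
      proof (rule forces_check_appE)
        fix s u' v' assume s: "s \<preceq> r" "vpair u' v' \<in> elts f" "s \<tturnstile> (x' \<^bold>= chk u')" "s \<tturnstile> (y \<^bold>= chk v')"
        have "s \<tturnstile> (chk v \<^bold>= chk v')"
          using forces_trans[OF forces_sym[OF forces_mono[OF r(4) s(1)]] s(4)] .
        then have "v = v'" using forces_check_eqD stronger_cond[OF s(1)] by blast
        then have "u = u'" using inj r(2) s(2) by blast
        then have "s \<tturnstile> (x' \<^bold>= chk u)" using s(3) by simp
        then show "s \<tturnstile> (x \<^bold>= x')" using forces_trans[OF forces_mono[OF r(3) s(1)]] forces_sym by blast
      qed
    qed
  qed
  show "p \<tturnstile> (\<^bold>\<forall>y. y \<^bold>\<in> chk Y \<^bold>\<longrightarrow> (\<^bold>\<exists>x. app_fm (chk f) x y))"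
  proof (rule forces_Forall_check)
    fix y q assume "y \<in> elts Y"
    then obtain x where "vpair x y \<in> elts f" using surj by blast
    then show "q \<tturnstile> (\<^bold>\<exists>x. app_fm (chk f) x (chk y))"
      by (intro forces_ExistsI[OF is_name_check[of x]] forces_check_appI)
  qed (unfold fm_defs, (intro fcong_rules; (assumption | rule forces_refl)))
qed

text \<open>Surjectivity gives a name for a preimage forced into \<open>chk X\<close>, and a
  stronger condition identifies it with a ground model element. The lemma after this one decides a
  value in the same way.\<close>

lemma forces_bij_app_check:
  assumes f: "p \<tturnstile> bij_fm f (chk X) Y" and y: "p \<tturnstile> (y \<^bold>\<in> Y)" "is_name P y" and p: "p \<in> conds P"
  shows "\<exists>t x. t \<preceq> p \<and> x \<in> elts X \<and> t \<tturnstile> app_fm f (chk x) y"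
proof -
  have fn: "p \<tturnstile> fun_fm f (chk X) Y" and surj: "p \<tturnstile> (\<^bold>\<forall>y. y \<^bold>\<in> Y \<^bold>\<longrightarrow> (\<^bold>\<exists>x. app_fm f x y))"
    using f unfolding bij_fm_def forces_Conj by simp_all
  have "p \<tturnstile> (\<^bold>\<exists>x. app_fm f x y)"
    by (rule forces_ImpD[OF forces_ForallD[OF surj y(2)] p y(1)])
  then obtain q u where q: "q \<preceq> p" "is_name P u" "q \<tturnstile> app_fm f u y"
    using stronger_refl[OF p] unfolding forces_Exists by blast
  have "q \<tturnstile> (u \<^bold>\<in> chk X)"
    using forces_fun_app_mem[OF forces_mono[OF fn q(1)] q(3,2) y(2)] by simp
  then obtain t x where t: "t \<preceq> q" "x \<in> elts X" "t \<tturnstile> (u \<^bold>= chk x)"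
    using stronger_self[OF q(1)] unfolding forces_mem_check_iff by blast
  have "t \<tturnstile> app_fm f (chk x) y"
    using forces_subst[OF fcong_app[OF t(3) forces_refl] forces_mono[OF q(3) t(1)] stronger_cond[OF t(1)]] .
  then show ?thesis using t(2) stronger_trans[OF t(1) q(1)] by blast
qed

lemma forces_fun_value_check:
  assumes f: "p \<tturnstile> fun_fm f (chk X) A" and A: "p \<tturnstile> subset_fm A (chk W)"
    and x: "x \<in> elts X" and p: "p \<in> conds P"
  shows "\<exists>t a. t \<preceq> p \<and> a \<in> elts W \<and> t \<tturnstile> app_fm f (chk x) (chk a) \<and> t \<tturnstile> (chk a \<^bold>\<in> A)"
proof -
  have "p \<tturnstile> (\<^bold>\<exists>y. app_fm f (chk x) y)"
    by (rule forces_fun_app_ex[OF f forces_mem_checkI[OF x] p is_name_check])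
  then obtain q u where q: "q \<preceq> p" "is_name P u" "q \<tturnstile> app_fm f (chk x) u"
    using stronger_refl[OF p] unfolding forces_Exists by blast
  have u: "q \<tturnstile> (u \<^bold>\<in> A)"
    using forces_fun_app_mem[OF forces_mono[OF f q(1)] q(3) is_name_check q(2)] by simp
  then have "q \<tturnstile> (u \<^bold>\<in> chk W)" using A q(1,2) unfolding forces_subset_iff by blast
  then obtain t a where t: "t \<preceq> q" "a \<in> elts W" "t \<tturnstile> (u \<^bold>= chk a)"
    using stronger_self[OF q(1)] unfolding forces_mem_check_iff by blast
  have "t \<tturnstile> app_fm f (chk x) (chk a)"
    using forces_subst[OF fcong_app[OF forces_refl t(3)] forces_mono[OF q(3) t(1)] stronger_cond[OF t(1)]] .
  moreover have "t \<tturnstile> (chk a \<^bold>\<in> A)"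
    using forces_Mem_subst[OF forces_mono[OF u t(1)] t(3) forces_refl] .
  ultimately show ?thesis using t(2) stronger_trans[OF t(1) q(1)] by blast
qed

end

text \<open>
  A strengthening of the countable chain condition: it also yields a single condition \<open>r\<close> below
  which the uncountable subfamily is, up to countably many exceptions, compatible with everything.
\<close>

locale strong_ccc_poset = forcing_poset P for P :: "'v::zfc forcing_notion" +
  assumes uncountable_family:
    "\<And>(S :: 'v set) f q. uncountable S \<Longrightarrow> \<forall>x\<in>S. f x \<preceq> q \<Longrightarrow>
      \<exists>r S'. S' \<subseteq> S \<and> uncountable S' \<and> r \<preceq> q \<and> (\<forall>x\<in>S'. f x \<preceq> r) \<and>
        (\<forall>s. s \<preceq> r \<longrightarrow> countable {x \<in> S'. \<not> (\<exists>t. t \<preceq> s \<and> t \<preceq> f x)})"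
begin

text \<open>Apply the chain condition to one member \<open>f x\<close> of the family itself: it lies
  below \<open>r\<close>, so it is compatible with all but countably many others, while
  incompatibility leaves only \<open>x\<close>.\<close>

lemma countable_antichain:
  fixes S :: "'v set"
  assumes f: "\<And>x. x \<in> S \<Longrightarrow> f x \<in> conds P"
    and anti: "\<And>x y t. x \<in> S \<Longrightarrow> y \<in> S \<Longrightarrow> t \<preceq> f x \<Longrightarrow> t \<preceq> f y \<Longrightarrow> x = y"
  shows "countable S"
proof (rule ccontr)
  assume S: "uncountable S"
  have "\<forall>x\<in>S. f x \<preceq> weakest P" using f stronger_weakest by blast
  from uncountable_family[OF S this] obtain r S' where "S' \<subseteq> S" "uncountable S'" "\<forall>x\<in>S'. f x \<preceq> r"
    and compat: "\<forall>s. s \<preceq> r \<longrightarrow> countable {x \<in> S'. \<not> (\<exists>t. t \<preceq> s \<and> t \<preceq> f x)}"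
    by (elim exE conjE) (rule that)
  note S' = this(1-3)
  obtain x where x: "x \<in> S'" using S'(2) by fastforce
  have "S' \<subseteq> insert x {y \<in> S'. \<not> (\<exists>t. t \<preceq> f x \<and> t \<preceq> f y)}"
    using anti S'(1) x by blast
  moreover have "countable (insert x {y \<in> S'. \<not> (\<exists>t. t \<preceq> f x \<and> t \<preceq> f y)})"
    using compat S'(3) x by (intro countable_insert) blast
  ultimately have "countable S'" by (rule countable_subset)
  then show False using S'(2) by contradiction
qed

text \<open>Given a name \<open>f\<close> of a bijection from \<open>x\<close> onto
  \<open>k\<close>, let \<open>T z\<close> decide the preimage of \<open>z\<close> to be
  \<open>F z\<close>. Conditions for different \<open>z\<close> with the same preimage are
  incompatible because \<open>f\<close> is forced to be a function, so \<open>F\<close> is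
  countable-to-one.\<close>

lemma forces_Card_check:
  assumes k: "V_models (Card_fm k)" "uncountable (elts k)"
  shows "p \<tturnstile> Card_fm (chk k)"
  unfolding Card_fm_def forces_Conj
proof
  show "p \<tturnstile> Ord_fm (chk k)" using k(1) by (intro forces_Ord_check) simp
  show "p \<tturnstile> (\<^bold>\<forall>x. x \<^bold>\<in> chk k \<^bold>\<longrightarrow> \<^bold>\<not> (\<^bold>\<exists>f. bij_fm f x (chk k)))"
  proof (rule forces_Forall_check)
    fix x q assume x: "x \<in> elts k"
    show "q \<tturnstile> (\<^bold>\<not> (\<^bold>\<exists>f. bij_fm f (chk x) (chk k)))"
      unfolding forces_Neg
    proof (intro allI impI notI)
      fix r assume r: "r \<preceq> q" "r \<tturnstile> (\<^bold>\<exists>f. bij_fm f (chk x) (chk k))"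
      then obtain s f where s: "s \<preceq> r" "s \<tturnstile> bij_fm f (chk x) (chk k)"
        using stronger_self[OF r(1)] unfolding forces_Exists by blast
      have "\<exists>t y. t \<preceq> s \<and> y \<in> elts x \<and> t \<tturnstile> app_fm f (chk y) (chk z)" if "z \<in> elts k" for z
        using forces_bij_app_check[OF s(2) forces_mem_checkI[OF that] is_name_check stronger_cond[OF s(1)]] .
      then obtain T F where TF: "\<And>z. z \<in> elts k \<Longrightarrow> T z \<preceq> s \<and> F z \<in> elts x \<and> T z \<tturnstile> app_fm f (chk (F z)) (chk z)"
        by metis
      have fn: "s \<tturnstile> fun_fm f (chk x) (chk k)" using s(2) unfolding bij_fm_def forces_Conj by blast
      show False
      proof (rule Card_no_countable_to_one[OF k x])
        show "F ` elts k \<subseteq> elts x" using TF by blast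
        fix y assume "y \<in> elts x"
        show "countable {z \<in> elts k. F z = y}"
        proof (rule countable_antichain[where f = T])
          fix z assume "z \<in> {z \<in> elts k. F z = y}"
          then show "T z \<in> conds P" using TF stronger_cond by blast
        next
          fix z z' t assume z: "z \<in> {z \<in> elts k. F z = y}" "z' \<in> {z \<in> elts k. F z = y}" "t \<preceq> T z" "t \<preceq> T z'"
          have app: "T u \<tturnstile> app_fm f (chk y) (chk u)" if "u \<in> {z \<in> elts k. F z = y}" for u
            using TF[of u] that by simp
          have "t \<preceq> s" using z(1) TF[of z] stronger_trans[OF z(3)] by simp
          have "t \<tturnstile> (chk z \<^bold>= chk z')"
            by (rule forces_fun_app_unique[OF forces_mono[OF fn \<open>t \<preceq> s\<close>] forces_mono[OF app[OF z(1)] z(3)]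
                forces_mono[OF app[OF z(2)] z(4)] stronger_cond[OF z(3)] is_name_check is_name_check is_name_check])
          then show "z = z'" using forces_check_eqD stronger_cond[OF z(3)] by blast
        qed
      qed
    qed
  qed (unfold fm_defs, (intro fcong_rules; (assumption | rule forces_refl)))
qed

text \<open>\<open>l\<close> remains a cardinal by the chain condition. A cardinal of the extension
  between \<open>k\<close> and \<open>l\<close> would be decided to be an old ordinal, which is not
  a cardinal of the ground model, and the bijection showing this persists.\<close>

lemma forces_csucc_check:
  assumes l: "V_models (csucc_fm k l)" "uncountable (elts l)"
  shows "p \<tturnstile> csucc_fm (chk k) (chk l)"
  unfolding csucc_fm_def forces_Conj
proof (intro conjI)
  have Card: "V_models (Card_fm l)" and kl: "k \<in> elts l"
    and least: "\<forall>m\<in>elts l. V_models (Card_fm m) \<longrightarrow> k \<notin> elts m"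
    using l(1) unfolding V_models_csucc by blast+
  show "p \<tturnstile> Card_fm (chk l)" using Card l(2) by (rule forces_Card_check)
  show "p \<tturnstile> (chk k \<^bold>\<in> chk l)" using kl by (rule forces_mem_checkI)
  show "p \<tturnstile> (\<^bold>\<forall>m. m \<^bold>\<in> chk l \<^bold>\<and> Card_fm m \<^bold>\<longrightarrow> \<^bold>\<not> chk k \<^bold>\<in> m)"
    unfolding forces_Forall forces_Imp
  proof (intro allI impI)
    fix m q assume m: "q \<tturnstile> (m \<^bold>\<in> chk l \<^bold>\<and> Card_fm m)"
    show "q \<tturnstile> (\<^bold>\<not> chk k \<^bold>\<in> m)"
      unfolding forces_Neg
    proof (intro allI impI notI)
      fix r assume r: "r \<preceq> q" "r \<tturnstile> (chk k \<^bold>\<in> m)"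
      obtain s m0 where s: "s \<preceq> r" "m0 \<in> elts l" "s \<tturnstile> (m \<^bold>= chk m0)"
        using m r(1) unfolding forces_Conj forces_mem_check_iff by blast
      note sc = stronger_cond[OF s(1)]
      have sq: "s \<preceq> q" using stronger_trans[OF s(1) r(1)] .
      have "s \<tturnstile> (chk k \<^bold>\<in> chk m0)" using forces_mem_eq[OF forces_mono[OF r(2) s(1)] s(3)] .
      then have "k \<in> elts m0" using forces_check_memD sc by blast
      then have "\<not> V_models (Card_fm m0)" using least s(2) by blast
      moreover have "Ord m0" using Card s(2) Ord_member[of l m0] by simp
      ultimately obtain x F where x: "x \<in> elts m0" "bij_betw F (elts x) (elts m0)" by auto
      have "s \<tturnstile> Card_fm (chk m0)"
        using forces_subst[OF fcong_Card[OF s(3)] _ sc] forces_mono[OF m sq] by simp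
      then have "s \<tturnstile> (\<^bold>\<forall>x. x \<^bold>\<in> chk m0 \<^bold>\<longrightarrow> \<^bold>\<not> (\<^bold>\<exists>f. bij_fm f x (chk m0)))"
        unfolding Card_fm_def forces_Conj by blast
      from forces_ImpD[OF forces_ForallD[OF this is_name_check] sc forces_mem_checkI[OF x(1)]]
      have "\<not> s \<tturnstile> (\<^bold>\<exists>f. bij_fm f (chk x) (chk m0))"
        using stronger_refl[OF sc] unfolding forces_Neg by blast
      moreover have "s \<tturnstile> (\<^bold>\<exists>f. bij_fm f (chk x) (chk m0))"
        by (rule forces_ExistsI[OF is_name_check[of "vgraph F x"]], rule forces_bij_check[OF V_models_bij_vgraph[OF x(2)]])
      ultimately show False by blast
    qed
  qed
qed

end


section \<open>The negative relation in the extension\<close>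

lemma small_UN:
  fixes F :: "'v::zfc \<Rightarrow> 'v set"
  assumes "\<And>x. x \<in> elts a \<Longrightarrow> \<exists>y. elts y = F x"
  shows "\<exists>z. elts z = (\<Union>x\<in>elts a. F x)"
proof -
  obtain G where G: "\<forall>x\<in>elts a. elts (G x) = F x" using assms by metis
  obtain b where b: "elts b = G ` elts a" using replacement by blast
  obtain z where "elts z = (\<Union>y\<in>elts b. elts y)" using union by blast
  then have "elts z = (\<Union>x\<in>elts a. F x)" using b G by simp
  then show ?thesis by blast
qed

lemma V_models_rect:
  "V_models (rect_fm D A B) \<longleftrightarrow>
     (\<forall>s. s \<in> elts D \<longleftrightarrow> (\<exists>x y. x \<in> elts A \<and> y \<in> elts B \<and> x \<noteq> y \<and> elts s = {x, y}))"
  by (simp add: rect_fm_def)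

lemma V_models_image:
  "V_models (image_fm c D m) \<longleftrightarrow> (\<forall>y. y \<in> elts m \<longleftrightarrow> (\<exists>s. s \<in> elts D \<and> vpair s y \<in> elts c))"
  by (simp add: image_fm_def)

lemma omega1_unique:
  assumes "V_models (omega1_fm w1)" "V_models (omega1_fm w1')"
  shows "w1 = w1'"
proof -
  have "elts w1 = {x. Ord x \<and> countable (elts x)}" if w1: "V_models (omega1_fm w1)" for w1 :: 'a
  proof -
    obtain w where w: "V_models (omega_fm w)" "V_models (csucc_fm w w1)"
      using w1 unfolding omega1_fm_def V_models_connectives V_models.simps by blast
    show ?thesis using omega1_members[OF w] by blast
  qed
  then show ?thesis using assms extensionality by metis
qed

context forcing_poset
begin

section \<open>Forced order types and a name for the set of pairs\<close>

lemma forces_otpE: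
  assumes "p \<tturnstile> otp_fm A a" "p \<in> conds P"
  obtains q f where "q \<preceq> p" "is_name P f" "q \<tturnstile> bij_fm f a A"
    "\<And>r x y u v. r \<preceq> q \<Longrightarrow> is_name P x \<Longrightarrow> is_name P y \<Longrightarrow> is_name P u \<Longrightarrow> is_name P v \<Longrightarrow>
       r \<tturnstile> app_fm f x u \<Longrightarrow> r \<tturnstile> app_fm f y v \<Longrightarrow> r \<tturnstile> (x \<^bold>\<in> y) \<Longrightarrow> r \<tturnstile> (u \<^bold>\<in> v)"
proof -
  have "p \<tturnstile> (\<^bold>\<exists>f. bij_fm f a A \<^bold>\<and>
         (\<^bold>\<forall>x. \<^bold>\<forall>y. \<^bold>\<forall>u. \<^bold>\<forall>v. app_fm f x u \<^bold>\<and> app_fm f y v \<^bold>\<longrightarrow> (x \<^bold>\<in> y \<^bold>\<longleftrightarrow> u \<^bold>\<in> v)))"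
    using assms(1) unfolding otp_fm_def forces_Conj by blast
  then obtain q f where q: "q \<preceq> p" "is_name P f" and bij: "q \<tturnstile> bij_fm f a A"
    and ord: "q \<tturnstile> (\<^bold>\<forall>x. \<^bold>\<forall>y. \<^bold>\<forall>u. \<^bold>\<forall>v. app_fm f x u \<^bold>\<and> app_fm f y v \<^bold>\<longrightarrow> (x \<^bold>\<in> y \<^bold>\<longleftrightarrow> u \<^bold>\<in> v))"
    using stronger_refl[OF assms(2)] unfolding forces_Exists forces_Conj by blast
  from q bij show thesis
  proof (rule that)
    fix r x y u v
    assume r: "r \<preceq> q" "is_name P x" "is_name P y" "is_name P u" "is_name P v"
      "r \<tturnstile> app_fm f x u" "r \<tturnstile> app_fm f y v" "r \<tturnstile> (x \<^bold>\<in> y)"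
    have "q \<tturnstile> (app_fm f x u \<^bold>\<and> app_fm f y v \<^bold>\<longrightarrow> (x \<^bold>\<in> y \<^bold>\<longleftrightarrow> u \<^bold>\<in> v))"
      using ord r(2-5) unfolding forces_Forall by blast
    then have "r \<tturnstile> (x \<^bold>\<in> y \<^bold>\<longleftrightarrow> u \<^bold>\<in> v)"
      using r(1,6,7) unfolding forces_Imp forces_Conj by blast
    then show "r \<tturnstile> (u \<^bold>\<in> v)"
      using r(8) stronger_self[OF r(1)] unfolding forces_Iff by blast
  qed
qed

lemma forces_bij_inj:
  assumes "p \<tturnstile> bij_fm f X Y" "p \<tturnstile> app_fm f x y" "p \<tturnstile> app_fm f x' y" "p \<in> conds P"
    and "is_name P x" "is_name P x'" "is_name P y"
  shows "p \<tturnstile> (x \<^bold>= x')"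
proof -
  have "p \<tturnstile> (\<^bold>\<forall>x. \<^bold>\<forall>x'. \<^bold>\<forall>y. app_fm f x y \<^bold>\<and> app_fm f x' y \<^bold>\<longrightarrow> x \<^bold>= x')"
    using assms(1) unfolding bij_fm_def forces_Conj by blast
  then have "p \<tturnstile> (app_fm f x y \<^bold>\<and> app_fm f x' y \<^bold>\<longrightarrow> x \<^bold>= x')"
    using assms(5-7) unfolding forces_Forall by blast
  then show ?thesis
    using assms(2,3) stronger_refl[OF assms(4)] unfolding forces_Imp forces_Conj by blast
qed

lemma fcong_upair: "p \<tturnstile> (s \<^bold>= s') \<Longrightarrow> p \<tturnstile> (x \<^bold>= x') \<Longrightarrow> p \<tturnstile> (y \<^bold>= y') \<Longrightarrow>
    fcong p (upair_fm s x y) (upair_fm s' x' y')"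
  unfolding fm_defs by (intro fcong_rules; (assumption | rule forces_refl))

abbreviation chk_pair :: "'v \<Rightarrow> 'v \<Rightarrow> 'v" where
  "chk_pair x y \<equiv> chk (vset {x, y})"

text \<open>Both factors are forced into \<open>chk W\<close>, so their elements can be decided. It
  suffices to know which check names of pairs enter \<open>D\<close>, and that every forced member
  of \<open>D\<close> is densely such a pair.\<close>

lemma forces_rectI:
  assumes A: "p \<tturnstile> subset_fm A (chk W)" and B: "p \<tturnstile> subset_fm B (chk W)"
    and into: "\<And>q x y. q \<preceq> p \<Longrightarrow> x \<in> elts W \<Longrightarrow> y \<in> elts W \<Longrightarrow> x \<noteq> y \<Longrightarrow>
      q \<tturnstile> (chk x \<^bold>\<in> A) \<Longrightarrow> q \<tturnstile> (chk y \<^bold>\<in> B) \<Longrightarrow> q \<tturnstile> (chk_pair x y \<^bold>\<in> D)"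
    and out: "\<And>q s. q \<preceq> p \<Longrightarrow> q \<tturnstile> (s \<^bold>\<in> D) \<Longrightarrow>
      \<exists>r x y. r \<preceq> q \<and> x \<noteq> y \<and> r \<tturnstile> (chk x \<^bold>\<in> A) \<and> r \<tturnstile> (chk y \<^bold>\<in> B) \<and> r \<tturnstile> (s \<^bold>= chk_pair x y)"
  shows "p \<tturnstile> rect_fm D A B"
  unfolding rect_fm_def forces_Forall forces_Iff
proof (intro allI impI iffI)
  fix s q assume s: "q \<preceq> p" "q \<tturnstile> (s \<^bold>\<in> D)"
  show "q \<tturnstile> (\<^bold>\<exists>x. \<^bold>\<exists>y. x \<^bold>\<in> A \<^bold>\<and> y \<^bold>\<in> B \<^bold>\<and> \<^bold>\<not> x \<^bold>= y \<^bold>\<and> upair_fm s x y)" (is "q \<tturnstile> ?ex")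
  proof (rule forces_dense)
    fix q' assume q': "q' \<preceq> q"
    obtain r x y where r: "r \<preceq> q'" "x \<noteq> y" "r \<tturnstile> (chk x \<^bold>\<in> A)" "r \<tturnstile> (chk y \<^bold>\<in> B)" "r \<tturnstile> (s \<^bold>= chk_pair x y)"
      using out[OF stronger_trans[OF q' s(1)] forces_mono[OF s(2) q']] by blast
    have "r \<tturnstile> upair_fm s (chk x) (chk y)"
      by (rule forces_subst[OF fcong_upair[OF forces_sym[OF r(5)] forces_refl forces_refl] _ stronger_cond[OF r(1)]])
        (rule forces_check_upair[OF elts_vset_pair])
    then have "r \<tturnstile> ?ex"
      by - (rule forces_ExistsI[OF is_name_check[of x]], rule forces_ExistsI[OF is_name_check[of y]],
          simp only: forces_Conj r forces_check_Neg_eq[OF r(2)])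
    then show "\<exists>r. r \<preceq> q' \<and> r \<tturnstile> ?ex" using r(1) by blast
  qed
next
  fix s q assume n: "is_name P s" and q: "q \<preceq> p"
    and ex: "q \<tturnstile> (\<^bold>\<exists>x. \<^bold>\<exists>y. x \<^bold>\<in> A \<^bold>\<and> y \<^bold>\<in> B \<^bold>\<and> \<^bold>\<not> x \<^bold>= y \<^bold>\<and> upair_fm s x y)"
  show "q \<tturnstile> (s \<^bold>\<in> D)"
  proof (rule forces_dense)
    fix q' assume q': "q' \<preceq> q"
    obtain r x where r: "r \<preceq> q'" "is_name P x" "r \<tturnstile> (\<^bold>\<exists>y. x \<^bold>\<in> A \<^bold>\<and> y \<^bold>\<in> B \<^bold>\<and> \<^bold>\<not> x \<^bold>= y \<^bold>\<and> upair_fm s x y)"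
      using ex q' unfolding forces_Exists[of q] by blast
    obtain t y where t: "t \<preceq> r" "is_name P y" "t \<tturnstile> (x \<^bold>\<in> A)" "t \<tturnstile> (y \<^bold>\<in> B)" "t \<tturnstile> (\<^bold>\<not> x \<^bold>= y)" "t \<tturnstile> upair_fm s x y"
      using r(3) stronger_self[OF r(1)] unfolding forces_Exists[of r] forces_Conj by blast
    have tp: "t \<preceq> p" using t(1) r(1) q' q stronger_trans by blast
    have "t \<tturnstile> (x \<^bold>\<in> chk W)" using A r(2) tp t(3) unfolding forces_subset_iff by blast
    then obtain t1 x0 where t1: "t1 \<preceq> t" "x0 \<in> elts W" "t1 \<tturnstile> (x \<^bold>= chk x0)"
      using stronger_self[OF tp] unfolding forces_mem_check_iff by blast
    have "t1 \<tturnstile> (y \<^bold>\<in> chk W)" using B t(2) tp forces_mono[OF t(4)] t1(1) stronger_trans[OF t1(1) tp]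
      unfolding forces_subset_iff by blast
    then obtain t2 y0 where t2: "t2 \<preceq> t1" "y0 \<in> elts W" "t2 \<tturnstile> (y \<^bold>= chk y0)"
      using stronger_self[OF t1(1)] unfolding forces_mem_check_iff by blast
    note t2t = stronger_trans[OF t2(1) t1(1)] and c = stronger_cond[OF t2(1)]
    have x: "t2 \<tturnstile> (x \<^bold>= chk x0)" using forces_mono[OF t1(3) t2(1)] .
    have "x0 \<noteq> y0"
    proof
      assume "x0 = y0"
      then have "t2 \<tturnstile> (x \<^bold>= y)" using forces_trans[OF x] forces_sym[OF t2(3)] by simp
      then show False using t(5) t2t unfolding forces_Neg by blast
    qed
    moreover have "t2 \<tturnstile> (chk x0 \<^bold>\<in> A)" "t2 \<tturnstile> (chk y0 \<^bold>\<in> B)"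
      using forces_Mem_subst[OF forces_mono[OF t(3) t2t] x forces_refl]
        forces_Mem_subst[OF forces_mono[OF t(4) t2t] t2(3) forces_refl] .
    ultimately have "t2 \<tturnstile> (chk_pair x0 y0 \<^bold>\<in> D)"
      using into stronger_trans[OF t2t tp] t1(2) t2(2) by blast
    moreover have "t2 \<tturnstile> upair_fm s (chk x0) (chk y0)"
      using forces_subst[OF fcong_upair[OF forces_refl x t2(3)] forces_mono[OF t(6) t2t] c] .
    then have "t2 \<tturnstile> (chk_pair x0 y0 \<^bold>= s)"
      by (intro forces_upair_eq[OF c is_name_check n forces_check_upair[OF elts_vset_pair]])
    ultimately have "t2 \<tturnstile> (s \<^bold>\<in> D)" using forces_Mem_subst forces_refl by blast
    moreover have "t2 \<preceq> q'" using t2t t(1) r(1) stronger_trans by blast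
    ultimately show "\<exists>t. t \<preceq> q' \<and> t \<tturnstile> (s \<^bold>\<in> D)" by blast
  qed
qed

text \<open>A pair is entered under every condition that forces its components into \<open>A\<close>
  and \<open>B\<close>. The bound \<open>W\<close> and the smallness of \<open>conds P\<close> make
  this collection a set.\<close>

definition rect_name :: "'v \<Rightarrow> 'v \<Rightarrow> 'v \<Rightarrow> 'v" where
  "rect_name W A B = vset {z. \<exists>x y q. z = vpair (chk_pair x y) q \<and> x \<in> elts W \<and> y \<in> elts W \<and> x \<noteq> y \<and>
     q \<in> conds P \<and> q \<tturnstile> (chk x \<^bold>\<in> A) \<and> q \<tturnstile> (chk y \<^bold>\<in> B)}"

lemma vpair_in_rect_name:
  "z \<in> elts (rect_name W A B) \<longleftrightarrow>
     (\<exists>x y q. z = vpair (chk_pair x y) q \<and> x \<in> elts W \<and> y \<in> elts W \<and> x \<noteq> y \<and>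
        q \<in> conds P \<and> q \<tturnstile> (chk x \<^bold>\<in> A) \<and> q \<tturnstile> (chk y \<^bold>\<in> B))"
proof -
  obtain C where C: "elts C = conds P" using small_conds by blast
  have "\<exists>u. elts u = (\<Union>x\<in>elts W. \<Union>y\<in>elts W. vpair (chk_pair x y) ` elts C)"
    by (intro small_UN replacement)
  then obtain u where u: "elts u = (\<Union>x\<in>elts W. \<Union>y\<in>elts W. vpair (chk_pair x y) ` elts C)" ..
  have "elts (rect_name W A B) = {z. \<exists>x y q. z = vpair (chk_pair x y) q \<and> x \<in> elts W \<and> y \<in> elts W \<and> x \<noteq> y \<and>
     q \<in> conds P \<and> q \<tturnstile> (chk x \<^bold>\<in> A) \<and> q \<tturnstile> (chk y \<^bold>\<in> B)}"
    unfolding rect_name_def by (rule small_subset[of _ u]) (auto simp only: u C)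
  then show ?thesis by simp
qed

lemma is_name_rect_name: "is_name P (rect_name W A B)"
proof (rule is_name.intros, rule ballI)
  fix z assume "z \<in> elts (rect_name W A B)"
  then show "\<exists>\<sigma> p. z = vpair \<sigma> p \<and> p \<in> conds P \<and> is_name P \<sigma>"
    unfolding vpair_in_rect_name using is_name_check by blast
qed

lemma forces_in_rect_nameI:
  assumes "x \<in> elts W" "y \<in> elts W" "x \<noteq> y" "q \<tturnstile> (chk x \<^bold>\<in> A)" "q \<tturnstile> (chk y \<^bold>\<in> B)"
  shows "q \<tturnstile> (chk_pair x y \<^bold>\<in> rect_name W A B)"
  unfolding forces.simps forces_mem_iff
proof (intro allI impI)
  fix r assume r: "r \<preceq> q"
  have "vpair (chk_pair x y) r \<in> elts (rect_name W A B)"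
    unfolding vpair_in_rect_name
    using assms(1-3) stronger_cond[OF r] forces_mono[OF assms(4) r] forces_mono[OF assms(5) r] by blast
  then show "\<exists>s \<pi> t. s \<preceq> r \<and> vpair \<pi> t \<in> elts (rect_name W A B) \<and> s \<preceq> t \<and> forces_eq P s (chk_pair x y) \<pi>"
    using stronger_self[OF r] forces_eq_refl by blast
qed

lemma forces_in_rect_nameD:
  assumes "q \<in> conds P" "q \<tturnstile> (s \<^bold>\<in> rect_name W A B)"
  shows "\<exists>r x y. r \<preceq> q \<and> x \<noteq> y \<and> r \<tturnstile> (chk x \<^bold>\<in> A) \<and> r \<tturnstile> (chk y \<^bold>\<in> B) \<and> r \<tturnstile> (s \<^bold>= chk_pair x y)"
proof -
  obtain r \<pi> t where r: "r \<preceq> q" "vpair \<pi> t \<in> elts (rect_name W A B)" "r \<preceq> t" "r \<tturnstile> (s \<^bold>= \<pi>)"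
    using assms(2) stronger_refl[OF assms(1)] unfolding forces.simps forces_mem_iff by blast
  from r(2) obtain x y where xy: "\<pi> = chk_pair x y" "x \<noteq> y" "t \<tturnstile> (chk x \<^bold>\<in> A)" "t \<tturnstile> (chk y \<^bold>\<in> B)"
    unfolding vpair_in_rect_name vpair_eq_iff by blast
  show ?thesis
    using r(1,4) xy(1,2) forces_mono[OF xy(3) r(3)] forces_mono[OF xy(4) r(3)] by blast
qed

lemma forces_rect_name:
  assumes "p \<tturnstile> subset_fm A (chk W)" "p \<tturnstile> subset_fm B (chk W)"
  shows "p \<tturnstile> rect_fm (rect_name W A B) A B"
  using assms by (rule forces_rectI) (blast intro: forces_in_rect_nameI forces_in_rect_nameD stronger_cond)+

lemma forces_rect_check:
  assumes "V_models (rect_fm D W W)"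
  shows "p \<tturnstile> rect_fm (chk D) (chk W) (chk W)"
proof (rule forces_rectI)
  show "p \<tturnstile> subset_fm (chk W) (chk W)" "p \<tturnstile> subset_fm (chk W) (chk W)"
    by (simp_all only: forces_subset_check order_refl)
next
  fix q x y assume "x \<in> elts W" "y \<in> elts W" "x \<noteq> y"
  then have "vset {x, y} \<in> elts D"
    using assms elts_vset_pair unfolding V_models_rect by blast
  then show "q \<tturnstile> (chk_pair x y \<^bold>\<in> chk D)" by (rule forces_mem_checkI)
next
  fix q s assume "q \<preceq> p" "q \<tturnstile> (s \<^bold>\<in> chk D)"
  then obtain r s0 where r: "r \<preceq> q" "s0 \<in> elts D" "r \<tturnstile> (s \<^bold>= chk s0)"
    using stronger_self unfolding forces_mem_check_iff by blast
  then obtain x y where xy: "x \<in> elts W" "y \<in> elts W" "x \<noteq> y" "elts s0 = {x, y}"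
    using assms unfolding V_models_rect by blast
  have "s0 = vset {x, y}" using vset_eqI[OF xy(4)] by simp
  then show "\<exists>r x y. r \<preceq> q \<and> x \<noteq> y \<and> r \<tturnstile> (chk x \<^bold>\<in> chk W) \<and> r \<tturnstile> (chk y \<^bold>\<in> chk W) \<and> r \<tturnstile> (s \<^bold>= chk_pair x y)"
    using r xy forces_mem_checkI by blast
qed

end

context strong_ccc_poset
begin

text \<open>
  Below \<open>r\<close> the possible values of \<open>B\<close> form an infinite set in the ground model, although \<open>B\<close> itself
  need not contain an infinite set from the ground model.
\<close>

lemma infinite_possible_values:
  assumes w: "V_models (omega_fm w)" and W: "Ord W"
    and B: "r \<tturnstile> subset_fm B (chk W)" and bij: "r \<tturnstile> bij_fm g (chk w) B"
    and ord: "\<And>t x y u v. t \<preceq> r \<Longrightarrow> is_name P x \<Longrightarrow> is_name P y \<Longrightarrow> is_name P u \<Longrightarrow> is_name P v \<Longrightarrow>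
       t \<tturnstile> app_fm g x u \<Longrightarrow> t \<tturnstile> app_fm g y v \<Longrightarrow> t \<tturnstile> (x \<^bold>\<in> y) \<Longrightarrow> t \<tturnstile> (u \<^bold>\<in> v)"
    and r: "r \<in> conds P"
  shows "infinite {b \<in> elts W. \<exists>s. s \<preceq> r \<and> s \<tturnstile> (chk b \<^bold>\<in> B)}" (is "infinite ?X")
proof
  assume fin: "finite ?X"
  have fn: "r \<tturnstile> fun_fm g (chk w) B" using bij unfolding bij_fm_def forces_Conj by blast
  have val: "\<exists>t b. t \<preceq> s \<and> b \<in> elts W \<and> t \<tturnstile> app_fm g (chk n) (chk b) \<and> t \<tturnstile> (chk b \<^bold>\<in> B)"
    if "s \<preceq> r" "n \<in> elts w" for s n
    using forces_fun_value_check[OF forces_mono[OF fn that(1)]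
        forces_mono[OF B that(1)] that(2) stronger_cond[OF that(1)]] .
  have unb: "elts w \<noteq> {}" "\<And>n. n \<in> elts w \<Longrightarrow> \<exists>n'\<in>elts w. n \<in> elts n'"
    using w unfolding omega_fm_def by auto
  have Ord: "Ord b" if "b \<in> ?X" for b using that W Ord_member by blast
  have "?X \<noteq> {}"
  proof -
    obtain n where n: "n \<in> elts w" using unb(1) by blast
    obtain t b where "t \<preceq> r" "b \<in> elts W" "t \<tturnstile> (chk b \<^bold>\<in> B)"
      using val[OF stronger_refl[OF r] n] by blast
    then have "b \<in> ?X" by blast
    then show ?thesis by blast
  qed
  then obtain m where m: "m \<in> ?X" "\<forall>b\<in>?X. b = m \<or> b \<in> elts m"
    using finite_Ord_set_has_max[OF fin _ Ord] by blast
  then obtain s where s: "s \<preceq> r" "s \<tturnstile> (chk m \<^bold>\<in> B)" by blast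
  \<comment> \<open>Below \<open>s\<close> decide the index \<open>n\<close> of the largest possible
    value \<open>m\<close>. The value \<open>b\<close> at a later index \<open>n'\<close>, decided
    below that, is a larger possible value.\<close>
  obtain t n where t: "t \<preceq> s" "n \<in> elts w" "t \<tturnstile> app_fm g (chk n) (chk m)"
    using forces_bij_app_check[OF forces_mono[OF bij s(1)] s(2) is_name_check stronger_cond[OF s(1)]] by blast
  have tr: "t \<preceq> r" using stronger_trans[OF t(1) s(1)] .
  obtain n' where n': "n' \<in> elts w" "n \<in> elts n'" using unb(2)[OF t(2)] by blast
  obtain u b where u: "u \<preceq> t" "b \<in> elts W" "u \<tturnstile> app_fm g (chk n') (chk b)" "u \<tturnstile> (chk b \<^bold>\<in> B)"
    using val[OF tr n'(1)] by blast
  have ur: "u \<preceq> r" using stronger_trans[OF u(1) tr] .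
  have "u \<tturnstile> (chk m \<^bold>\<in> chk b)"
    using ord[OF ur is_name_check is_name_check is_name_check is_name_check
        forces_mono[OF t(3) u(1)] u(3) forces_mem_checkI[OF n'(2)]] .
  then have mb: "m \<in> elts b" using forces_check_memD stronger_cond[OF u(1)] by blast
  have "b \<in> ?X" using u(2,4) ur by blast
  with m(2) have "b = m \<or> b \<in> elts m" by (rule bspec)
  then show False using mb mem_asym[OF mb] by auto
qed

text \<open>One colour \<nu> is treated at a time. As \<open>p\<close> is an arbitrary condition
  forcing the hypotheses, which pass to stronger ones, the conclusion amounts to a density
  statement, as needed to realize \<nu> in the extension.\<close>

lemma forces_realized_colour:
  assumes w: "V_models (omega_fm w)" and w1: "V_models (csucc_fm w w1)" and W: "Ord W"
    and colouring: "\<And>A B. elts A \<subseteq> elts W \<Longrightarrow> V_models (otp_fm A w1) \<Longrightarrow> elts B \<subseteq> elts W \<Longrightarrow>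
      V_models (otp_fm B w) \<Longrightarrow> (\<forall>x\<in>elts A. \<forall>y\<in>elts B. x \<in> elts y) \<Longrightarrow>
      \<exists>x\<in>elts A. \<exists>y\<in>elts B. x \<noteq> y \<and> vpair (vset {x, y}) \<nu> \<in> elts c"
    and p: "p \<in> conds P"
    and A: "p \<tturnstile> subset_fm A (chk W)" "p \<tturnstile> otp_fm A (chk w1)"
    and B: "p \<tturnstile> subset_fm B (chk W)" "p \<tturnstile> otp_fm B (chk w)"
    and less: "p \<tturnstile> (\<^bold>\<forall>x. \<^bold>\<forall>y. x \<^bold>\<in> A \<^bold>\<and> y \<^bold>\<in> B \<^bold>\<longrightarrow> x \<^bold>\<in> y)"
  shows "\<exists>t x y. t \<preceq> p \<and> x \<in> elts W \<and> y \<in> elts W \<and> x \<noteq> y \<and>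
    t \<tturnstile> (chk x \<^bold>\<in> A) \<and> t \<tturnstile> (chk y \<^bold>\<in> B) \<and> vpair (vset {x, y}) \<nu> \<in> elts c"
proof -
  obtain q1 f where q1: "q1 \<preceq> p" "q1 \<tturnstile> bij_fm f (chk w1) A"
    using forces_otpE[OF A(2) p] by metis
  obtain q g where q: "q \<preceq> q1" and bijg: "q \<tturnstile> bij_fm g (chk w) B"
    and ord: "\<And>t x y u v. t \<preceq> q \<Longrightarrow> is_name P x \<Longrightarrow> is_name P y \<Longrightarrow> is_name P u \<Longrightarrow> is_name P v \<Longrightarrow>
       t \<tturnstile> app_fm g x u \<Longrightarrow> t \<tturnstile> app_fm g y v \<Longrightarrow> t \<tturnstile> (x \<^bold>\<in> y) \<Longrightarrow> t \<tturnstile> (u \<^bold>\<in> v)"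
    by (rule forces_otpE[OF forces_mono[OF B(2) q1(1)] stronger_cond[OF q1(1)]]) (rule that)
  have qp: "q \<preceq> p" using stronger_trans[OF q q1(1)] .
  have bijf: "q \<tturnstile> bij_fm f (chk w1) A" using forces_mono[OF q1(2) q] .
  then have fnf: "q \<tturnstile> fun_fm f (chk w1) A" unfolding bij_fm_def forces_Conj by blast
  have "\<exists>t a. t \<preceq> q \<and> a \<in> elts W \<and> t \<tturnstile> app_fm f (chk x) (chk a) \<and> t \<tturnstile> (chk a \<^bold>\<in> A)" if "x \<in> elts w1" for x
    using forces_fun_value_check[OF fnf forces_mono[OF A(1) qp] that stronger_cond[OF q]] .
  then obtain T a where Ta: "\<And>x. x \<in> elts w1 \<Longrightarrow>
      T x \<preceq> q \<and> a x \<in> elts W \<and> T x \<tturnstile> app_fm f (chk x) (chk (a x)) \<and> T x \<tturnstile> (chk (a x) \<^bold>\<in> A)"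
    by metis
  then have "\<forall>x\<in>elts w1. T x \<preceq> q" by blast
  from uncountable_family[OF omega1_uncountable[OF w w1] this]
  obtain r S where "S \<subseteq> elts w1" "uncountable S" "r \<preceq> q" "\<forall>x\<in>S. T x \<preceq> r"
    and compat: "\<forall>s. s \<preceq> r \<longrightarrow> countable {x \<in> S. \<not> (\<exists>t. t \<preceq> s \<and> t \<preceq> T x)}"
    by (elim exE conjE) (rule that)
  note S = this(1-4)
  let ?X = "{b \<in> elts W. \<exists>s. s \<preceq> r \<and> s \<tturnstile> (chk b \<^bold>\<in> B)}"
  have rp: "r \<preceq> p" using stronger_trans[OF S(3) qp] .
  note ord_r = ord[OF stronger_trans[OF _ S(3)]]
  have infX: "infinite ?X"
    by (rule infinite_possible_values[OF w W forces_mono[OF B(1) rp] forces_mono[OF bijg S(3)] ord_r stronger_cond[OF rp]])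
  obtain B0 where B0: "elts B0 \<subseteq> ?X" "V_models (otp_fm B0 w)"
  proof (rule subset_of_order_type[of w finite ?X W])
    show "Ord w" using w by (simp add: omega_fm_def)
    show "x \<in> elts w \<longleftrightarrow> Ord x \<and> finite (elts x)" for x by (rule omega_members[OF w])
    show "?X \<subseteq> elts W" by blast
  qed (use W infX in \<open>auto intro: finite_subset\<close>)
  have "countable (elts w)"
    using omega1_members[OF w w1] w1 unfolding V_models_csucc by blast
  moreover obtain h where "bij_betw h (elts w) (elts B0)"
    using B0(2) V_models_bij_ex[of w B0] unfolding otp_fm_def V_models_connectives V_models.simps by blast
  ultimately have cB0: "countable (elts B0)" using countable_image unfolding bij_betw_def by metis
  have "\<forall>b\<in>elts B0. \<exists>s. s \<preceq> r \<and> s \<tturnstile> (chk b \<^bold>\<in> B)" using B0(1) by blast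
  then obtain s where s: "\<forall>b\<in>elts B0. s b \<preceq> r \<and> s b \<tturnstile> (chk b \<^bold>\<in> B)" by metis
  \<comment> \<open>Each of the countably many \<open>s b\<close> has countably many exceptions; the
    remaining indices have conditions compatible with every \<open>s b\<close>.\<close>
  define S' where "S' = S - (\<Union>b\<in>elts B0. {x \<in> S. \<not> (\<exists>t. t \<preceq> s b \<and> t \<preceq> T x)})"
  have "countable (\<Union>b\<in>elts B0. {x \<in> S. \<not> (\<exists>t. t \<preceq> s b \<and> t \<preceq> T x)})"
    using compat s by (intro countable_UN cB0) blast
  with S(2) have S'u: "uncountable S'" unfolding S'_def by (rule uncountable_minus_countable)
  have S': "x \<in> elts w1" "\<forall>b\<in>elts B0. \<exists>t. t \<preceq> s b \<and> t \<preceq> T x" if "x \<in> S'" for x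
    using that S(1) unfolding S'_def by blast+
  have uaS: "uncountable (a ` S')"
  proof
    assume "countable (a ` S')"
    \<comment> \<open>The name \<open>f\<close> is forced to be injective, so conditions that assign
      the same value \<open>y\<close> to different indices are incompatible.\<close>
    moreover have "countable {x \<in> S'. a x = y}" for y
    proof (rule countable_antichain[where f = T])
      show "T x \<in> conds P" if "x \<in> {x \<in> S'. a x = y}" for x
        using Ta[of x] S'(1)[of x] that stronger_cond[of "T x" q] by simp
      fix x x' t assume x: "x \<in> {x \<in> S'. a x = y}" "x' \<in> {x \<in> S'. a x = y}" "t \<preceq> T x" "t \<preceq> T x'"
      have app: "T u \<tturnstile> app_fm f (chk u) (chk y) \<and> T u \<preceq> q" if "u \<in> {x \<in> S'. a x = y}" for u
        using Ta[of u] S'(1)[of u] that by auto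
      have "t \<preceq> q" using stronger_trans[OF x(3)] app[OF x(1)] by blast
      have "t \<tturnstile> (chk x \<^bold>= chk x')"
        by (rule forces_bij_inj[OF forces_mono[OF bijf \<open>t \<preceq> q\<close>] forces_mono[OF conjunct1[OF app[OF x(1)]] x(3)]
            forces_mono[OF conjunct1[OF app[OF x(2)]] x(4)] stronger_cond[OF x(3)] is_name_check is_name_check is_name_check])
      then show "x = x'" using forces_check_eqD stronger_cond[OF x(3)] by blast
    qed
    ultimately have "countable (\<Union>y\<in>a ` S'. {x \<in> S'. a x = y})" by (intro countable_UN)
    moreover have "S' = (\<Union>y\<in>a ` S'. {x \<in> S'. a x = y})" by blast
    ultimately show False using S'u by simp
  qed
  obtain A0 where A0: "elts A0 \<subseteq> a ` S'" "V_models (otp_fm A0 w1)"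
  proof (rule subset_of_order_type[of w1 countable "a ` S'" W])
    show "Ord w1" using w1 by (simp add: V_models_csucc)
    show "x \<in> elts w1 \<longleftrightarrow> Ord x \<and> countable (elts x)" for x by (rule omega1_members[OF w w1])
    show "a ` S' \<subseteq> elts W" using Ta S'(1) by blast
  qed (use W uaS in \<open>auto intro: countable_subset\<close>)
  have common: "\<exists>t. t \<preceq> p \<and> t \<tturnstile> (chk x \<^bold>\<in> A) \<and> t \<tturnstile> (chk y \<^bold>\<in> B)" if xy: "x \<in> elts A0" "y \<in> elts B0" for x y
  proof -
    obtain z where z: "z \<in> S'" "x = a z" using A0(1) xy(1) by blast
    obtain t where t: "t \<preceq> s y" "t \<preceq> T z" using S'(2)[OF z(1)] xy(2) by blast
    have Tz: "T z \<preceq> q" "T z \<tturnstile> (chk x \<^bold>\<in> A)" using Ta[OF S'(1)[OF z(1)]] z(2) by simp_all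
    have "t \<preceq> p" using stronger_trans[OF t(2) stronger_trans[OF Tz(1) qp]] .
    moreover have "t \<tturnstile> (chk y \<^bold>\<in> B)" using s xy(2) forces_mono[OF _ t(1)] by blast
    ultimately show ?thesis using forces_mono[OF Tz(2) t(2)] by blast
  qed
  have AW: "elts A0 \<subseteq> elts W" and BW: "elts B0 \<subseteq> elts W"
    using A0(1) B0(1) Ta S'(1) by blast+
  \<comment> \<open>A single \<open>t\<close> below \<open>p\<close> puts both elements into
    \<open>A\<close> and \<open>B\<close>, so it forces the inequality, and membership between check
    names reflects to the ground model.\<close>
  have "\<forall>x\<in>elts A0. \<forall>y\<in>elts B0. x \<in> elts y"
  proof (intro ballI)
    fix x y assume "x \<in> elts A0" "y \<in> elts B0"
    then obtain t where t: "t \<preceq> p" "t \<tturnstile> (chk x \<^bold>\<in> A)" "t \<tturnstile> (chk y \<^bold>\<in> B)" using common by blast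
    have "p \<tturnstile> (chk x \<^bold>\<in> A \<^bold>\<and> chk y \<^bold>\<in> B \<^bold>\<longrightarrow> chk x \<^bold>\<in> chk y)"
      using less is_name_check unfolding forces_Forall by blast
    then have "t \<tturnstile> (chk x \<^bold>\<in> chk y)" using t unfolding forces_Imp forces_Conj by blast
    then show "x \<in> elts y" using forces_check_memD stronger_cond[OF t(1)] by blast
  qed
  from colouring[OF AW A0(2) BW B0(2) this]
  obtain x y where xy: "x \<in> elts A0" "y \<in> elts B0" "x \<noteq> y" "vpair (vset {x, y}) \<nu> \<in> elts c" by blast
  then show ?thesis using common[OF xy(1,2)] AW BW by blast
qed

text \<open>The ground model cardinals and the domain of \<open>c\<close> are witnesses under their
  check names. In the image clause, one inclusion holds since \<open>c\<close> has values in \<mu>,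
  the other by density, one colour at a time.\<close>

theorem forces_establishes_check:
  assumes est: "V_models (establishes_fm c \<mu>)" and p: "p \<in> conds P"
  shows "p \<tturnstile> establishes_fm (chk c) (chk \<mu>)"
proof -
  obtain w w1 w2 D where w: "V_models (omega_fm w)" and om1: "V_models (omega1_fm w1)" and om2: "V_models (omega2_fm w2)"
    and D: "V_models (rect_fm D w2 w2)" "V_models (fun_fm c D \<mu>)"
    and neg: "\<forall>A B. elts A \<subseteq> elts w2 \<and> V_models (otp_fm A w1) \<and> elts B \<subseteq> elts w2 \<and> V_models (otp_fm B w) \<and>
        (\<forall>x y. x \<in> elts A \<and> y \<in> elts B \<longrightarrow> x \<in> elts y) \<longrightarrow>
        (\<exists>D. V_models (rect_fm D A B) \<and> V_models (image_fm c D \<mu>))"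
    using est
    unfolding establishes_fm_def V_models_connectives V_models.simps V_models_subset
    by (elim exE conjE) (rule that)
  \<comment> \<open>\<open>omega1_fm\<close> and \<open>omega2_fm\<close> hide their own smaller
    cardinals; uniqueness identifies these with \<open>w\<close> and \<open>w1\<close>.\<close>
  have w1: "V_models (csucc_fm w w1)"
    using om1 omega_unique[OF w] unfolding omega1_fm_def V_models_connectives V_models.simps by blast
  have w2: "V_models (csucc_fm w1 w2)"
    using om2 omega1_unique[OF om1] unfolding omega2_fm_def V_models_connectives V_models.simps by blast
  have u1: "uncountable (elts w1)" using omega1_uncountable[OF w w1] .
  have Ord2: "Ord w2" using w2 by (simp add: V_models_csucc)
  have "elts w1 \<subseteq> elts w2" using w2 Ord2 unfolding V_models_csucc Ord_def by blast
  then have u2: "uncountable (elts w2)" using u1 countable_subset by blast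
  have fw1: "q \<tturnstile> omega1_fm (chk w1)" for q
    unfolding omega1_fm_def
    by (rule forces_ExistsI[OF is_name_check[of w]])
      (simp only: forces_Conj forces_omega_check[OF w] forces_csucc_check[OF w1 u1])
  have fw2: "q \<tturnstile> omega2_fm (chk w2)" for q
    unfolding omega2_fm_def
    by (rule forces_ExistsI[OF is_name_check[of w1]]) (simp only: forces_Conj fw1 forces_csucc_check[OF w2 u2])
  have c: "q \<tturnstile> fun_fm (chk c) (chk D) (chk \<mu>)" for q using D(2) by (rule forces_fun_check)
  have fD: "p \<tturnstile> (\<^bold>\<exists>D. rect_fm D (chk w2) (chk w2) \<^bold>\<and> fun_fm (chk c) D (chk \<mu>))"
    by (rule forces_ExistsI[OF is_name_check[of D]]) (simp only: forces_Conj c forces_rect_check[OF D(1)])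
  have "p \<tturnstile> (\<^bold>\<forall>A. \<^bold>\<forall>B. subset_fm A (chk w2) \<^bold>\<and> otp_fm A (chk w1) \<^bold>\<and>
                subset_fm B (chk w2) \<^bold>\<and> otp_fm B (chk w) \<^bold>\<and>
                (\<^bold>\<forall>x. \<^bold>\<forall>y. x \<^bold>\<in> A \<^bold>\<and> y \<^bold>\<in> B \<^bold>\<longrightarrow> x \<^bold>\<in> y) \<^bold>\<longrightarrow>
                (\<^bold>\<exists>D. rect_fm D A B \<^bold>\<and> image_fm (chk c) D (chk \<mu>)))"
    unfolding forces_Forall forces_Imp[of p] forces_Conj
  proof (intro allI impI, elim conjE)
    fix A B q
    assume q: "q \<preceq> p" and A: "q \<tturnstile> subset_fm A (chk w2)" "q \<tturnstile> otp_fm A (chk w1)"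
      and B: "q \<tturnstile> subset_fm B (chk w2)" "q \<tturnstile> otp_fm B (chk w)"
      and less: "\<forall>x. is_name P x \<longrightarrow> (\<forall>y. is_name P y \<longrightarrow> q \<tturnstile> (x \<^bold>\<in> A \<^bold>\<and> y \<^bold>\<in> B \<^bold>\<longrightarrow> x \<^bold>\<in> y))"
    let ?D = "rect_name w2 A B"
    have less': "q \<tturnstile> (\<^bold>\<forall>x. \<^bold>\<forall>y. x \<^bold>\<in> A \<^bold>\<and> y \<^bold>\<in> B \<^bold>\<longrightarrow> x \<^bold>\<in> y)"
      unfolding forces_Forall by (rule less)
    have "q \<tturnstile> image_fm (chk c) ?D (chk \<mu>)"
      unfolding image_fm_def forces_Forall[of q] forces_Iff
    proof (intro allI impI iffI)
      fix y r assume y: "is_name P y" "r \<preceq> q" and "r \<tturnstile> (y \<^bold>\<in> chk \<mu>)"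
      then show "r \<tturnstile> (\<^bold>\<exists>s. s \<^bold>\<in> ?D \<^bold>\<and> app_fm (chk c) s y)" (is "_ \<tturnstile> ?ex")
      proof (elim forces_mem_checkE)
        fix r1 \<nu> assume r1: "r1 \<preceq> r" "\<nu> \<in> elts \<mu>" "r1 \<tturnstile> (y \<^bold>= chk \<nu>)"
        have colour: "\<exists>x\<in>elts A0. \<exists>y\<in>elts B0. x \<noteq> y \<and> vpair (vset {x, y}) \<nu> \<in> elts c"
          if AB: "elts A0 \<subseteq> elts w2" "V_models (otp_fm A0 w1)" "elts B0 \<subseteq> elts w2" "V_models (otp_fm B0 w)"
            "\<forall>x\<in>elts A0. \<forall>y\<in>elts B0. x \<in> elts y" for A0 B0
        proof -
          obtain D0 where D0: "V_models (rect_fm D0 A0 B0)" "V_models (image_fm c D0 \<mu>)"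
            using neg[rule_format, of A0 B0] AB by blast
          obtain s where s: "s \<in> elts D0" "vpair s \<nu> \<in> elts c"
            using D0(2) r1(2) unfolding V_models_image by blast
          then obtain x y where xy: "x \<in> elts A0" "y \<in> elts B0" "x \<noteq> y" "elts s = {x, y}"
            using D0(1) unfolding V_models_rect by blast
          then show ?thesis using s(2) vset_eqI[OF xy(4)] by blast
        qed
        \<comment> \<open>With the colour decided to be \<nu>, a pair of that colour is found below
          every condition stronger than \<open>r1\<close>.\<close>
        show "r1 \<tturnstile> ?ex"
        proof (rule forces_dense)
          fix r2 assume r2: "r2 \<preceq> r1"
          have r2q: "r2 \<preceq> q" using stronger_trans[OF stronger_trans[OF r2 r1(1)] y(2)] .
          note m = forces_mono[OF _ r2q]
          obtain t x z where t: "t \<preceq> r2" "x \<in> elts w2" "z \<in> elts w2" "x \<noteq> z"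
            "t \<tturnstile> (chk x \<^bold>\<in> A)" "t \<tturnstile> (chk z \<^bold>\<in> B)" "vpair (vset {x, z}) \<nu> \<in> elts c"
            using forces_realized_colour[OF w w1 Ord2 colour stronger_cond[OF r2]
                m[OF A(1)] m[OF A(2)] m[OF B(1)] m[OF B(2)] m[OF less']] by blast
          have eq: "t \<tturnstile> (chk \<nu> \<^bold>= y)"
            using forces_sym[OF forces_mono[OF r1(3) stronger_trans[OF t(1) r2]]] .
          have "t \<tturnstile> app_fm (chk c) (chk_pair x z) y"
            by (rule forces_subst[OF fcong_app[OF forces_refl eq] forces_check_appI[OF t(7)] stronger_cond[OF t(1)]])
          moreover have "t \<tturnstile> (chk_pair x z \<^bold>\<in> ?D)"
            using t(2-6) by (rule forces_in_rect_nameI)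
          ultimately have "t \<tturnstile> ?ex"
            by (intro forces_ExistsI[OF is_name_check[of "vset {x, z}"]]) (simp only: forces_Conj)
          then show "\<exists>t. t \<preceq> r2 \<and> t \<tturnstile> ?ex" using t(1) by blast
        qed
      qed
    next
      fix y r assume y: "is_name P y" "r \<preceq> q" and "r \<tturnstile> (\<^bold>\<exists>s. s \<^bold>\<in> ?D \<^bold>\<and> app_fm (chk c) s y)"
      from this(3) show "r \<tturnstile> (y \<^bold>\<in> chk \<mu>)"
      proof (rule forces_ExistsE)
        fix t s assume "is_name P s" "t \<tturnstile> (s \<^bold>\<in> ?D \<^bold>\<and> app_fm (chk c) s y)"
        then show "t \<tturnstile> (y \<^bold>\<in> chk \<mu>)"
          using forces_fun_app_mem[OF c _ _ y(1)] unfolding forces_Conj by blast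
      qed
    qed
    then show "q \<tturnstile> (\<^bold>\<exists>D. rect_fm D A B \<^bold>\<and> image_fm (chk c) D (chk \<mu>))"
      by (intro forces_ExistsI[OF is_name_rect_name[of w2 A B]]) (simp only: forces_Conj forces_rect_name[OF A(1) B(1)])
  qed
  then show ?thesis
    unfolding establishes_fm_def
    by - (rule forces_ExistsI[OF is_name_check[of w]], rule forces_ExistsI[OF is_name_check[of w1]],
        rule forces_ExistsI[OF is_name_check[of w2]], simp only: forces_Conj forces_omega_check[OF w] fw1 fw2 fD)
qed

end

section \<open>The Cohen poset\<close>

lemma le_Fn [simp]: "le (Fn \<kappa>) p q \<longleftrightarrow> elts q \<subseteq> elts p"
  by (simp add: Fn_def)

lemma weakest_Fn [simp]: "weakest (Fn \<kappa>) = vset {}"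
  by (simp add: Fn_def)

lemma conds_Fn:
  "p \<in> conds (Fn \<kappa>) \<longleftrightarrow> finite (elts p) \<and>
     (\<forall>z\<in>elts p. \<exists>\<xi>\<in>elts \<kappa>. \<exists>i\<in>{vset {}, vset {vset {}}}. z = vpair \<xi> i) \<and>
     (\<forall>\<xi> i j. vpair \<xi> i \<in> elts p \<and> vpair \<xi> j \<in> elts p \<longrightarrow> i = j)"
  by (simp add: Fn_def)

lemma elts_vset_Un: "elts (vset (elts x \<union> elts y)) = elts x \<union> elts y"
proof -
  obtain z where z: "elts z = {x, y}" using pairing by blast
  obtain u where "elts u = (\<Union>v\<in>elts z. elts v)" using union by blast
  then have "elts u = elts x \<union> elts y" using z by simp
  then show ?thesis by (rule elts_vset)
qed

lemma small_conds_Fn: "\<exists>x. elts x = conds (Fn \<kappa>)"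
proof -
  obtain T :: 'a where T: "elts T = {vset {}, vset {vset {}}}" using pairing by blast
  have "\<exists>u. elts u = (\<Union>\<xi>\<in>elts \<kappa>. vpair \<xi> ` elts T)" by (intro small_UN replacement)
  then obtain u where u: "elts u = (\<Union>\<xi>\<in>elts \<kappa>. vpair \<xi> ` elts T)" ..
  obtain U where U: "elts U = {z. elts z \<subseteq> elts u}" using powerset by blast
  have "conds (Fn \<kappa>) \<subseteq> elts U"
    unfolding U u T by (auto simp: conds_Fn)
  then show ?thesis using small_subset by blast
qed

lemma forcing_poset_Fn: "forcing_poset (Fn \<kappa>)"
proof
  show "weakest (Fn \<kappa>) \<in> conds (Fn \<kappa>)" by (simp add: conds_Fn elts_vset_empty)
qed (auto simp: elts_vset_empty small_conds_Fn)

text \<open>The union of two finite functions that agree on their common domain is a common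
  extension.\<close>

lemma Fn_compatible:
  assumes p: "p \<in> conds (Fn \<kappa>)" and q: "q \<in> conds (Fn \<kappa>)"
    and agree: "\<And>\<xi> i j. vpair \<xi> i \<in> elts p \<Longrightarrow> vpair \<xi> j \<in> elts q \<Longrightarrow> i = j"
  shows "\<exists>t\<in>conds (Fn \<kappa>). elts p \<subseteq> elts t \<and> elts q \<subseteq> elts t"
proof
  let ?t = "vset (elts p \<union> elts q)"
  show "?t \<in> conds (Fn \<kappa>)"
    unfolding conds_Fn elts_vset_Un
  proof (intro conjI ballI allI impI)
    show "finite (elts p \<union> elts q)" using p q by (simp add: conds_Fn)
    fix z assume "z \<in> elts p \<union> elts q"
    then show "\<exists>\<xi>\<in>elts \<kappa>. \<exists>i\<in>{vset {}, vset {vset {}}}. z = vpair \<xi> i"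
      using p q unfolding conds_Fn by (elim UnE) (blast+)
  next
    fix \<xi> i j assume "vpair \<xi> i \<in> elts p \<union> elts q \<and> vpair \<xi> j \<in> elts p \<union> elts q"
    then show "i = j"
      using p q agree[of \<xi> i j] agree[of \<xi> j i] unfolding conds_Fn by blast
  qed
  show "elts p \<subseteq> elts ?t \<and> elts q \<subseteq> elts ?t" by (simp add: elts_vset_Un)
qed

lemma Fn_subset_cond:
  assumes "p \<in> conds (Fn \<kappa>)" "elts r \<subseteq> elts p"
  shows "r \<in> conds (Fn \<kappa>)"
  using assms finite_subset unfolding conds_Fn by (meson subsetD)

text \<open>
  When all \<open>f x\<close> have size \<open>n\<close>: among the sets that extend \<open>q\<close> and are contained in uncountably many \<open>f x\<close>,
  take \<open>r\<close> of maximal size: each pair outside \<open>r\<close> then belongs to only countably many of these \<open>f x\<close>.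
\<close>

lemma Fn_uncountable_family:
  fixes S :: "'v::zfc set" and f :: "'v \<Rightarrow> 'v"
  assumes S: "uncountable S" and f: "\<forall>x\<in>S. f x \<in> conds (Fn \<kappa>) \<and> elts q \<subseteq> elts (f x)"
  shows "\<exists>r S'. S' \<subseteq> S \<and> uncountable S' \<and> (r \<in> conds (Fn \<kappa>) \<and> elts q \<subseteq> elts r) \<and>
    (\<forall>x\<in>S'. f x \<in> conds (Fn \<kappa>) \<and> elts r \<subseteq> elts (f x)) \<and>
    (\<forall>s. s \<in> conds (Fn \<kappa>) \<and> elts r \<subseteq> elts s \<longrightarrow>
      countable {x \<in> S'. \<not> (\<exists>t\<in>conds (Fn \<kappa>). elts s \<subseteq> elts t \<and> elts (f x) \<subseteq> elts t)})"
proof -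
  \<comment> \<open>Fixing the size of the conditions bounds the size of every set included in one
    of them, so a maximal choice exists.\<close>
  have "S = (\<Union>n. {x \<in> S. card (elts (f x)) = n})" by blast
  then obtain n where n: "uncountable {x \<in> S. card (elts (f x)) = n}"
    using S countable_UN[of UNIV "\<lambda>n. {x \<in> S. card (elts (f x)) = n}"] by auto
  define T where "T R = {x \<in> S. card (elts (f x)) = n \<and> R \<subseteq> elts (f x)}" for R
  define good where "good R \<longleftrightarrow> elts q \<subseteq> R \<and> uncountable (T R)" for R
  have "T (elts q) = {x \<in> S. card (elts (f x)) = n}" using f unfolding T_def by blast
  then have q: "good (elts q)" using n unfolding good_def by simp
  have bound: "card R \<le> n" if "good R" for R
  proof -
    have "T R \<noteq> {}" using that unfolding good_def by auto
    then obtain x where "x \<in> S" "card (elts (f x)) = n" "R \<subseteq> elts (f x)" unfolding T_def by blast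
    moreover have "finite (elts (f x))" using f \<open>x \<in> S\<close> by (simp add: conds_Fn)
    ultimately show ?thesis using card_mono by blast
  qed
  then have "\<exists>R. good R \<and> (\<forall>R'. good R' \<longrightarrow> card R' \<le> card R)"
    by (intro ex_has_greatest_nat[of good _ card "Suc n", OF q]) (simp add: less_Suc_eq_le)
  then obtain R where R: "good R" "\<And>R'. good R' \<Longrightarrow> card R' \<le> card R" by blast
  obtain x where x: "x \<in> T R" using R(1) unfolding good_def by fastforce
  define r where "r = vset R"
  have Rx: "R \<subseteq> elts (f x)" using x unfolding T_def by blast
  then have r: "elts r = R" unfolding r_def by (rule small_subset)
  have fx: "f x \<in> conds (Fn \<kappa>)" using x f unfolding T_def by blast
  have rc: "r \<in> conds (Fn \<kappa>)" by (rule Fn_subset_cond[OF fx]) (simp add: r Rx)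
  then have finR: "finite R" using r unfolding conds_Fn by simp
  have small: "countable {y \<in> T R. z \<in> elts (f y)}" if z: "z \<notin> R" for z
  proof (rule ccontr)
    assume "uncountable {y \<in> T R. z \<in> elts (f y)}"
    moreover have "{y \<in> T R. z \<in> elts (f y)} = T (insert z R)" unfolding T_def by blast
    ultimately have "good (insert z R)" using R(1) unfolding good_def by auto
    then have "card (insert z R) \<le> card R" by (rule R(2))
    then show False using z finR by simp
  qed
  have "countable {y \<in> T R. \<not> (\<exists>t\<in>conds (Fn \<kappa>). elts s \<subseteq> elts t \<and> elts (f y) \<subseteq> elts t)}"
    if s: "s \<in> conds (Fn \<kappa>)" "elts r \<subseteq> elts s" for s
  proof -
    let ?I = "{vset {}, vset {vset {}}} :: 'v set"
    \<comment> \<open>If \<open>f y\<close> is incompatible with \<open>s\<close>, they take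
      different values at some \<xi>. The pair in \<open>f y\<close> is not in \<open>R\<close>,
      because \<open>s\<close> is a function that includes \<open>R\<close>; so only countably many
      \<open>f y\<close> contain it. The finite domain of \<open>s\<close> and the two values leave
      finitely many such pairs.\<close>
    let ?C = "\<Union>i\<in>?I. \<Union>j\<in>?I. \<Union>\<xi>\<in>(\<lambda>\<xi>. vpair \<xi> i) -` elts s. {y \<in> T R. vpair \<xi> j \<notin> R \<and> vpair \<xi> j \<in> elts (f y)}"
    have index: "i \<in> ?I" if "vpair \<xi> i \<in> elts p" "p \<in> conds (Fn \<kappa>)" for \<xi> i p
      using that unfolding conds_Fn by fastforce
    have "{y \<in> T R. \<not> (\<exists>t\<in>conds (Fn \<kappa>). elts s \<subseteq> elts t \<and> elts (f y) \<subseteq> elts t)} \<subseteq> ?C"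
    proof
      fix y assume y: "y \<in> {y \<in> T R. \<not> (\<exists>t\<in>conds (Fn \<kappa>). elts s \<subseteq> elts t \<and> elts (f y) \<subseteq> elts t)}"
      then have fy: "f y \<in> conds (Fn \<kappa>)" using f unfolding T_def by blast
      obtain \<xi> i j where c: "vpair \<xi> i \<in> elts s" "vpair \<xi> j \<in> elts (f y)" "i \<noteq> j"
        using Fn_compatible[OF s(1) fy] y by blast
      have "vpair \<xi> j \<notin> R"
        using s c(1,3) unfolding r conds_Fn by blast
      with y c(1,2) have "\<xi> \<in> (\<lambda>\<xi>. vpair \<xi> i) -` elts s"
        "y \<in> {y \<in> T R. vpair \<xi> j \<notin> R \<and> vpair \<xi> j \<in> elts (f y)}" by simp_all
      then show "y \<in> ?C" using index[OF c(1) s(1)] index[OF c(2) fy] by blast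
    qed
    moreover have "countable ?C"
    proof (intro countable_UN)
      fix i j \<xi>
      show "countable ((\<lambda>\<xi>. vpair \<xi> i) -` elts s)"
        using s(1) by (intro countable_finite finite_vimageI) (simp_all add: conds_Fn inj_on_def)
      show "countable {y \<in> T R. vpair \<xi> j \<notin> R \<and> vpair \<xi> j \<in> elts (f y)}"
        using small[of "vpair \<xi> j"] by (cases "vpair \<xi> j \<in> R") simp_all
    qed simp_all
    ultimately show ?thesis by (rule countable_subset)
  qed
  moreover have "\<forall>y\<in>T R. f y \<in> conds (Fn \<kappa>) \<and> elts r \<subseteq> elts (f y)"
    using f r unfolding T_def by blast
  moreover have "T R \<subseteq> S" unfolding T_def by blast
  moreover have "uncountable (T R)" "elts q \<subseteq> elts r" using R(1) r unfolding good_def by blast+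
  ultimately show ?thesis using rc by blast
qed

lemma strong_ccc_poset_Fn: "strong_ccc_poset (Fn \<kappa>)"
proof (intro strong_ccc_poset.intro strong_ccc_poset_axioms.intro forcing_poset_Fn)
  have stronger: "forcing_poset.stronger (Fn \<kappa>) p q \<longleftrightarrow> p \<in> conds (Fn \<kappa>) \<and> elts q \<subseteq> elts p" for p q
    by (simp add: forcing_poset.stronger_def[OF forcing_poset_Fn])
  have compatible: "(\<exists>t. (t \<in> conds (Fn \<kappa>) \<and> elts p \<subseteq> elts t) \<and> t \<in> conds (Fn \<kappa>) \<and> elts q \<subseteq> elts t) \<longleftrightarrow>
      (\<exists>t\<in>conds (Fn \<kappa>). elts p \<subseteq> elts t \<and> elts q \<subseteq> elts t)" for p q
    by blast
  fix S :: "'a set" and f q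
  assume "uncountable S" "\<forall>x\<in>S. forcing_poset.stronger (Fn \<kappa>) (f x) q"
  then show "\<exists>r S'. S' \<subseteq> S \<and> uncountable S' \<and> forcing_poset.stronger (Fn \<kappa>) r q \<and>
      (\<forall>x\<in>S'. forcing_poset.stronger (Fn \<kappa>) (f x) r) \<and>
      (\<forall>s. forcing_poset.stronger (Fn \<kappa>) s r \<longrightarrow>
        countable {x \<in> S'. \<not> (\<exists>t. forcing_poset.stronger (Fn \<kappa>) t s \<and> forcing_poset.stronger (Fn \<kappa>) t (f x))})"
    unfolding stronger compatible by (rule Fn_uncountable_family)
qed

theorem theorem2p2:
  fixes c \<mu> \<kappa> :: "'v::zfc"
  assumes "V_models (Card_fm \<mu>)"
    and "V_models (\<^bold>\<exists>w1. omega1_fm w1 \<^bold>\<and> (\<mu> \<^bold>\<in> w1 \<^bold>\<or> \<mu> \<^bold>= w1))"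
    and "V_models (Card_fm \<kappa>)"
    and "V_models (establishes_fm c \<mu>)"
  shows "ext_models (Fn \<kappa>) (establishes_fm (check (Fn \<kappa>) c) (check (Fn \<kappa>) \<mu>))"
proof -
  interpret strong_ccc_poset "Fn \<kappa>" by (rule strong_ccc_poset_Fn)
  show ?thesis
    unfolding ext_models_def using forces_establishes_check[OF assms(4)] by blast
qed

end
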